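(* Let $(M,\Delta,g)$ be a $C^{1,1}$ sub-Riemannian manifold of rank $m\ge 1$ (the distribution $\Delta$ is not assumed to be bracket-generating), and let $d$ be its Carnot-Carathéodory distance. Then for every $p\in M$ there exist a neighbourhood $V$ of $p$ (with respect to the manifold topology of $M$) and $\bar r>0$ such that $$\mathrm{diam}(B(q,r))=2r\qquad\text{for every } 0<r<\bar r \text{ and every } q\in V.$$
   Context: Regularity of functions, vector fields, etc. on a smooth manifold is understood in charts with respect to the usual (Euclidean) manifold structure; a $C^{1,1}$ object is a $C^1$ object whose first-order derivatives are, in charts, locally Lipschitz continuous. An $n$-dimensional $C^{1,1}$ sub-Riemannian manifold of rank $m$ is a triple $(M,\Delta,g)$ where: $M$ is a connected smooth manifold of dimension $n$; $\Delta=\sqcup_{p\in M}\Delta_p$ is a $C^{1,1}$ distribution, i.e. a map $p\mapsto\Delta_p$ assigning to each $p\in M$ an $m$-dimensional vector subspace $\Delta_p$ of $T_pM$, of class $C^{1,1}$ (locally spanned by $m$ vector fields of class $C^{1,1}$); $g$ is a $C^{1,1}$ metric on $\Delta$ (an inner product $g_p$ on each $\Delta_p$, depending on $p$ in a $C^{1,1}$ way). Equivalently, near every point there are $C^{1,1}$ vector fields $X_1,\dots,X_m$ forming a $g$-orthonormal frame of $\Delta$. For $v\in\Delta_p$ set $|v|_p=\sqrt{g_p(v,v)}$. No bracket-generating condition is imposed. An admissible curve joining $p$ and $q$ is an absolutely continuous curve $\gamma:[a,b]\to M$ with $\gamma(a)=p$, $\gamma(b)=q$ and $\dot\gamma(t)\in\Delta_{\gamma(t)}$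 for a.e. $t\in[a,b]$. Its length is $L(\gamma)=\int_a^b|\dot\gamma(t)|_{\gamma(t)}\,dt$. The Carnot-Carathéodory distance is $d(p,q)=\inf\{L(\gamma):\gamma\text{ is an admissible curve joining }p\text{ and }q\}$, with $\inf\emptyset=+\infty$ (so $d$ takes values in $[0,+\infty]$). $B(q,r)=\{x\in M: d(q,x)<r\}$ is the open ball for $d$, and $\mathrm{diam}(E)=\sup\{d(x,y):x,y\in E\}$. *)

theory Defs
  imports "HOL-Analysis.Analysis"
begin

section \<open>Regularity in Euclidean space\<close>

text \<open>The next three predicates are meant for open \<open>S\<close>; derivatives are taken in all
  directions \<open>v\<close>.\<close>

primrec Ck_on :: "nat \<Rightarrow> ('e::real_normed_vector \<Rightarrow> 'f::real_normed_vector) \<Rightarrow> 'e set \<Rightarrow> bool" where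
  "Ck_on 0 f S \<longleftrightarrow> continuous_on S f"
| "Ck_on (Suc k) f S \<longleftrightarrow> (\<forall>x\<in>S. f differentiable (at x)) \<and>
     (\<forall>v. Ck_on k (\<lambda>x. frechet_derivative f (at x) v) S)"

definition smooth_on :: "('e::real_normed_vector \<Rightarrow> 'f::real_normed_vector) \<Rightarrow> 'e set \<Rightarrow> bool" where
  "smooth_on f S \<longleftrightarrow> (\<forall>k. Ck_on k f S)"

definition locally_lipschitz_on :: "('e::metric_space \<Rightarrow> 'f::metric_space) \<Rightarrow> 'e set \<Rightarrow> bool" where
  "locally_lipschitz_on f S \<longleftrightarrow> (\<forall>x\<in>S. \<exists>e>0. \<exists>L. L-lipschitz_on (ball x e \<inter> S) f)"

definition C11_on :: "('e::real_normed_vector \<Rightarrow> 'f::real_normed_vector) \<Rightarrow> 'e set \<Rightarrow> bool" where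
  "C11_on f S \<longleftrightarrow> Ck_on 1 f S \<and>
     (\<forall>v. locally_lipschitz_on (\<lambda>x. frechet_derivative f (at x) v) S)"

definition abs_continuous_on_interval :: "real \<Rightarrow> real \<Rightarrow> (real \<Rightarrow> 'e::real_normed_vector) \<Rightarrow> bool" where
  "abs_continuous_on_interval a b f \<longleftrightarrow>
     (\<forall>\<epsilon>>0. \<exists>\<delta>>0. \<forall>(N::nat) (s::nat \<Rightarrow> real) (t::nat \<Rightarrow> real).
        (\<forall>i<N. a \<le> s i \<and> s i \<le> t i \<and> t i \<le> b) \<longrightarrow>
        (\<forall>i<N. \<forall>j<N. i \<noteq> j \<longrightarrow> {s i<..<t i} \<inter> {s j<..<t j} = {}) \<longrightarrow>
        (\<Sum>i<N. t i - s i) < \<delta> \<longrightarrow>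
        (\<Sum>i<N. norm (f (t i) - f (s i))) < \<epsilon>)"


section \<open>Smooth manifolds\<close>

text \<open>A manifold is an abstract topology \<open>M\<close> with an atlas \<open>A\<close>, not necessarily maximal. Its
  dimension is \<open>DIM('e)\<close>. A chart is a pair \<open>(U, \<phi>)\<close>; the values of \<open>\<phi>\<close> outside \<open>U\<close> are junk.\<close>

type_synonym ('a, 'e) chart = "'a set \<times> ('a \<Rightarrow> 'e)"

definition chart_inv :: "('a, 'e) chart \<Rightarrow> 'e \<Rightarrow> 'a" where
  "chart_inv c = inv_into (fst c) (snd c)"

definition transition :: "('a, 'e) chart \<Rightarrow> ('a, 'e) chart \<Rightarrow> 'e \<Rightarrow> 'e" where
  "transition c c' = (\<lambda>x. snd c' (chart_inv c x))"

definition smooth_atlas :: "'a topology \<Rightarrow> ('a, 'e::euclidean_space) chart set \<Rightarrow> bool" where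
  "smooth_atlas M A \<longleftrightarrow>
     (\<forall>(U, \<phi>)\<in>A. openin M U \<and> open (\<phi> ` U) \<and>
        homeomorphic_map (subtopology M U) (top_of_set (\<phi> ` U)) \<phi>) \<and>
     (\<Union>c\<in>A. fst c) = topspace M \<and>
     (\<forall>c\<in>A. \<forall>c'\<in>A. smooth_on (transition c c') (snd c ` (fst c \<inter> fst c')))"

definition smooth_manifold :: "'a topology \<Rightarrow> ('a, 'e::euclidean_space) chart set \<Rightarrow> bool" where
  "smooth_manifold M A \<longleftrightarrow> Hausdorff_space M \<and> second_countable M \<and> smooth_atlas M A"


section \<open>Tangent vectors\<close>

text \<open>A tangent vector at \<open>p\<close> is its family of coordinate vectors in the charts around \<open>p\<close>, subject
  to the usual transformation law. Such families live in the following real vector space, a copy of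
  the function space with pointwise operations, introduced as a new type only so that it can be an
  instance of class \<open>real_vector\<close>.\<close>

typedef ('a, 'e) tvec = "UNIV :: (('a, 'e) chart \<Rightarrow> 'e) set"
  morphisms coords Tvec ..

setup_lifting type_definition_tvec

instantiation tvec :: (type, real_vector) real_vector
begin

lift_definition zero_tvec :: "('a, 'b) tvec" is "\<lambda>c. 0" .
lift_definition plus_tvec :: "('a, 'b) tvec \<Rightarrow> ('a, 'b) tvec \<Rightarrow> ('a, 'b) tvec"
  is "\<lambda>v w c. v c + w c" .
lift_definition minus_tvec :: "('a, 'b) tvec \<Rightarrow> ('a, 'b) tvec \<Rightarrow> ('a, 'b) tvec"
  is "\<lambda>v w c. v c - w c" .
lift_definition uminus_tvec :: "('a, 'b) tvec \<Rightarrow> ('a, 'b) tvec"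
  is "\<lambda>v c. - v c" .
lift_definition scaleR_tvec :: "real \<Rightarrow> ('a, 'b) tvec \<Rightarrow> ('a, 'b) tvec"
  is "\<lambda>r v c. r *\<^sub>R v c" .

instance
  by standard (transfer; simp add: algebra_simps)+

end

text \<open>The second condition, vanishing at the charts that do not contain \<open>p\<close>, makes the family
  representing a given tangent vector unique.\<close>

definition tangent_space :: "('a, 'e::euclidean_space) chart set \<Rightarrow> 'a \<Rightarrow> ('a, 'e) tvec set" where
  "tangent_space A p = {v.
     (\<forall>c\<in>A. \<forall>c'\<in>A. p \<in> fst c \<inter> fst c' \<longrightarrow>
        coords v c' = frechet_derivative (transition c c') (at (snd c p)) (coords v c)) \<and>
     (\<forall>c. \<not> (c \<in> A \<and> p \<in> fst c) \<longrightarrow> coords v c = 0)}"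

definition C11_function ::
    "('a, 'e::euclidean_space) chart set \<Rightarrow> 'a set \<Rightarrow> ('a \<Rightarrow> real) \<Rightarrow> bool" where
  "C11_function A W f \<longleftrightarrow>
     (\<forall>c\<in>A. C11_on (\<lambda>x. f (chart_inv c x)) (snd c ` (fst c \<inter> W)))"

definition C11_vector_field ::
    "('a, 'e::euclidean_space) chart set \<Rightarrow> 'a set \<Rightarrow> ('a \<Rightarrow> ('a, 'e) tvec) \<Rightarrow> bool" where
  "C11_vector_field A W X \<longleftrightarrow>
     (\<forall>p\<in>W. X p \<in> tangent_space A p) \<and>
     (\<forall>c\<in>A. C11_on (\<lambda>x. coords (X (chart_inv c x)) c) (snd c ` (fst c \<inter> W)))"


section \<open>Sub-Riemannian manifolds\<close>

definition C11_distribution ::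
    "'a topology \<Rightarrow> ('a, 'e::euclidean_space) chart set \<Rightarrow> nat \<Rightarrow> ('a \<Rightarrow> ('a, 'e) tvec set) \<Rightarrow> bool" where
  "C11_distribution M A m \<Delta> \<longleftrightarrow>
     (\<forall>p\<in>topspace M. \<Delta> p \<subseteq> tangent_space A p \<and> subspace (\<Delta> p) \<and> dim (\<Delta> p) = m) \<and>
     (\<forall>p\<in>topspace M. \<exists>W X. openin M W \<and> p \<in> W \<and>
        (\<forall>i<m. C11_vector_field A W (X i)) \<and>
        (\<forall>q\<in>W. \<Delta> q = span ((\<lambda>i. X i q) ` {..<m})))"

definition inner_product_on :: "'v::real_vector set \<Rightarrow> ('v \<Rightarrow> 'v \<Rightarrow> real) \<Rightarrow> bool" where
  "inner_product_on S b \<longleftrightarrow>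
     (\<forall>u\<in>S. \<forall>v\<in>S. b u v = b v u) \<and>
     (\<forall>u\<in>S. \<forall>v\<in>S. \<forall>w\<in>S. b (u + v) w = b u w + b v w) \<and>
     (\<forall>r. \<forall>u\<in>S. \<forall>v\<in>S. b (r *\<^sub>R u) v = r * b u v) \<and>
     (\<forall>v\<in>S. v \<noteq> 0 \<longrightarrow> 0 < b v v)"

text \<open>A metric is of class \<open>C\<^sup>1\<^sup>,\<^sup>1\<close> if its values on local sections of \<open>\<Delta>\<close> of class
  \<open>C\<^sup>1\<^sup>,\<^sup>1\<close> are. The values of \<open>g p\<close> off \<open>\<Delta> p\<close> are junk.\<close>

definition C11_metric ::
    "'a topology \<Rightarrow> ('a, 'e::euclidean_space) chart set \<Rightarrow> ('a \<Rightarrow> ('a, 'e) tvec set) \<Rightarrow>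
     ('a \<Rightarrow> ('a, 'e) tvec \<Rightarrow> ('a, 'e) tvec \<Rightarrow> real) \<Rightarrow> bool" where
  "C11_metric M A \<Delta> g \<longleftrightarrow>
     (\<forall>p\<in>topspace M. inner_product_on (\<Delta> p) (g p)) \<and>
     (\<forall>W X Y. openin M W \<longrightarrow> C11_vector_field A W X \<longrightarrow> C11_vector_field A W Y \<longrightarrow>
        (\<forall>p\<in>W. X p \<in> \<Delta> p \<and> Y p \<in> \<Delta> p) \<longrightarrow>
        C11_function A W (\<lambda>p. g p (X p) (Y p)))"

definition C11_sub_riemannian_manifold ::
    "'a topology \<Rightarrow> ('a, 'e::euclidean_space) chart set \<Rightarrow> nat \<Rightarrow> ('a \<Rightarrow> ('a, 'e) tvec set) \<Rightarrow>
     ('a \<Rightarrow> ('a, 'e) tvec \<Rightarrow> ('a, 'e) tvec \<Rightarrow> real) \<Rightarrow> bool" where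
  "C11_sub_riemannian_manifold M A m \<Delta> g \<longleftrightarrow>
     smooth_manifold M A \<and> connected_space M \<and> C11_distribution M A m \<Delta> \<and> C11_metric M A \<Delta> g"


section \<open>Admissible curves and the Carnot-Caratheodory distance\<close>

definition abs_continuous_curve ::
    "'a topology \<Rightarrow> ('a, 'e::euclidean_space) chart set \<Rightarrow> real \<Rightarrow> real \<Rightarrow> (real \<Rightarrow> 'a) \<Rightarrow> bool" where
  "abs_continuous_curve M A a b \<gamma> \<longleftrightarrow>
     continuous_map (top_of_set {a..b}) M \<gamma> \<and>
     (\<forall>c\<in>A. \<forall>s t. a \<le> s \<and> s \<le> t \<and> t \<le> b \<and> \<gamma> ` {s..t} \<subseteq> fst c \<longrightarrow>
        abs_continuous_on_interval s t (snd c \<circ> \<gamma>))"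

definition has_velocity ::
    "('a, 'e::euclidean_space) chart set \<Rightarrow> real set \<Rightarrow> (real \<Rightarrow> 'a) \<Rightarrow> ('a, 'e) tvec \<Rightarrow> real \<Rightarrow> bool" where
  "has_velocity A I \<gamma> v t \<longleftrightarrow> v \<in> tangent_space A (\<gamma> t) \<and>
     (\<forall>c\<in>A. \<gamma> t \<in> fst c \<longrightarrow>
        ((snd c \<circ> \<gamma>) has_vector_derivative coords v c) (at t within I))"

definition velocity ::
    "('a, 'e::euclidean_space) chart set \<Rightarrow> real set \<Rightarrow> (real \<Rightarrow> 'a) \<Rightarrow> real \<Rightarrow> ('a, 'e) tvec" where
  "velocity A I \<gamma> t = (THE v. has_velocity A I \<gamma> v t)"

definition admissible_curve ::
    "'a topology \<Rightarrow> ('a, 'e::euclidean_space) chart set \<Rightarrow> ('a \<Rightarrow> ('a, 'e) tvec set) \<Rightarrow>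
     real \<Rightarrow> real \<Rightarrow> (real \<Rightarrow> 'a) \<Rightarrow> bool" where
  "admissible_curve M A \<Delta> a b \<gamma> \<longleftrightarrow> a < b \<and> abs_continuous_curve M A a b \<gamma> \<and>
     (AE t in lebesgue. t \<in> {a..b} \<longrightarrow> (\<exists>v\<in>\<Delta> (\<gamma> t). has_velocity A {a..b} \<gamma> v t))"

definition curve_length ::
    "('a, 'e::euclidean_space) chart set \<Rightarrow> ('a \<Rightarrow> ('a, 'e) tvec \<Rightarrow> ('a, 'e) tvec \<Rightarrow> real) \<Rightarrow>
     real \<Rightarrow> real \<Rightarrow> (real \<Rightarrow> 'a) \<Rightarrow> ennreal" where
  "curve_length A g a b \<gamma> =
     (\<integral>\<^sup>+t\<in>{a..b}. ennreal (sqrt (g (\<gamma> t) (velocity A {a..b} \<gamma> t) (velocity A {a..b} \<gamma> t))) \<partial>lebesgue)"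

definition cc_dist ::
    "'a topology \<Rightarrow> ('a, 'e::euclidean_space) chart set \<Rightarrow> ('a \<Rightarrow> ('a, 'e) tvec set) \<Rightarrow>
     ('a \<Rightarrow> ('a, 'e) tvec \<Rightarrow> ('a, 'e) tvec \<Rightarrow> real) \<Rightarrow> 'a \<Rightarrow> 'a \<Rightarrow> ennreal" where
  "cc_dist M A \<Delta> g p q =
     Inf {curve_length A g a b \<gamma> | a b \<gamma>. admissible_curve M A \<Delta> a b \<gamma> \<and> \<gamma> a = p \<and> \<gamma> b = q}"

definition cc_ball ::
    "'a topology \<Rightarrow> ('a, 'e::euclidean_space) chart set \<Rightarrow> ('a \<Rightarrow> ('a, 'e) tvec set) \<Rightarrow>
     ('a \<Rightarrow> ('a, 'e) tvec \<Rightarrow> ('a, 'e) tvec \<Rightarrow> real) \<Rightarrow> 'a \<Rightarrow> real \<Rightarrow> 'a set" where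
  "cc_ball M A \<Delta> g q r = {x \<in> topspace M. cc_dist M A \<Delta> g q x < ennreal r}"

definition cc_diameter ::
    "'a topology \<Rightarrow> ('a, 'e::euclidean_space) chart set \<Rightarrow> ('a \<Rightarrow> ('a, 'e) tvec set) \<Rightarrow>
     ('a \<Rightarrow> ('a, 'e) tvec \<Rightarrow> ('a, 'e) tvec \<Rightarrow> real) \<Rightarrow> 'a set \<Rightarrow> ennreal" where
  "cc_diameter M A \<Delta> g E = (SUP (x, y)\<in>E \<times> E. cc_dist M A \<Delta> g x y)"

end

theory Submission
  imports Defs
begin

text \<open>
  The inequality \<open>diam B(q, r) \<le> 2 r\<close> is the triangle inequality, that is, reversal and concatenation of
  admissible curves. For the converse it suffices to find, for every \<open>q\<close> near \<open>p\<close>, a curve \<open>\<gamma>\<close> on a time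
  interval \<open>[-T, T]\<close> independent of \<open>q\<close>, with \<open>\<gamma> 0 = q\<close> and of unit speed, such that no curve from
  \<open>\<gamma> (-s)\<close> to \<open>\<gamma> s\<close> is shorter than \<open>2 s\<close>.

  Gram-Schmidt (lemma \<open>ex_orthonormal_frame\<close>) provides an orthonormal frame \<open>y 0, ..., y (m - 1)\<close> of class
  $C^{1,1}$. The curve \<open>\<gamma>\<close> is a normal extremal: with a covector \<open>\<eta>\<close> it solves Hamilton's equations for
  \<open>H = (\<Sum>i<m. (\<eta> \<bullet> y i)\<^sup>2) / 2\<close> on the level \<open>H = 1/2\<close>. The Hamiltonian vector field is locally Lipschitz, so
  that Picard's theorem gives a uniform existence time (lemma \<open>extremals_exist\<close>).

  That \<open>\<gamma>\<close> is minimising is shown by a calibration: a function \<open>S\<close> near \<open>q\<close> with \<open>S (\<gamma> t) = t\<close> and with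
  \<open>dS(v) \<le> |v|\<close> for all horizontal vectors \<open>v\<close>. Solving the eikonal equation is not necessary, because only an
  inequality is required off \<open>\<gamma>\<close>. Let \<open>t(x)\<close> be the time at which \<open>\<gamma>\<close> meets the hyperplane through \<open>x\<close>
  parallel to a fixed one, and let \<open>e = x - \<gamma>(t(x))\<close>. The function \<open>t + \<eta>(t) \<bullet> e\<close> satisfies the eikonal
  equation up to an error of order \<open>|e|\<^sup>2\<close>, and subtracting \<open>K t |e|\<^sup>2\<close> with a large \<open>K\<close> turns this into the
  wanted inequality for small \<open>t\<close> and \<open>e\<close> (lemmas \<open>calibration_inequality\<close> and \<open>extremals_calibrated\<close>).
  The quadratic order of the error is exactly what class $C^{1,1}$ guarantees, and all constants are
  locally uniform.

  Finally, \<open>S\<close> is integrated along an arbitrary competing curve. Competitors are only absolutely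
  continuous, so this needs the fundamental theorem of calculus in that generality
  (lemma \<open>absolutely_continuous_has_integral\<close>). A competitor that leaves the domain of \<open>S\<close> is long
  (lemma \<open>short_curve_stays\<close>).
\<close>

section \<open>Calculus of $C^{1,1}$ functions\<close>

text \<open>Bounded Lipschitz functions are closed under products, which Lipschitz functions are not. Locally
  the two notions agree.\<close>

definition bounded_lipschitz_on :: "('a::metric_space \<Rightarrow> 'b::real_normed_vector) \<Rightarrow> 'a set \<Rightarrow> bool" where
  "bounded_lipschitz_on f S \<longleftrightarrow> (\<exists>L B. L-lipschitz_on S f \<and> (\<forall>x\<in>S. norm (f x) \<le> B))"

lemma bounded_lipschitz_onI:
  assumes "\<And>x y. x \<in> S \<Longrightarrow> y \<in> S \<Longrightarrow> norm (f x - f y) \<le> L * dist x y"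
    and "\<And>x. x \<in> S \<Longrightarrow> norm (f x) \<le> B"
  shows "bounded_lipschitz_on f S"
proof -
  have "(max L 0)-lipschitz_on S f"
  proof (rule lipschitz_onI)
    fix x y assume "x \<in> S" "y \<in> S"
    then have "norm (f x - f y) \<le> L * dist x y" by (rule assms)
    also have "\<dots> \<le> max L 0 * dist x y" by (intro mult_right_mono) auto
    finally show "dist (f x) (f y) \<le> max L 0 * dist x y" by (simp add: dist_norm)
  qed simp
  then show ?thesis using assms(2) unfolding bounded_lipschitz_on_def by blast
qed

lemma bounded_lipschitz_onE:
  assumes "bounded_lipschitz_on f S"
  obtains B where "B \<ge> 0" "\<And>x. x \<in> S \<Longrightarrow> norm (f x) \<le> B"
    "\<And>x y. x \<in> S \<Longrightarrow> y \<in> S \<Longrightarrow> norm (f x - f y) \<le> B * dist x y"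
proof -
  obtain L B where L: "L-lipschitz_on S f" and B: "\<forall>x\<in>S. norm (f x) \<le> B"
    using assms unfolding bounded_lipschitz_on_def by blast
  show thesis
  proof (rule that[of "max L (max B 0)"])
    fix x y assume "x \<in> S" "y \<in> S"
    then have "norm (f x - f y) \<le> L * dist x y"
      using lipschitz_onD[OF L] by (simp add: dist_norm)
    also have "\<dots> \<le> max L (max B 0) * dist x y" by (intro mult_right_mono) auto
    finally show "norm (f x - f y) \<le> max L (max B 0) * dist x y" .
  qed (use B in force)+
qed

lemma bounded_lipschitz_on_subset:
  "bounded_lipschitz_on f S \<Longrightarrow> T \<subseteq> S \<Longrightarrow> bounded_lipschitz_on f T"
  unfolding bounded_lipschitz_on_def by (blast intro: lipschitz_on_subset)

lemma bounded_lipschitz_on_const: "bounded_lipschitz_on (\<lambda>x. c) S"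
  by (rule bounded_lipschitz_onI[of _ _ 0 "norm c"]) auto

lemma bounded_lipschitz_on_bilinear:
  assumes bl: "bounded_bilinear (pr :: 'b::real_normed_vector \<Rightarrow> 'c::real_normed_vector \<Rightarrow> 'd::real_normed_vector)"
    and f: "bounded_lipschitz_on f S" and g: "bounded_lipschitz_on g S"
  shows "bounded_lipschitz_on (\<lambda>x. pr (f x) (g x)) S"
proof -
  interpret bounded_bilinear pr by (rule bl)
  obtain F where F: "F \<ge> 0" "\<And>x. x \<in> S \<Longrightarrow> norm (f x) \<le> F"
    "\<And>x y. x \<in> S \<Longrightarrow> y \<in> S \<Longrightarrow> norm (f x - f y) \<le> F * dist x y"
    by (rule bounded_lipschitz_onE[OF f]) blast
  obtain G where G: "G \<ge> 0" "\<And>x. x \<in> S \<Longrightarrow> norm (g x) \<le> G"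
    "\<And>x y. x \<in> S \<Longrightarrow> y \<in> S \<Longrightarrow> norm (g x - g y) \<le> G * dist x y"
    by (rule bounded_lipschitz_onE[OF g]) blast
  obtain K where K: "K > 0" "\<And>a b. norm (pr a b) \<le> norm a * norm b * K"
    using pos_bounded by blast
  show ?thesis
  proof (rule bounded_lipschitz_onI)
    fix x assume x: "x \<in> S"
    have "norm (pr (f x) (g x)) \<le> norm (f x) * norm (g x) * K" by (rule K)
    also have "\<dots> \<le> F * G * K"
      using F(2)[OF x] G(2)[OF x] F(1) G(1) K(1) by (intro mult_mono) auto
    finally show "norm (pr (f x) (g x)) \<le> F * G * K" .
  next
    fix x y assume xy: "x \<in> S" "y \<in> S"
    have "pr (f x) (g x) - pr (f y) (g y) = pr (f x - f y) (g x) + pr (f y) (g x - g y)"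
      by (simp add: diff_left diff_right)
    also have "norm \<dots> \<le> norm (pr (f x - f y) (g x)) + norm (pr (f y) (g x - g y))"
      by (rule norm_triangle_ineq)
    also have "\<dots> \<le> norm (f x - f y) * norm (g x) * K + norm (f y) * norm (g x - g y) * K"
      by (intro add_mono K)
    also have "\<dots> \<le> (F * dist x y) * G * K + F * (G * dist x y) * K"
      using F(2)[OF xy(2)] F(3)[OF xy] G(2)[OF xy(1)] G(3)[OF xy] F(1) G(1) K(1)
      by (intro add_mono mult_mono) auto
    also have "\<dots> = (2 * F * G * K) * dist x y" by (simp add: algebra_simps)
    finally show "norm (pr (f x) (g x) - pr (f y) (g y)) \<le> (2 * F * G * K) * dist x y" .
  qed
qed

lemmas bounded_lipschitz_on_scaleR = bounded_lipschitz_on_bilinear[OF bounded_bilinear_scaleR]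
lemmas bounded_lipschitz_on_inner = bounded_lipschitz_on_bilinear[OF bounded_bilinear_inner]

lemma bounded_lipschitz_on_linear:
  assumes "bounded_linear h" "bounded_lipschitz_on f S"
  shows "bounded_lipschitz_on (\<lambda>x. h (f x)) S"
proof -
  have "bounded_lipschitz_on (\<lambda>x. (\<lambda>(r::real) a. r *\<^sub>R h a) 1 (f x)) S"
    by (rule bounded_lipschitz_on_bilinear[where pr="\<lambda>(r::real) a. r *\<^sub>R h a"])
      (use bounded_bilinear.comp[OF bounded_bilinear_scaleR bounded_linear_ident assms(1)] assms(2)
        in \<open>auto intro: bounded_lipschitz_on_const\<close>)
  then show ?thesis by simp
qed

lemma bounded_lipschitz_on_add:
  assumes f: "bounded_lipschitz_on f S" and g: "bounded_lipschitz_on g S"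
  shows "bounded_lipschitz_on (\<lambda>x. f x + g x) S"
proof -
  obtain F where F: "F \<ge> 0" "\<And>x. x \<in> S \<Longrightarrow> norm (f x) \<le> F"
    "\<And>x y. x \<in> S \<Longrightarrow> y \<in> S \<Longrightarrow> norm (f x - f y) \<le> F * dist x y"
    by (rule bounded_lipschitz_onE[OF f]) blast
  obtain G where G: "G \<ge> 0" "\<And>x. x \<in> S \<Longrightarrow> norm (g x) \<le> G"
    "\<And>x y. x \<in> S \<Longrightarrow> y \<in> S \<Longrightarrow> norm (g x - g y) \<le> G * dist x y"
    by (rule bounded_lipschitz_onE[OF g]) blast
  show ?thesis
  proof (rule bounded_lipschitz_onI)
    fix x assume x: "x \<in> S"
    show "norm (f x + g x) \<le> F + G"
      using F(2)[OF x] G(2)[OF x] norm_triangle_ineq[of "f x" "g x"] by linarith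
  next
    fix x y assume xy: "x \<in> S" "y \<in> S"
    have "norm (f x + g x - (f y + g y)) \<le> norm (f x - f y) + norm (g x - g y)"
      by (metis add_diff_add norm_triangle_ineq)
    also have "\<dots> \<le> (F + G) * dist x y"
      using F(3)[OF xy] G(3)[OF xy] by (simp add: algebra_simps)
    finally show "norm (f x + g x - (f y + g y)) \<le> (F + G) * dist x y" .
  qed
qed

lemma bounded_lipschitz_on_minus:
  "bounded_lipschitz_on f S \<Longrightarrow> bounded_lipschitz_on (\<lambda>x. - f x) S"
  using bounded_lipschitz_on_linear[of uminus f S] by (simp add: bounded_linear_minus bounded_linear_ident)

lemma bounded_lipschitz_on_sum:
  assumes "\<And>i. i \<in> I \<Longrightarrow> bounded_lipschitz_on (f i) S"
  shows "bounded_lipschitz_on (\<lambda>x. \<Sum>i\<in>I. f i x) S"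
  using assms
  by (induction I rule: infinite_finite_induct)
    (auto intro: bounded_lipschitz_on_const bounded_lipschitz_on_add)

lemma bounded_lipschitz_on_Pair:
  assumes f: "bounded_lipschitz_on f S" and g: "bounded_lipschitz_on g S"
  shows "bounded_lipschitz_on (\<lambda>x. (f x, g x)) S"
proof -
  have "bounded_lipschitz_on (\<lambda>x. (f x, 0) + (0, g x)) S"
    by (intro bounded_lipschitz_on_add bounded_lipschitz_on_linear[OF _ f] bounded_lipschitz_on_linear[OF _ g]
       bounded_linear_Pair bounded_linear_zero bounded_linear_ident)
  then show ?thesis by simp
qed

lemma bounded_lipschitz_on_id:
  assumes "bounded S" shows "bounded_lipschitz_on (\<lambda>x::'a::real_normed_vector. x) S"
proof -
  obtain B where "\<forall>x\<in>S. norm x \<le> B" using assms bounded_iff by blast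
  then show ?thesis by (intro bounded_lipschitz_onI[of _ _ 1 B]) (auto simp: dist_norm)
qed

lemma locally_lipschitz_on_iff_bounded_lipschitz:
  fixes f :: "'a::metric_space \<Rightarrow> 'b::real_normed_vector"
  shows "locally_lipschitz_on f S \<longleftrightarrow> (\<forall>x\<in>S. \<exists>e>0. bounded_lipschitz_on f (ball x e \<inter> S))"
    (is "?L \<longleftrightarrow> ?R")
proof
  assume ?R
  then show ?L unfolding locally_lipschitz_on_def bounded_lipschitz_on_def by blast
next
  assume L: ?L
  show ?R
  proof
    fix x assume x: "x \<in> S"
    then obtain e L where eL: "e > 0" "L-lipschitz_on (ball x e \<inter> S) f"
      using L unfolding locally_lipschitz_on_def by blast
    have "norm (f y) \<le> norm (f x) + L * e" if y: "y \<in> ball x e \<inter> S" for y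
    proof -
      have "norm (f y - f x) \<le> L * dist y x"
        using lipschitz_onD[OF eL(2) y, of x] x eL(1) by (auto simp: dist_norm)
      also have "\<dots> \<le> L * e"
        using y lipschitz_on_nonneg[OF eL(2)] by (intro mult_left_mono) (auto simp: dist_commute)
      finally show ?thesis using norm_triangle_sub[of "f y" "f x"] by linarith
    qed
    then show "\<exists>e>0. bounded_lipschitz_on f (ball x e \<inter> S)"
      using eL unfolding bounded_lipschitz_on_def by blast
  qed
qed

lemma locally_lipschitz_on_bilinear:
  fixes f :: "'a::metric_space \<Rightarrow> 'b::real_normed_vector" and g :: "'a \<Rightarrow> 'c::real_normed_vector"
    and pr :: "'b \<Rightarrow> 'c \<Rightarrow> 'd::real_normed_vector"
  assumes "bounded_bilinear pr" "locally_lipschitz_on f S" "locally_lipschitz_on g S"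
  shows "locally_lipschitz_on (\<lambda>x. pr (f x) (g x)) S"
  unfolding locally_lipschitz_on_iff_bounded_lipschitz
proof
  fix x assume x: "x \<in> S"
  obtain e where e: "e > 0" "bounded_lipschitz_on f (ball x e \<inter> S)"
    using assms(2) x unfolding locally_lipschitz_on_iff_bounded_lipschitz by blast
  obtain d where d: "d > 0" "bounded_lipschitz_on g (ball x d \<inter> S)"
    using assms(3) x unfolding locally_lipschitz_on_iff_bounded_lipschitz by blast
  show "\<exists>e>0. bounded_lipschitz_on (\<lambda>x. pr (f x) (g x)) (ball x e \<inter> S)"
    using e d
    by (intro exI[of _ "min d e"] conjI bounded_lipschitz_on_bilinear[OF assms(1)]
      bounded_lipschitz_on_subset[OF e(2)] bounded_lipschitz_on_subset[OF d(2)]) auto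
qed

lemma locally_lipschitz_on_add:
  fixes f g :: "'a::metric_space \<Rightarrow> 'b::real_normed_vector"
  assumes "locally_lipschitz_on f S" "locally_lipschitz_on g S"
  shows "locally_lipschitz_on (\<lambda>x. f x + g x) S"
  unfolding locally_lipschitz_on_iff_bounded_lipschitz
proof
  fix x assume x: "x \<in> S"
  obtain e where e: "e > 0" "bounded_lipschitz_on f (ball x e \<inter> S)"
    using assms(1) x unfolding locally_lipschitz_on_iff_bounded_lipschitz by blast
  obtain d where d: "d > 0" "bounded_lipschitz_on g (ball x d \<inter> S)"
    using assms(2) x unfolding locally_lipschitz_on_iff_bounded_lipschitz by blast
  show "\<exists>e>0. bounded_lipschitz_on (\<lambda>x. f x + g x) (ball x e \<inter> S)"
    using e d
    by (intro exI[of _ "min d e"] conjI bounded_lipschitz_on_add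
      bounded_lipschitz_on_subset[OF e(2)] bounded_lipschitz_on_subset[OF d(2)]) auto
qed

lemma locally_lipschitz_on_cong:
  assumes "\<And>x. x \<in> S \<Longrightarrow> f x = g x" "locally_lipschitz_on f S"
  shows "locally_lipschitz_on g S"
proof -
  have "L-lipschitz_on (ball x e \<inter> S) f \<longleftrightarrow> L-lipschitz_on (ball x e \<inter> S) g" for L x e
    by (rule lipschitz_on_cong) (use assms(1) in auto)
  then show ?thesis using assms(2) unfolding locally_lipschitz_on_def by blast
qed

lemma locally_lipschitz_imp_continuous_on:
  fixes f :: "'a::metric_space \<Rightarrow> 'b::metric_space"
  assumes "locally_lipschitz_on f S" shows "continuous_on S f"
proof (rule continuous_on_eq_continuous_within[THEN iffD2], rule ballI)
  fix x assume x: "x \<in> S"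
  then obtain e L where eL: "e > 0" "L-lipschitz_on (ball x e \<inter> S) f"
    using assms unfolding locally_lipschitz_on_def by blast
  have "continuous (at x within ball x e \<inter> S) f"
    by (rule lipschitz_on_continuous_within[OF eL(2)]) (use x eL in auto)
  then show "continuous (at x within S) f"
    using eL(1) at_within_nhd[of x "ball x e" "ball x e \<inter> S" S]
    by (auto simp: continuous_within Int_ac)
qed

lemma C11_onD:
  assumes "C11_on f S"
  shows "x \<in> S \<Longrightarrow> (f has_derivative frechet_derivative f (at x)) (at x)"
    and "locally_lipschitz_on (\<lambda>x. frechet_derivative f (at x) v) S"
  using assms unfolding C11_on_def by (auto simp: frechet_derivative_works)

lemma C11_onI:
  assumes "\<And>x. x \<in> S \<Longrightarrow> (f has_derivative f' x) (at x)"
    and "\<And>v. locally_lipschitz_on (\<lambda>x. f' x v) S"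
  shows "C11_on f S"
proof -
  have "locally_lipschitz_on (\<lambda>x. frechet_derivative f (at x) v) S" for v
  proof (rule locally_lipschitz_on_cong[OF _ assms(2)[of v]])
    show "f' x v = frechet_derivative f (at x) v" if "x \<in> S" for x
      using frechet_derivative_at[OF assms(1)[OF that]] by simp
  qed
  then show ?thesis
    using assms(1) unfolding C11_on_def
    by (auto intro: differentiableI locally_lipschitz_imp_continuous_on)
qed

text \<open>Near each point of an open set, a $C^{1,1}$ function is bounded, and its derivative is bounded
  and Lipschitz in the operator norm; one constant serves for all three.\<close>

lemma C11_on_local_bounds:
  fixes f :: "'e::euclidean_space \<Rightarrow> 'f::real_normed_vector"
  assumes "C11_on f S" "open S" "x0 \<in> S"
  obtains e B where "e > 0" "B \<ge> 0" "cball x0 e \<subseteq> S"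
    "\<And>x. x \<in> cball x0 e \<Longrightarrow> norm (f x) \<le> B"
    "\<And>x h. x \<in> cball x0 e \<Longrightarrow> norm (frechet_derivative f (at x) h) \<le> B * norm h"
    "\<And>x x' h. x \<in> cball x0 e \<Longrightarrow> x' \<in> cball x0 e \<Longrightarrow>
       norm (frechet_derivative f (at x) h - frechet_derivative f (at x') h) \<le> B * norm (x - x') * norm h"
proof -
  let ?D = "\<lambda>x. frechet_derivative f (at x)"
  have "\<exists>e>0. bounded_lipschitz_on (\<lambda>x. ?D x b) (ball x0 e \<inter> S)" for b
    using C11_onD(2)[OF assms(1), of b] assms(3) unfolding locally_lipschitz_on_iff_bounded_lipschitz by blast
  then obtain e where e: "\<And>b. e b > 0" "\<And>b. bounded_lipschitz_on (\<lambda>x. ?D x b) (ball x0 (e b) \<inter> S)"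
    by metis
  obtain d where d: "d > 0" "cball x0 d \<subseteq> S"
    using assms(2,3) open_contains_cball by blast
  define r where "r = min d (Min (e ` (Basis::'e set)) / 2)"
  have r: "r > 0" "r \<le> d" unfolding r_def using d e(1) by (auto simp: Min_gr_iff)
  have re: "r < e b" if "b \<in> Basis" for b
  proof -
    have "Min (e ` (Basis::'e set)) \<le> e b" using that by auto
    moreover have "0 < e b" by (rule e)
    moreover have "r \<le> Min (e ` (Basis::'e set)) / 2" unfolding r_def by (rule min.cobounded2)
    ultimately show ?thesis by linarith
  qed
  have cS: "cball x0 r \<subseteq> S" using d(2) r(2) by (meson order.trans subset_cball)
  have bl: "bounded_lipschitz_on (\<lambda>x. ?D x b) (cball x0 r)" if "b \<in> Basis" for b
    by (rule bounded_lipschitz_on_subset[OF e(2)]) (use re[OF that] cS in auto)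
  have "\<exists>B. b \<in> Basis \<longrightarrow> B\<ge>0 \<and> (\<forall>x\<in>cball x0 r. norm (?D x b) \<le> B) \<and>
      (\<forall>x\<in>cball x0 r. \<forall>y\<in>cball x0 r. norm (?D x b - ?D y b) \<le> B * dist x y)" for b
  proof (cases "b \<in> Basis")
    case True
    show ?thesis by (rule bounded_lipschitz_onE[OF bl[OF True]]) blast
  qed simp
  then obtain B where B: "\<And>b. b \<in> Basis \<Longrightarrow> 0 \<le> B b"
    "\<And>b x. b \<in> Basis \<Longrightarrow> x \<in> cball x0 r \<Longrightarrow> norm (?D x b) \<le> B b"
    "\<And>b x y. b \<in> Basis \<Longrightarrow> x \<in> cball x0 r \<Longrightarrow> y \<in> cball x0 r \<Longrightarrow> norm (?D x b - ?D y b) \<le> B b * dist x y"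
    by metis
  define C where "C = (\<Sum>b\<in>(Basis::'e set). B b)"
  have C: "C \<ge> 0" unfolding C_def by (simp add: B sum_nonneg)
  have lin: "linear (?D x)" if "x \<in> cball x0 r" for x
    using C11_onD(1)[OF assms(1)] that cS has_derivative_linear by blast
  have D1: "norm (?D x h) \<le> C * norm h" if x: "x \<in> cball x0 r" for x h
  proof -
    have "?D x h = ?D x (\<Sum>b\<in>Basis. (h \<bullet> b) *\<^sub>R b)" by (simp add: euclidean_representation)
    also have "\<dots> = (\<Sum>b\<in>Basis. (h \<bullet> b) *\<^sub>R ?D x b)"
      by (simp add: linear_sum[OF lin[OF x]] linear_scale[OF lin[OF x]])
    also have "norm \<dots> \<le> (\<Sum>b\<in>Basis. norm h * B b)"
      by (rule sum_norm_le) (auto intro!: mult_mono B Basis_le_norm x)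
    finally show ?thesis by (simp add: C_def sum_distrib_left mult.commute)
  qed
  have D2: "norm (?D x h - ?D y h) \<le> C * norm (x - y) * norm h"
    if x: "x \<in> cball x0 r" and y: "y \<in> cball x0 r" for x y h
  proof -
    have *: "?D x h = (\<Sum>b\<in>Basis. (h \<bullet> b) *\<^sub>R ?D x b)" if x: "x \<in> cball x0 r" for x
    proof -
      have "?D x h = ?D x (\<Sum>b\<in>Basis. (h \<bullet> b) *\<^sub>R b)" by (simp add: euclidean_representation)
      also have "\<dots> = (\<Sum>b\<in>Basis. (h \<bullet> b) *\<^sub>R ?D x b)"
        by (simp add: linear_sum[OF lin[OF x]] linear_scale[OF lin[OF x]])
      finally show ?thesis .
    qed
    have "?D x h - ?D y h = (\<Sum>b\<in>Basis. (h \<bullet> b) *\<^sub>R (?D x b - ?D y b))"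
      by (simp add: *[OF x] *[OF y] sum_subtractf scaleR_diff_right)
    also have "norm \<dots> \<le> (\<Sum>b\<in>Basis. norm h * (B b * dist x y))"
      by (rule sum_norm_le) (auto intro!: mult_mono B Basis_le_norm x y)
    finally show ?thesis
      by (simp add: C_def sum_distrib_left sum_distrib_right mult.commute mult.left_commute dist_norm)
  qed
  have fb: "norm (f x) \<le> norm (f x0) + C * r" if x: "x \<in> cball x0 r" for x
  proof -
    have "norm (f x - f x0) \<le> C * norm (x - x0)"
    proof (rule differentiable_bound[of "cball x0 r" f ?D])
      fix z assume z: "z \<in> cball x0 r"
      show "(f has_derivative ?D z) (at z within cball x0 r)"
        using C11_onD(1)[OF assms(1)] z cS by (meson has_derivative_at_withinI subsetD)
      show "onorm (?D z) \<le> C"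
        by (rule onorm_bound[OF C]) (use D1[OF z] in auto)
    qed (use x r in auto)
    also have "\<dots> \<le> C * r"
      using x C by (intro mult_left_mono) (auto simp: dist_norm norm_minus_commute)
    finally show ?thesis using norm_triangle_sub[of "f x" "f x0"] by linarith
  qed
  define N where "N = max C (norm (f x0) + C * r)"
  show thesis
  proof (rule that[of r N])
    show "0 \<le> N" using C by (simp add: N_def)
    show "norm (?D x h) \<le> N * norm h" if "x \<in> cball x0 r" for x h
      using D1[OF that, of h] mult_right_mono[of C N "norm h"] by (force simp: N_def)
    show "norm (?D x h - ?D y h) \<le> N * norm (x - y) * norm h" if "x \<in> cball x0 r" "y \<in> cball x0 r" for x y h
    proof -
      have "C * (norm (x - y) * norm h) \<le> N * (norm (x - y) * norm h)"
        by (rule mult_right_mono) (auto simp: N_def)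
      then show ?thesis using D2[OF that, of h] by (simp add: mult.assoc)
    qed
    show "norm (f x) \<le> N" if "x \<in> cball x0 r" for x
      using fb[OF that] by (simp add: N_def)
  qed (use r cS in auto)
qed

lemma C11_on_imp_locally_lipschitz:
  fixes f :: "'e::euclidean_space \<Rightarrow> 'f::real_normed_vector"
  assumes "C11_on f S" "open S"
  shows "locally_lipschitz_on f S"
  unfolding locally_lipschitz_on_def
proof
  fix x0 assume x0: "x0 \<in> S"
  obtain e B where eB: "e > 0" "B \<ge> 0" "cball x0 e \<subseteq> S"
    "\<And>x h. x \<in> cball x0 e \<Longrightarrow> norm (frechet_derivative f (at x) h) \<le> B * norm h"
    by (rule C11_on_local_bounds[OF assms x0]) blast
  have "B-lipschitz_on (ball x0 e \<inter> S) f"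
  proof (rule lipschitz_onI)
    fix x y assume xy: "x \<in> ball x0 e \<inter> S" "y \<in> ball x0 e \<inter> S"
    have "norm (f x - f y) \<le> B * norm (x - y)"
    proof (rule differentiable_bound[of "cball x0 e" f "\<lambda>x. frechet_derivative f (at x)"])
      fix z assume z: "z \<in> cball x0 e"
      show "(f has_derivative frechet_derivative f (at z)) (at z within cball x0 e)"
        using C11_onD(1)[OF assms(1)] z eB(3) by (meson has_derivative_at_withinI subsetD)
      show "onorm (frechet_derivative f (at z)) \<le> B"
        by (rule onorm_bound[OF eB(2)]) (use eB(4)[OF z] in auto)
    qed (use xy in auto)
    then show "dist (f x) (f y) \<le> B * dist x y" by (simp add: dist_norm)
  qed (rule eB(2))
  then show "\<exists>e>0. \<exists>L. L-lipschitz_on (ball x0 e \<inter> S) f" using eB(1) by blast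
qed

lemma C11_on_add:
  assumes "C11_on f S" "C11_on g S"
  shows "C11_on (\<lambda>x. f x + g x) S"
  by (rule C11_onI[where f'="\<lambda>x h. frechet_derivative f (at x) h + frechet_derivative g (at x) h"])
    (auto intro!: has_derivative_add locally_lipschitz_on_add C11_onD assms)

lemma C11_on_bilinear:
  fixes f :: "'e::euclidean_space \<Rightarrow> 'b::real_normed_vector" and g :: "'e \<Rightarrow> 'c::real_normed_vector"
    and pr :: "'b \<Rightarrow> 'c \<Rightarrow> 'd::real_normed_vector"
  assumes bl: "bounded_bilinear pr" and "C11_on f S" "C11_on g S" "open S"
  shows "C11_on (\<lambda>x. pr (f x) (g x)) S"
proof (rule C11_onI[where f'="\<lambda>x h. pr (f x) (frechet_derivative g (at x) h) + pr (frechet_derivative f (at x) h) (g x)"])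
  show "((\<lambda>x. pr (f x) (g x)) has_derivative
      (\<lambda>h. pr (f x) (frechet_derivative g (at x) h) + pr (frechet_derivative f (at x) h) (g x))) (at x)"
    if "x \<in> S" for x
    by (intro bounded_bilinear.FDERIV[OF bl] C11_onD(1)[OF assms(2)] C11_onD(1)[OF assms(3)] that)
  show "locally_lipschitz_on (\<lambda>x. pr (f x) (frechet_derivative g (at x) v) + pr (frechet_derivative f (at x) v) (g x)) S" for v
    by (intro locally_lipschitz_on_add locally_lipschitz_on_bilinear[OF bl] C11_on_imp_locally_lipschitz
      C11_onD(2)[OF assms(2)] C11_onD(2)[OF assms(3)] assms(2-4))
qed

lemma locally_lipschitz_on_compose_C1:
  fixes f :: "'e::metric_space \<Rightarrow> real"
  assumes f: "locally_lipschitz_on f S" and pos: "\<And>x. x \<in> S \<Longrightarrow> f x > 0"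
    and h: "\<And>s. s > 0 \<Longrightarrow> (h has_real_derivative h' s) (at s)"
    and h': "continuous_on {0<..} h'"
  shows "locally_lipschitz_on (\<lambda>x. h (f x)) S"
  unfolding locally_lipschitz_on_def
proof
  fix x assume x: "x \<in> S"
  obtain e L where eL: "e > 0" "L-lipschitz_on (ball x e \<inter> S) f"
    using f x unfolding locally_lipschitz_on_def by blast
  define a where "a = f x / 2"
  define b where "b = 2 * f x"
  have fx: "f x > 0" by (rule pos[OF x])
  have "continuous (at x within S) f"
    using locally_lipschitz_imp_continuous_on[OF f] x by (simp add: continuous_on_eq_continuous_within)
  from this[unfolded continuous_within_eps_delta, rule_format, OF half_gt_zero[OF fx]]
  obtain d where d: "d > 0" "\<And>y. y \<in> S \<Longrightarrow> dist y x < d \<Longrightarrow> dist (f y) (f x) < f x / 2"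
    by auto
  have "continuous_on {a..b} h'"
    by (rule continuous_on_subset[OF h']) (use fx in \<open>auto simp: a_def\<close>)
  then have "compact (h' ` {a..b})" by (intro compact_continuous_image) auto
  then obtain B where B: "\<And>s. s \<in> {a..b} \<Longrightarrow> norm (h' s) \<le> B"
    using compact_imp_bounded[of "h' ` {a..b}"] unfolding bounded_iff by blast
  have "norm (h' (f x)) \<le> B" by (rule B) (use fx in \<open>simp add: a_def b_def\<close>)
  then have B0: "B \<ge> 0" using norm_ge_zero[of "h' (f x)"] by linarith
  have lh: "B-lipschitz_on {a..b} h"
  proof (rule lipschitz_onI[OF _ B0])
    fix s t assume st: "s \<in> {a..b}" "t \<in> {a..b}"
    have "norm (h s - h t) \<le> B * norm (s - t)"
    proof (rule field_differentiable_bound[of "{a..b}" h h'])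
      fix z assume "z \<in> {a..b}"
      then have "z > 0" using fx by (auto simp: a_def)
      then show "(h has_field_derivative h' z) (at z within {a..b})"
        by (rule has_field_derivative_at_within[OF h])
    qed (use st B in auto)
    then show "dist (h s) (h t) \<le> B * dist s t" by (simp add: dist_norm)
  qed
  have "(B * L)-lipschitz_on (ball x (min d e) \<inter> S) (\<lambda>x. h (f x))"
  proof (rule lipschitz_on_compose2[where f=f and g=h])
    show "L-lipschitz_on (ball x (min d e) \<inter> S) f"
      by (rule lipschitz_on_subset[OF eL(2)]) auto
    show "B-lipschitz_on (f ` (ball x (min d e) \<inter> S)) h"
    proof (rule lipschitz_on_subset[OF lh], rule image_subsetI)
      fix y assume "y \<in> ball x (min d e) \<inter> S"
      then have "dist (f y) (f x) < f x / 2" by (intro d) (auto simp: dist_commute)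
      then have "\<bar>f y - f x\<bar> < f x / 2" by (simp add: dist_real_def)
      then have "f y - f x < f x / 2" "f x - f y < f x / 2" by linarith+
      then show "f y \<in> {a..b}" using fx unfolding a_def b_def atLeastAtMost_iff by linarith
    qed
  qed
  then show "\<exists>e>0. \<exists>L. L-lipschitz_on (ball x e \<inter> S) (\<lambda>x. h (f x))"
    using eL(1) d(1) by (intro exI[of _ "min d e"] exI[of _ "B * L"] conjI) simp_all
qed

lemma C11_on_inverse_sqrt:
  fixes f :: "'e::euclidean_space \<Rightarrow> real"
  assumes f: "C11_on f S" and S: "open S" and pos: "\<And>x. x \<in> S \<Longrightarrow> f x > 0"
  shows "C11_on (\<lambda>x. f x powr (-1/2)) S"
proof (rule C11_onI)
  let ?D = "\<lambda>x. frechet_derivative f (at x)"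
  show "((\<lambda>x. f x powr (-1/2)) has_derivative (\<lambda>h. (-1/2 * f x powr (-3/2)) * ?D x h)) (at x)" if x: "x \<in> S" for x
  proof -
    have "((\<lambda>s. s powr (-1/2)) has_real_derivative (-1/2 * f x powr (-1/2 - 1))) (at (f x))"
      by (rule has_real_derivative_powr[OF pos[OF x]])
    then have "((\<lambda>s. s powr (-1/2)) has_derivative (*) (-1/2 * f x powr (-3/2))) (at (f x))"
      by (simp add: has_field_derivative_def)
    from has_derivative_compose[OF C11_onD(1)[OF f x] this] show ?thesis .
  qed
  have "locally_lipschitz_on (\<lambda>x. - 1 / 2 * f x powr (- 3 / 2)) S"
  proof (rule locally_lipschitz_on_compose_C1[where h="\<lambda>s. - 1 / 2 * s powr (- 3 / 2)"
        and h'="\<lambda>s. 3/4 * s powr (-5/2)"])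
    show "((\<lambda>s. - 1 / 2 * s powr (- 3 / 2)) has_real_derivative 3 / 4 * s powr (- 5 / 2)) (at s)" if "s > 0" for s :: real
    proof -
      have "((\<lambda>s. s powr (-3/2)) has_real_derivative (-3/2 * s powr (-3/2 - 1))) (at s)"
        by (rule has_real_derivative_powr[OF that])
      from DERIV_cmult[OF this, of "-1/2"] show ?thesis by simp
    qed
    show "continuous_on {0::real<..} (\<lambda>s. 3 / 4 * s powr (- 5 / 2))"
      by (intro continuous_intros) auto
  qed (use pos C11_on_imp_locally_lipschitz[OF f S] in auto)
  then show "locally_lipschitz_on (\<lambda>x. (-1/2 * f x powr (-3/2)) * ?D x v) S" for v
    by (rule locally_lipschitz_on_bilinear[OF bounded_bilinear_mult _ C11_onD(2)[OF f]])
qed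

section \<open>Absolutely continuous functions\<close>

text \<open>An absolutely continuous function that is differentiable almost everywhere is the Henstock
  integral of its derivative. A gauge handles the points of differentiability as in the usual
  fundamental theorem; around the exceptional points it is fine for an open set of small measure,
  on which absolute continuity makes the increments of the function small.\<close>

lemma absolutely_continuous_has_integral:
  fixes f :: "real \<Rightarrow> real"
  assumes ac: "abs_continuous_on_interval a b f" and ab: "a \<le> b" and N: "negligible N"
    and vecd: "\<And>x. x \<in> {a..b} - N \<Longrightarrow> (f has_vector_derivative f' x) (at x within {a..b})"
  shows "(f' has_integral (f b - f a)) {a..b}"
proof (cases "a = b")
  case True then show ?thesis by auto
next
  case False
  with ab have ab: "a < b" by simp
  define h where "h = (\<lambda>x. if x \<in> N then 0 else f' x)"
  have "(h has_integral (f b - f a)) {a..b}"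
    unfolding has_integral_factor_content box_real[symmetric]
  proof safe
    fix e :: real
    assume e: "e > 0"
    define e2 where "e2 = e / 2"
    have e2: "e2 > 0" using e by (simp add: e2_def)
    have eab: "e2 * (b - a) > 0" using e2 ab by simp
    obtain \<delta> where \<delta>: "\<delta> > 0" and ac\<delta>: "\<And>(M::nat) s t. (\<forall>i<M. a \<le> s i \<and> s i \<le> t i \<and> t i \<le> b) \<Longrightarrow>
        (\<forall>i<M. \<forall>j<M. i \<noteq> j \<longrightarrow> {s i<..<t i} \<inter> {s j<..<t j} = {}) \<Longrightarrow>
        (\<Sum>i<M. t i - s i) < \<delta> \<Longrightarrow> (\<Sum>i<M. norm (f (t i) - f (s i))) < e2 * (b - a)"
      using ac[unfolded abs_continuous_on_interval_def, rule_format, OF eab] by blast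
    have Nm: "N \<in> sets lebesgue" "N \<in> null_sets lebesgue"
      using N by (auto simp: negligible_iff_null_sets)
    \<comment> \<open>an open set around the exceptional points, too small for \<open>f\<close> to vary much on it\<close>
    obtain U where U: "open U" "N \<subseteq> U" "U - N \<in> lmeasurable" "emeasure lebesgue (U - N) < ennreal \<delta>"
      using sets_lebesgue_outer_open[OF Nm(1) \<delta>] by metis
    have Ueq: "emeasure lebesgue U = emeasure lebesgue (U - N)"
      using emeasure_Diff_null_set[OF Nm(2), of U] U(1) by simp
    have Um: "U \<in> lmeasurable"
      using U Ueq by (intro fmeasurableI) (auto intro: order_less_trans simp: less_top[symmetric] top_unique)
    have U\<delta>: "measure lebesgue U < \<delta>"
      using U(4) \<delta> ennreal_less_iff[of "measure lebesgue U" \<delta>]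
      unfolding Ueq[symmetric] emeasure_eq_measure2[OF Um] by simp
    have "\<forall>x. \<exists>d>0. (x \<in> {a..b} - N \<longrightarrow>
         (\<forall>y\<in>{a..b}. norm (y-x) < d \<longrightarrow> norm (f y - f x - (y-x) *\<^sub>R f' x) \<le> e2 * norm (y-x))) \<and>
         (x \<in> N \<longrightarrow> ball x d \<subseteq> U)"
    proof
      fix x
      show "\<exists>d>0. (x \<in> {a..b} - N \<longrightarrow>
         (\<forall>y\<in>{a..b}. norm (y-x) < d \<longrightarrow> norm (f y - f x - (y-x) *\<^sub>R f' x) \<le> e2 * norm (y-x))) \<and>
         (x \<in> N \<longrightarrow> ball x d \<subseteq> U)"
      proof (cases "x \<in> N")
        case True
        then show ?thesis using U(1,2) open_contains_ball by blast
      next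
        case x: False
        show ?thesis
        proof (cases "x \<in> {a..b}")
          case True
          then show ?thesis using x e2 vecd[of x, unfolded has_vector_derivative_def has_derivative_within_alt]
            by blast
        next
          case False
          then show ?thesis using x by (intro exI[of _ 1]) auto
        qed
      qed
    qed
    then obtain d where d0: "\<And>x. 0 < d x"
      and d: "\<And>x y. \<lbrakk>x \<in> {a..b} - N; y \<in> {a..b}; norm (y-x) < d x\<rbrakk>
                        \<Longrightarrow> norm (f y - f x - (y-x) *\<^sub>R f' x) \<le> e2 * norm (y-x)"
      and dN: "\<And>x. x \<in> N \<Longrightarrow> ball x (d x) \<subseteq> U"
      by metis
    show "\<exists>d. gauge d \<and> (\<forall>p. p tagged_division_of (cbox a b) \<and> d fine p \<longrightarrow>
      norm ((\<Sum>(x, k)\<in>p. measure lborel k *\<^sub>R h x) - (f b - f a)) \<le> e * measure lborel (cbox a b))"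
    proof (rule exI, safe)
      show "gauge (\<lambda>x. ball x (d x))"
        using d0 gauge_ball_dependent by blast
    next
      fix p
      assume ptag: "p tagged_division_of cbox a b" and finep: "(\<lambda>x. ball x (d x)) fine p"
      have finp: "finite p" using ptag by blast
      have ba: "b - a = (\<Sum>(x,K)\<in>p. Sup K - Inf K)" "f b - f a = (\<Sum>(x,K)\<in>p. f(Sup K) - f(Inf K))"
        using additive_tagged_division_1[OF less_imp_le[OF ab] ptag[unfolded box_real], of "\<lambda>x. x"]
          additive_tagged_division_1[OF less_imp_le[OF ab] ptag[unfolded box_real], of f] by simp_all
      \<comment> \<open>the tagged intervals whose tag is exceptional\<close>
      define pN where "pN = {z\<in>p. fst z \<in> N}"
      have finN: "finite pN" using finp by (simp add: pN_def)
      have intv: "\<exists>u v. K = cbox u v \<and> u \<le> v \<and> x \<in> K \<and> Inf K = u \<and> Sup K = v \<and> a \<le> u \<and> v \<le> b" if xKp: "(x, K) \<in> p" for x K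
      proof -
        have "x \<in> K" "K \<subseteq> cbox a b" using ptag xKp by blast+
        moreover obtain u v where k: "K = cbox u v" using tagged_division_ofD(4)[OF ptag xKp] by blast
        moreover have "u \<le> v" using \<open>x \<in> K\<close> k by auto
        ultimately show ?thesis by (intro exI[of _ u] exI[of _ v]) auto
      qed
      have good: "norm (\<Sum>(x, K) \<in> p - pN. (measure lborel K *\<^sub>R h x) - (f (Sup K) - f (Inf K)))
          \<le> (\<Sum>n\<in>p - pN. e2 * (case n of (x, k) \<Rightarrow> Sup k - Inf k))"
      proof (rule sum_norm_le,safe)
        fix x K
        assume xK: "(x, K) \<in> p" "(x, K) \<notin> pN"
        then have xN: "x \<notin> N" by (simp add: pN_def)
        obtain u v where k: "K = cbox u v" "u \<le> v" "x \<in> K" "Inf K = u" "Sup K = v" "a \<le> u" "v \<le> b"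
          using intv[OF xK(1)] by blast
        have xab: "x \<in> {a..b} - N" using k xN by auto
        have ball: "\<forall>y\<in>K. y \<in> ball x (d x)"
          using finep xK by blast
        have uv: "u \<in> K" "v \<in> K" using k by auto
        have "norm ((v - u) *\<^sub>R f' x - (f v - f u)) = norm (f u - f x - (u - x) *\<^sub>R f' x - (f v - f x - (v - x) *\<^sub>R f' x))"
          by (auto simp add: algebra_simps)
        also have "\<dots> \<le> norm (f u - f x - (u - x) *\<^sub>R f' x) + norm (f v - f x - (v - x) *\<^sub>R f' x)"
          by (rule norm_triangle_ineq4)
        also have "\<dots> \<le> e2 * norm (u - x) + e2 * norm (v - x)"
          using ball[rule_format, OF uv(1)] ball[rule_format, OF uv(2)] k xab
          by (intro add_mono d) (auto simp: dist_real_def)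
        also have "\<dots> = e2 * (v - u)"
          using k by (auto simp: algebra_simps)
        finally show "norm (measure lborel K *\<^sub>R h x - (f (Sup K) - f (Inf K))) \<le> e2 * (Sup K - Inf K)"
          using k xN by (simp add: h_def)
      qed
      have gd: "(\<Sum>n\<in>p - pN. e2 * (case n of (x, k) \<Rightarrow> Sup k - Inf k)) \<le> e2 * (b - a)"
      proof -
        have "(\<Sum>n\<in>p - pN. (case n of (x, k) \<Rightarrow> Sup k - Inf k)) \<le> (\<Sum>n\<in>p. (case n of (x, k) \<Rightarrow> Sup k - Inf k))"
        proof (rule sum_mono2[OF finp])
          fix z assume "z \<in> p - (p - pN)"
          then show "0 \<le> (case z of (x, k) \<Rightarrow> Sup k - Inf k)"
            using intv by (cases z) fastforce
        qed auto
        also have "\<dots> = b - a" using ba by simp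
        finally show ?thesis using e2 by (simp add: sum_distrib_left[symmetric])
      qed
      have bad: "norm (\<Sum>(x, K) \<in> pN. (measure lborel K *\<^sub>R h x) - (f (Sup K) - f (Inf K))) \<le> e2 * (b - a)"
      proof -
        obtain g where g: "bij_betw g {..<card pN} pN"
          using ex_bij_betw_nat_finite[OF finN] by (auto simp: atLeast0LessThan)
        define s where "s = (\<lambda>i. Inf (snd (g i)))"
        define t where "t = (\<lambda>i. Sup (snd (g i)))"
        have gp: "g i \<in> pN" if "i < card pN" for i using g that by (auto simp: bij_betw_def)
        have gi: "a \<le> s i \<and> s i \<le> t i \<and> t i \<le> b \<and> snd (g i) = {s i..t i} \<and> {s i..t i} \<subseteq> U" if i: "i < card pN" for i
        proof -
          obtain x K where xK: "g i = (x, K)" by (cases "g i")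
          have p: "(x, K) \<in> p" "x \<in> N" using gp[OF i] xK by (auto simp: pN_def)
          obtain u v where k: "K = cbox u v" "u \<le> v" "x \<in> K" "Inf K = u" "Sup K = v" "a \<le> u" "v \<le> b"
            using intv[OF p(1)] by blast
          have "K \<subseteq> ball x (d x)" using finep p(1) by blast
          then have "K \<subseteq> U" using dN[OF p(2)] by blast
          then show ?thesis using xK k by (simp add: s_def t_def)
        qed
        have disj: "{s i<..<t i} \<inter> {s j<..<t j} = {}" if ij: "i < card pN" "j < card pN" "i \<noteq> j" for i j
        proof -
          have "g i \<noteq> g j" using g ij by (auto simp: bij_betw_def inj_on_def)
          moreover have "g i \<in> p" "g j \<in> p" using gp ij by (auto simp: pN_def)
          ultimately have "interior (snd (g i)) \<inter> interior (snd (g j)) = {}"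
            using tagged_division_ofD(5)[OF ptag, of "fst (g i)" "snd (g i)" "fst (g j)" "snd (g j)"]
            by (metis prod.collapse)
          then show ?thesis using gi[OF ij(1)] gi[OF ij(2)] by (simp add: interior_atLeastAtMost_real)
        qed
        have "(\<Sum>i<card pN. t i - s i) = (\<Sum>i<card pN. measure lebesgue {s i<..<t i})"
          using gi by (intro sum.cong) auto
        also have "\<dots> = measure lebesgue (\<Union>i<card pN. {s i<..<t i})"
          by (rule measure_finite_Union[symmetric]) (use disj gi in \<open>auto simp: disjoint_family_on_def\<close>)
        also have "\<dots> \<le> measure lebesgue U"
          using gi by (intro measure_mono_fmeasurable Um) fastforce+
        also have "\<dots> < \<delta>" by (rule U\<delta>)
        finally have small: "(\<Sum>i<card pN. t i - s i) < \<delta>" .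
        have "norm (\<Sum>(x, K) \<in> pN. (measure lborel K *\<^sub>R h x) - (f (Sup K) - f (Inf K)))
          \<le> (\<Sum>n\<in>pN. norm (f (Sup (snd n)) - f (Inf (snd n))))"
          by (rule sum_norm_le) (auto simp: pN_def h_def split: prod.splits)
        also have "\<dots> = (\<Sum>i<card pN. norm (f (t i) - f (s i)))"
          unfolding s_def t_def by (rule sum.reindex_bij_betw[OF g, symmetric])
        also have "\<dots> < e2 * (b - a)"
          by (rule ac\<delta>) (use gi disj small in auto)
        finally show ?thesis by simp
      qed
      have "(\<Sum>(x, K)\<in>p. measure lborel K *\<^sub>R h x) - (f b - f a) =
          (\<Sum>(x, K)\<in>p. (measure lborel K *\<^sub>R h x) - (f (Sup K) - f (Inf K)))"
        unfolding ba(2) by (simp add: sum_subtractf[symmetric] split_def)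
      also have "\<dots> = (\<Sum>(x, K)\<in>p - pN. (measure lborel K *\<^sub>R h x) - (f (Sup K) - f (Inf K))) +
          (\<Sum>(x, K)\<in>pN. (measure lborel K *\<^sub>R h x) - (f (Sup K) - f (Inf K)))"
        by (rule sum.subset_diff[OF _ finp]) (auto simp: pN_def)
      also have "norm \<dots> \<le> e2 * (b - a) + e2 * (b - a)"
        using good gd bad by (intro order_trans[OF norm_triangle_ineq] add_mono) auto
      also have "\<dots> = e * measure lborel (cbox a b)"
        using ab by (simp add: e2_def)
      finally show "norm ((\<Sum>(x, K)\<in>p. measure lborel K *\<^sub>R h x) - (f b - f a)) \<le> e * measure lborel (cbox a b)" .
    qed
  qed
  then show ?thesis
    by (rule has_integral_spike[OF N, rotated]) (auto simp: h_def)
qed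

text \<open>No measurability of \<open>h\<close> is needed: the integral of a non-measurable function is the lower
  integral, and the derivative of an absolutely continuous function is measurable.\<close>

lemma absolutely_continuous_increment_le_nn_integral:
  fixes f :: "real \<Rightarrow> real" and h :: "real \<Rightarrow> ennreal"
  assumes ac: "abs_continuous_on_interval a b f" and ab: "a \<le> b"
    and ae: "AE x in lebesgue. x \<in> {a..b} \<longrightarrow>
       (\<exists>D. (f has_vector_derivative D) (at x within {a..b}) \<and> ennreal D \<le> h x)"
  shows "ennreal (f b - f a) \<le> (\<integral>\<^sup>+x\<in>{a..b}. h x \<partial>lebesgue)"
proof -
  let ?P = "\<lambda>x D. (f has_vector_derivative D) (at x within {a..b}) \<and> ennreal D \<le> h x"
  define f' where "f' = (\<lambda>x. if x \<in> {a..b} then SOME D. ?P x D else 0)"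
  obtain N where N: "N \<in> null_sets lebesgue" "\<And>x. x \<notin> N \<Longrightarrow> x \<in> {a..b} \<Longrightarrow> (\<exists>D. ?P x D)"
    by (rule AE_E3[OF ae]) auto
  have P: "?P x (f' x)" if "x \<in> {a..b} - N" for x
    unfolding f'_def using N(2)[of x] that someI_ex[of "?P x"] by auto
  have int: "(f' has_integral (f b - f a)) {a..b}"
    by (rule absolutely_continuous_has_integral[OF ac ab]) (use N P in \<open>auto simp: negligible_iff_null_sets\<close>)
  have f'_out: "f' x * indicator {a..b} x = f' x" for x by (simp add: f'_def indicator_def)
  have meas: "f' \<in> borel_measurable lebesgue"
    using has_integral_implies_lebesgue_measurable_real[OF int] by (simp add: f'_out)
  define g where "g = (\<lambda>x. max 0 (f' x))"
  have gm: "g \<in> borel_measurable lebesgue" unfolding g_def using meas by measurable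
  have gle: "(\<integral>\<^sup>+x. ennreal (g x) \<partial>lebesgue) \<le> (\<integral>\<^sup>+x\<in>{a..b}. h x \<partial>lebesgue)"
  proof (rule nn_integral_mono_AE)
    have "AE x in lebesgue. x \<notin> N" using N(1) by (rule AE_not_in)
    then show "AE x in lebesgue. ennreal (g x) \<le> h x * indicator {a..b} x"
    proof eventually_elim
      case (elim x)
      then show ?case
        using P[of x] by (cases "x \<in> {a..b}") (auto simp: g_def f'_def max_def)
    qed
  qed
  show ?thesis
  proof (cases "(\<integral>\<^sup>+x\<in>{a..b}. h x \<partial>lebesgue) = \<infinity>")
    case False
    then have fin: "(\<integral>\<^sup>+x. ennreal (g x) \<partial>lebesgue) < \<infinity>"
      using gle by (metis infinity_ennreal_def less_top order_le_less_trans)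
    have gi: "integrable lebesgue g"
      by (rule integrableI_nonneg) (use gm fin in \<open>auto simp: g_def\<close>)
    have "(g has_integral (\<integral>x. g x \<partial>lebesgue)) UNIV"
      using has_integral_integral_lebesgue[OF gi] by simp
    moreover have "(\<lambda>x. if x \<in> {a..b} then g x else 0) = g" by (auto simp: g_def f'_def)
    ultimately have g1: "(g has_integral (\<integral>x. g x \<partial>lebesgue)) {a..b}"
      using has_integral_restrict_UNIV[of "{a..b}" g "\<integral>x. g x \<partial>lebesgue"]
      by simp
    have "f b - f a \<le> (\<integral>x. g x \<partial>lebesgue)"
      by (rule has_integral_le[OF int g1]) (auto simp: g_def)
    then have "ennreal (f b - f a) \<le> ennreal (\<integral>x. g x \<partial>lebesgue)" by (rule ennreal_leI)
    also have "\<dots> = (\<integral>\<^sup>+x. ennreal (g x) \<partial>lebesgue)"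
      by (rule nn_integral_eq_integral[symmetric, OF gi]) (auto simp: g_def)
    also note gle
    finally show ?thesis .
  qed simp
qed

text \<open>A finite family of \<open>N\<close> non-overlapping subintervals \<open>[s i, t i]\<close> of \<open>[a, b]\<close>, as tested in
  the definition of absolute continuity.\<close>

definition interval_family :: "real \<Rightarrow> real \<Rightarrow> nat \<Rightarrow> (nat \<Rightarrow> real) \<Rightarrow> (nat \<Rightarrow> real) \<Rightarrow> bool" where
  "interval_family a b N s t \<longleftrightarrow> (\<forall>i<N. a \<le> s i \<and> s i \<le> t i \<and> t i \<le> b) \<and>
     (\<forall>i<N. \<forall>j<N. i \<noteq> j \<longrightarrow> {s i<..<t i} \<inter> {s j<..<t j} = {})"

lemma abs_continuous_on_interval_iff:
  "abs_continuous_on_interval a b f \<longleftrightarrow> (\<forall>\<epsilon>>0. \<exists>\<delta>>0. \<forall>N s t. interval_family a b N s t \<longrightarrow>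
     (\<Sum>i<N. t i - s i) < \<delta> \<longrightarrow> (\<Sum>i<N. norm (f (t i) - f (s i))) < \<epsilon>)"
  unfolding abs_continuous_on_interval_def interval_family_def by (simp only: imp_conjL)

lemma abs_continuous_on_intervalE:
  assumes "abs_continuous_on_interval a b f" "\<epsilon> > 0"
  obtains \<delta> where "\<delta> > 0" "\<And>N s t. interval_family a b N s t \<Longrightarrow> (\<Sum>i<N. t i - s i) < \<delta> \<Longrightarrow>
     (\<Sum>i<N. norm (f (t i) - f (s i))) < \<epsilon>"
proof -
  obtain \<delta> where "\<delta> > 0" and *: "\<forall>N s t. interval_family a b N s t \<longrightarrow>
     (\<Sum>i<N. t i - s i) < \<delta> \<longrightarrow> (\<Sum>i<N. norm (f (t i) - f (s i))) < \<epsilon>"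
    using assms(1)[unfolded abs_continuous_on_interval_iff, rule_format, OF assms(2)] by (elim exE conjE)
  show thesis
    by (rule that[OF \<open>\<delta> > 0\<close>]) (use * in simp)
qed

text \<open>The common core of the composition rules: every subinterval \<open>[s, t]\<close> is assigned a subinterval
  \<open>[p s t, q s t]\<close> of the same length on which \<open>f\<close> controls the increment of \<open>h\<close>.\<close>

lemma abs_continuous_transfer:
  fixes p q :: "real \<Rightarrow> real \<Rightarrow> real"
  assumes ac: "abs_continuous_on_interval a' b' f" and L: "L > 0"
    and pq: "\<And>s t. a \<le> s \<Longrightarrow> s \<le> t \<Longrightarrow> t \<le> b \<Longrightarrow> a' \<le> p s t \<and> p s t \<le> q s t \<and> q s t \<le> b' \<and> q s t - p s t = t - s"
    and disj: "\<And>s t s' t'. {s<..<t} \<inter> {s'<..<t'} = {} \<Longrightarrow> {p s t<..<q s t} \<inter> {p s' t'<..<q s' t'} = {}"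
    and le: "\<And>s t. a \<le> s \<Longrightarrow> s \<le> t \<Longrightarrow> t \<le> b \<Longrightarrow> norm (h t - h s) \<le> L * norm (f (q s t) - f (p s t))"
  shows "abs_continuous_on_interval a b h"
  unfolding abs_continuous_on_interval_iff
proof (intro allI impI)
  fix \<epsilon> :: real assume "\<epsilon> > 0"
  then have \<epsilon>: "\<epsilon> / L > 0" using L by simp
  obtain \<delta> where \<delta>: "\<delta> > 0" "\<And>N s t. interval_family a' b' N s t \<Longrightarrow> (\<Sum>i<N. t i - s i) < \<delta> \<Longrightarrow>
     (\<Sum>i<N. norm (f (t i) - f (s i))) < \<epsilon> / L"
    by (rule abs_continuous_on_intervalE[OF ac \<epsilon>]) blast
  show "\<exists>\<delta>>0. \<forall>N s t. interval_family a b N s t \<longrightarrow>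
     (\<Sum>i<N. t i - s i) < \<delta> \<longrightarrow> (\<Sum>i<N. norm (h (t i) - h (s i))) < \<epsilon>"
  proof (intro exI[of _ \<delta>] conjI allI impI \<delta>(1))
    fix N s t assume fam: "interval_family a b N s t" and small: "(\<Sum>i<N. t i - s i) < \<delta>"
    have st: "a \<le> s i" "s i \<le> t i" "t i \<le> b" if "i < N" for i
      using fam that by (auto simp: interval_family_def)
    let ?p = "\<lambda>i. p (s i) (t i)" and ?q = "\<lambda>i. q (s i) (t i)"
    have "interval_family a' b' N ?p ?q"
      unfolding interval_family_def using fam pq[OF st] by (intro conjI allI impI disj) (auto simp: interval_family_def)
    moreover have "(\<Sum>i<N. ?q i - ?p i) = (\<Sum>i<N. t i - s i)"
      using pq[OF st] by (intro sum.cong) auto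
    ultimately have f: "(\<Sum>i<N. norm (f (?q i) - f (?p i))) < \<epsilon> / L" using small by (intro \<delta>(2)) auto
    have "(\<Sum>i<N. norm (h (t i) - h (s i))) \<le> (\<Sum>i<N. L * norm (f (?q i) - f (?p i)))"
      by (rule sum_mono) (use le st in auto)
    also have "\<dots> < L * (\<epsilon> / L)"
      unfolding sum_distrib_left[symmetric] by (rule mult_strict_left_mono[OF f L])
    finally show "(\<Sum>i<N. norm (h (t i) - h (s i))) < \<epsilon>" using L by simp
  qed
qed

lemma abs_continuous_compose_lipschitz:
  assumes ac: "abs_continuous_on_interval a b f" and h: "L-lipschitz_on (f ` {a..b}) h"
  shows "abs_continuous_on_interval a b (\<lambda>t. h (f t))"
proof (rule abs_continuous_transfer[OF ac, where L="L + 1" and p="\<lambda>s t. s" and q="\<lambda>s t. t"])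
  show "L + 1 > 0" using lipschitz_on_nonneg[OF h] by simp
  fix s t assume st: "a \<le> s" "s \<le> t" "t \<le> b"
  then have "norm (h (f t) - h (f s)) \<le> L * norm (f t - f s)"
    using lipschitz_onD[OF h, of "f t" "f s"] by (simp add: dist_norm)
  also have "\<dots> \<le> (L + 1) * norm (f t - f s)" by (intro mult_right_mono) auto
  finally show "norm (h (f t) - h (f s)) \<le> (L + 1) * norm (f t - f s)" .
qed auto

lemma lipschitz_imp_abs_continuous:
  assumes "L-lipschitz_on {a..b} f"
  shows "abs_continuous_on_interval a b f"
proof -
  have "abs_continuous_on_interval a b (\<lambda>t. t)"
    unfolding abs_continuous_on_interval_iff
  proof (intro allI impI)
    fix \<epsilon> :: real assume \<epsilon>: "\<epsilon> > 0"
    have "(\<Sum>i<N. norm (t i - s i)) = (\<Sum>i<N. t i - s i)" if "interval_family a b N s t" for N s t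
      using that by (intro sum.cong) (auto simp: interval_family_def)
    then show "\<exists>\<delta>>0. \<forall>N s t. interval_family a b N s t \<longrightarrow>
       (\<Sum>i<N. t i - s i) < \<delta> \<longrightarrow> (\<Sum>i<N. norm (t i - s i)) < \<epsilon>"
      using \<epsilon> by (intro exI[of _ \<epsilon>]) auto
  qed
  from abs_continuous_compose_lipschitz[OF this] show ?thesis using assms by simp
qed

lemma abs_continuous_cong:
  assumes "abs_continuous_on_interval a b f" and "\<And>t. t \<in> {a..b} \<Longrightarrow> f t = h t"
  shows "abs_continuous_on_interval a b h"
  by (rule abs_continuous_transfer[OF assms(1), where L=1 and p="\<lambda>s t. s" and q="\<lambda>s t. t"])
    (use assms(2) in \<open>auto simp: assms(2)[symmetric]\<close>)

lemma abs_continuous_compose_shift: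
  assumes "abs_continuous_on_interval (k + a) (k + b) f"
  shows "abs_continuous_on_interval a b (\<lambda>t. f (k + t))"
  by (rule abs_continuous_transfer[OF assms, where L=1 and p="\<lambda>s t. k + s" and q="\<lambda>s t. k + t"]) auto

lemma abs_continuous_compose_reflect:
  assumes "abs_continuous_on_interval (k - b) (k - a) f"
  shows "abs_continuous_on_interval a b (\<lambda>t. f (k - t))"
  by (rule abs_continuous_transfer[OF assms, where L=1 and p="\<lambda>s t. k - t" and q="\<lambda>s t. k - s"])
    (auto simp: norm_minus_commute min_def max_def split: if_splits)

text \<open>An interval straddling the common endpoint is cut there by clamping its endpoints to either
  side.\<close>

lemma abs_continuous_join:
  assumes ac1: "abs_continuous_on_interval a b f" and ac2: "abs_continuous_on_interval b c f"
    and ab: "a \<le> b" "b \<le> c"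
  shows "abs_continuous_on_interval a c f"
  unfolding abs_continuous_on_interval_iff
proof (intro allI impI)
  fix \<epsilon> :: real assume "\<epsilon> > 0"
  then have \<epsilon>: "\<epsilon> / 2 > 0" by simp
  obtain d1 where d1: "d1 > 0" "\<And>N s t. interval_family a b N s t \<Longrightarrow> (\<Sum>i<N. t i - s i) < d1 \<Longrightarrow>
     (\<Sum>i<N. norm (f (t i) - f (s i))) < \<epsilon> / 2"
    by (rule abs_continuous_on_intervalE[OF ac1 \<epsilon>]) blast
  obtain d2 where d2: "d2 > 0" "\<And>N s t. interval_family b c N s t \<Longrightarrow> (\<Sum>i<N. t i - s i) < d2 \<Longrightarrow>
     (\<Sum>i<N. norm (f (t i) - f (s i))) < \<epsilon> / 2"
    by (rule abs_continuous_on_intervalE[OF ac2 \<epsilon>]) blast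
  show "\<exists>\<delta>>0. \<forall>N s t. interval_family a c N s t \<longrightarrow>
        (\<Sum>i<N. t i - s i) < \<delta> \<longrightarrow> (\<Sum>i<N. norm (f (t i) - f (s i))) < \<epsilon>"
  proof (intro exI[of _ "min d1 d2"] conjI allI impI)
    show "0 < min d1 d2" using d1 d2 by simp
  next
    fix N :: nat and s t :: "nat \<Rightarrow> real"
    assume fam: "interval_family a c N s t" and 3: "(\<Sum>i<N. t i - s i) < min d1 d2"
    have 1: "a \<le> s i" "s i \<le> t i" "t i \<le> c" if "i < N" for i
      using fam that by (auto simp: interval_family_def)
    have disj: "{s i<..<t i} \<inter> {s j<..<t j} = {}" if "i < N" "j < N" "i \<noteq> j" for i j
      using fam that by (auto simp: interval_family_def)
    have A: "(\<Sum>i<N. norm (f (min (t i) b) - f (min (s i) b))) < \<epsilon> / 2"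
    proof (rule d1(2))
      show "interval_family a b N (\<lambda>i. min (s i) b) (\<lambda>i. min (t i) b)"
        unfolding interval_family_def
      proof (intro conjI allI impI)
        fix i j assume ij: "i < N" "j < N" "i \<noteq> j"
        have "{min (s i) b<..<min (t i) b} \<subseteq> {s i<..<t i}" "{min (s j) b<..<min (t j) b} \<subseteq> {s j<..<t j}"
          by (auto simp: min_less_iff_disj)
        then show "{min (s i) b<..<min (t i) b} \<inter> {min (s j) b<..<min (t j) b} = {}" using disj[OF ij] by blast
      qed (use 1(1) ab in \<open>auto intro: min.coboundedI1 1(2)\<close>)
      have "(\<Sum>i<N. min (t i) b - min (s i) b) \<le> (\<Sum>i<N. t i - s i)"
      proof (rule sum_mono)
        fix i assume "i \<in> {..<N}"
        then have "s i \<le> t i" using 1(2) by simp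
        then show "min (t i) b - min (s i) b \<le> t i - s i" by (auto simp: min_def)
      qed
      then show "(\<Sum>i<N. min (t i) b - min (s i) b) < d1" using 3 by linarith
    qed
    have B: "(\<Sum>i<N. norm (f (max (t i) b) - f (max (s i) b))) < \<epsilon> / 2"
    proof (rule d2(2))
      show "interval_family b c N (\<lambda>i. max (s i) b) (\<lambda>i. max (t i) b)"
        unfolding interval_family_def
      proof (intro conjI allI impI)
        fix i j assume ij: "i < N" "j < N" "i \<noteq> j"
        have "{max (s i) b<..<max (t i) b} \<subseteq> {s i<..<t i}" "{max (s j) b<..<max (t j) b} \<subseteq> {s j<..<t j}"
          by (auto simp: less_max_iff_disj)
        then show "{max (s i) b<..<max (t i) b} \<inter> {max (s j) b<..<max (t j) b} = {}" using disj[OF ij] by blast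
      qed (use 1(3) ab in \<open>auto intro: max.coboundedI1 1(2)\<close>)
      have "(\<Sum>i<N. max (t i) b - max (s i) b) \<le> (\<Sum>i<N. t i - s i)"
      proof (rule sum_mono)
        fix i assume "i \<in> {..<N}"
        then have "s i \<le> t i" using 1(2) by simp
        then show "max (t i) b - max (s i) b \<le> t i - s i" by (auto simp: max_def)
      qed
      then show "(\<Sum>i<N. max (t i) b - max (s i) b) < d2" using 3 by linarith
    qed
    have "(\<Sum>i<N. norm (f (t i) - f (s i))) \<le>
      (\<Sum>i<N. norm (f (min (t i) b) - f (min (s i) b)) + norm (f (max (t i) b) - f (max (s i) b)))"
    proof (rule sum_mono)
      fix i assume "i \<in> {..<N}"
      then have "s i \<le> t i" using 1 by auto
      then consider "t i \<le> b" "s i \<le> b" | "s i \<le> b" "b \<le> t i" | "b \<le> s i" "b \<le> t i" by linarith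
      then show "norm (f (t i) - f (s i)) \<le> norm (f (min (t i) b) - f (min (s i) b)) + norm (f (max (t i) b) - f (max (s i) b))"
      proof cases
        case 2
        have "norm (f (t i) - f (s i)) \<le> norm (f b - f (s i)) + norm (f (t i) - f b)"
          using norm_triangle_ineq[of "f b - f (s i)" "f (t i) - f b"] by simp
        then show ?thesis using 2 by (simp add: min_absorb1 min_absorb2 max_absorb1 max_absorb2)
      qed (simp_all add: min_absorb1 min_absorb2 max_absorb1 max_absorb2)
    qed
    also have "\<dots> < \<epsilon>" using A B by (simp add: sum.distrib)
    finally show "(\<Sum>i<N. norm (f (t i) - f (s i))) < \<epsilon>" .
  qed
qed

section \<open>Lower integrals\<close>

text \<open>The length of a curve is a nonnegative integral whose integrand is not known to be measurable.
  For such an integrand the integral is the supremum of the integrals of the simple functions below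
  it. The following rules hold for it without measurability.\<close>

lemma nn_integral_le_simpleI:
  assumes "\<And>h. simple_function M h \<Longrightarrow> h \<le> f \<Longrightarrow> integral\<^sup>N M h \<le> c"
  shows "integral\<^sup>N M f \<le> c"
  unfolding nn_integral_def[of M f]
proof (rule SUP_least)
  fix h assume "h \<in> {g. simple_function M g \<and> g \<le> f}"
  then have h: "simple_function M h" "h \<le> f" by auto
  then show "integral\<^sup>S M h \<le> c" using assms[OF h] nn_integral_eq_simple_integral[OF h(1)] by simp
qed

lemma nn_integral_split_le:
  fixes f :: "'x \<Rightarrow> ennreal"
  assumes "S \<in> sets M"
  shows "(\<integral>\<^sup>+x. f x \<partial>M) \<le> (\<integral>\<^sup>+x. f x * indicator S x \<partial>M) + (\<integral>\<^sup>+x. f x * indicator (- S) x \<partial>M)"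
proof (rule nn_integral_le_simpleI)
  fix h assume h: "simple_function M h" "h \<le> f"
  have hm: "h \<in> borel_measurable M" using h(1) by (rule borel_measurable_simple_function)
  have "(\<integral>\<^sup>+x. h x \<partial>M) = (\<integral>\<^sup>+x. h x * indicator S x + h x * indicator (space M - S) x \<partial>M)"
    by (rule nn_integral_cong) (auto simp: indicator_def)
  also have "\<dots> = (\<integral>\<^sup>+x. h x * indicator S x \<partial>M) + (\<integral>\<^sup>+x. h x * indicator (space M - S) x \<partial>M)"
    by (rule nn_integral_add) (use hm assms in measurable)
  also have "\<dots> \<le> (\<integral>\<^sup>+x. f x * indicator S x \<partial>M) + (\<integral>\<^sup>+x. f x * indicator (- S) x \<partial>M)"
    using h(2) by (intro add_mono nn_integral_mono) (auto simp: indicator_def le_fun_def)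
  finally show "(\<integral>\<^sup>+x. h x \<partial>M) \<le> (\<integral>\<^sup>+x. f x * indicator S x \<partial>M) + (\<integral>\<^sup>+x. f x * indicator (- S) x \<partial>M)" .
qed

lemma nn_integral_affine_le:
  fixes F :: "real \<Rightarrow> ennreal"
  assumes s: "\<bar>s\<bar> = 1"
  shows "(\<integral>\<^sup>+t. F (k + s * t) \<partial>lebesgue) \<le> (\<integral>\<^sup>+t. F t \<partial>lebesgue)"
proof (rule nn_integral_le_simpleI)
  fix h assume h: "simple_function lebesgue h" "h \<le> (\<lambda>t. F (k + s * t))"
  have hm: "h \<in> borel_measurable lebesgue" using h(1) by (rule borel_measurable_simple_function)
  have ss: "s * s = 1" using s by (metis abs_mult_self_eq mult_1)
  have "(\<integral>\<^sup>+t. h t \<partial>lebesgue) = (\<integral>\<^sup>+t. h (- s * k + s * t) \<partial>lebesgue)"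
    using nn_integral_real_affine_lebesgue[OF hm, of s "- s * k"] s by auto
  also have "\<dots> \<le> (\<integral>\<^sup>+t. F t \<partial>lebesgue)"
  proof (rule nn_integral_mono)
    fix t
    have "k + s * (- s * k + s * t) = k - (s * s) * k + (s * s) * t" by (simp add: algebra_simps)
    also have "\<dots> = t" by (simp add: ss)
    finally show "h (- s * k + s * t) \<le> F t" using h(2) by (metis le_funD)
  qed
  finally show "(\<integral>\<^sup>+t. h t \<partial>lebesgue) \<le> (\<integral>\<^sup>+t. F t \<partial>lebesgue)" .
qed

lemma AE_lebesgue_affine:
  fixes s k :: real
  assumes s: "\<bar>s\<bar> = 1" and P: "AE t in lebesgue. P t"
  shows "AE t in lebesgue. P (k + s * t)"
proof -
  have m: "(\<lambda>t. k + s * t) \<in> lebesgue \<rightarrow>\<^sub>M lebesgue"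
    using lebesgue_affine_measurable[where c="\<lambda>x::real. s" and t=k] s by auto
  have "s \<noteq> 0" using s by auto
  then have "distr lebesgue lebesgue (\<lambda>t. k + s * t) = lebesgue"
    using lebesgue_real_affine[of s k] s by (simp add: density_1)
  then have "AE t in distr lebesgue lebesgue (\<lambda>t. k + s * t). P t" using P by (simp only:)
  then show ?thesis by (rule AE_distrD[OF m])
qed

section \<open>Lipschitz flows and an inverse function\<close>

text \<open>Local existence for Lipschitz vector fields, by Banach's fixed point theorem. The existence time
  \<open>T\<close> does not depend on the initial point, and solutions run in both time directions.\<close>

lemma picard_local_flow:
  fixes F :: "'a::euclidean_space \<Rightarrow> 'a"
  assumes F: "bounded_lipschitz_on F (cball z0 \<rho>)" and \<rho>: "\<rho> > 0"
  obtains T where "T > 0" "\<And>z. z \<in> cball z0 (\<rho>/2) \<Longrightarrow> \<exists>\<phi>. \<phi> 0 = z \<and>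
      (\<forall>t\<in>{-T..T}. \<phi> t \<in> cball z0 \<rho> \<and> (\<phi> has_vector_derivative F (\<phi> t)) (at t within {-T..T}))"
proof -
  let ?C = "cball z0 \<rho>"
  obtain B0 where B0: "B0 \<ge> 0" "\<And>x. x \<in> ?C \<Longrightarrow> norm (F x) \<le> B0"
    "\<And>x y. x \<in> ?C \<Longrightarrow> y \<in> ?C \<Longrightarrow> norm (F x - F y) \<le> B0 * dist x y"
    by (rule bounded_lipschitz_onE[OF F]) blast
  define B where "B = B0 + 1"
  have B: "B > 0" using B0(1) by (simp add: B_def)
  \<comment> \<open>extend the field to the whole space by composing with the nearest-point projection\<close>
  define G where "G = (\<lambda>x. F (closest_point ?C x))"
  have cp: "closest_point ?C x \<in> ?C" for x
    by (rule closest_point_in_set) (use \<rho> in auto)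
  have GB: "norm (G x) \<le> B" for x
    using B0(2)[OF cp, of x] by (simp add: G_def B_def)
  have GL: "norm (G x - G y) \<le> B * dist x y" for x y
  proof -
    have "norm (G x - G y) \<le> B0 * dist (closest_point ?C x) (closest_point ?C y)"
      unfolding G_def by (rule B0(3)[OF cp cp])
    also have "\<dots> \<le> B0 * dist x y"
      by (intro mult_left_mono closest_point_lipschitz B0(1)) (use \<rho> in auto)
    also have "\<dots> \<le> B * dist x y" by (intro mult_right_mono) (auto simp: B_def)
    finally show ?thesis .
  qed
  have "B-lipschitz_on UNIV G"
    using GL B by (intro lipschitz_onI) (auto simp: dist_norm)
  then have Gc: "continuous_on UNIV G" by (rule lipschitz_on_continuous_on)
  define T where "T = min (\<rho> / (8 * B)) (1 / (8 * B))"
  have T: "T > 0" using \<rho> B by (simp add: T_def)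
  have TB: "4 * (T * B) \<le> \<rho> / 2" "4 * (T * B) \<le> 1 / 2"
  proof -
    have "T \<le> \<rho> / (8 * B)" "T \<le> 1 / (8 * B)" by (auto simp: T_def)
    then show "4 * (T * B) \<le> \<rho> / 2" "4 * (T * B) \<le> 1 / 2"
      using B by (auto simp: field_simps)
  qed
  define c where "c = (\<lambda>t::real. max (-T) (min t T))"
  have c: "-T \<le> c t" "c t \<le> T" for t using T by (auto simp: c_def)
  have cc: "continuous_on UNIV c" unfolding c_def by (intro continuous_intros)
  have bnd: "norm (integral {-T..a} f) \<le> K * (2 * T)"
    if "-T \<le> a" "a \<le> T" "continuous_on UNIV f" "\<And>t. norm (f t) \<le> K" for a K and f :: "real \<Rightarrow> 'a"
  proof -
    have "norm (integral {-T..a} f) \<le> K * (a - (-T))"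
      by (rule integral_bound) (use that in \<open>auto intro: continuous_on_subset\<close>)
    also have "\<dots> \<le> K * (2 * T)"
      using that(2) order_trans[OF norm_ge_zero that(4)] by (intro mult_left_mono) auto
    finally show ?thesis .
  qed
  have main: "\<exists>\<phi>. \<phi> 0 = z \<and>
      (\<forall>t\<in>{-T..T}. \<phi> t \<in> ?C \<and> (\<phi> has_vector_derivative F (\<phi> t)) (at t within {-T..T}))"
    if z: "z \<in> cball z0 (\<rho>/2)" for z
  proof -
    define P where "P = (\<lambda>(x :: real \<Rightarrow>\<^sub>C 'a) t. z + (integral {-T..c t} (\<lambda>s. G (x s)) - integral {-T..0} (\<lambda>s. G (x s))))"
    have Gx: "continuous_on S (\<lambda>s. G (apply_bcontfun x s))" for x and S :: "real set"
      by (rule continuous_on_compose2[OF Gc]) auto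
    have Pz: "norm (P x t - z) \<le> 4 * (T * B)" for x t
    proof -
      have "norm (P x t - z) \<le> norm (integral {-T..c t} (\<lambda>s. G (x s))) + norm (integral {-T..0} (\<lambda>s. G (x s)))"
        unfolding P_def by (simp add: norm_triangle_ineq4)
      also have "\<dots> \<le> B * (2 * T) + B * (2 * T)"
        by (intro add_mono bnd c Gx GB) (use T in auto)
      finally show ?thesis by (simp add: algebra_simps)
    qed
    have Pc: "continuous_on UNIV (P x)" for x
    proof -
      have "continuous_on {-T..T} (\<lambda>u. integral {-T..u} (\<lambda>s. G (x s)))"
        by (intro indefinite_integral_continuous_1 integrable_continuous_real Gx)
      then have "continuous_on UNIV (\<lambda>t. integral {-T..c t} (\<lambda>s. G (x s)))"
        by (rule continuous_on_compose2[OF _ cc]) (use c in auto)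
      then show ?thesis unfolding P_def by (intro continuous_intros)
    qed
    have Pb: "P x \<in> bcontfun" for x
    proof (rule bcontfun_normI[OF Pc])
      fix t show "norm (P x t) \<le> norm z + 4 * (T * B)"
        using Pz[of x t] norm_triangle_sub[of "P x t" z] by linarith
    qed
    have app: "apply_bcontfun (Bcontfun (P x)) = P x" for x
      using Pb by (rule Bcontfun_inverse)
    have "\<exists>!x. Bcontfun (P x) = x"
    proof (rule banach_fix_type[of "1/2"], simp, simp, intro allI)
      fix x w :: "real \<Rightarrow>\<^sub>C 'a"
      show "dist (Bcontfun (P x)) (Bcontfun (P w)) \<le> 1 / 2 * dist x w"
      proof (rule dist_bound)
        fix t
        let ?f = "\<lambda>s. G (x s) - G (w s)"
        have fb: "norm (?f s) \<le> B * dist x w" for s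
          using GL[of "x s" "w s"] mult_left_mono[OF dist_bounded[of x s w], of B] B by linarith
        have int: "(\<lambda>s. G (apply_bcontfun v s)) integrable_on {-T..a}" for v a
          by (rule integrable_continuous_real[OF Gx])
        have "P x t - P w t = integral {-T..c t} ?f - integral {-T..0} ?f"
          unfolding P_def by (simp add: integral_diff int)
        also have "norm \<dots> \<le> norm (integral {-T..c t} ?f) + norm (integral {-T..0} ?f)"
          by (rule norm_triangle_ineq4)
        also have "\<dots> \<le> (B * dist x w) * (2 * T) + (B * dist x w) * (2 * T)"
          by (intro add_mono bnd c fb continuous_on_diff Gx) (use T in auto)
        also have "\<dots> = 4 * (T * B) * dist x w" by (simp add: algebra_simps)
        also have "\<dots> \<le> 1 / 2 * dist x w" by (intro mult_right_mono TB) auto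
        finally show "dist (Bcontfun (P x) t) (Bcontfun (P w) t) \<le> 1 / 2 * dist x w"
          by (simp add: app dist_norm)
      qed
    qed
    then obtain x where fix_x: "Bcontfun (P x) = x" by auto
    have x: "apply_bcontfun x t = P x t" for t using app[of x] unfolding fix_x by (rule fun_cong)
    show ?thesis
    proof (intro exI[of _ "apply_bcontfun x"] conjI ballI)
      show "x 0 = z" using T by (simp add: x[of 0] P_def c_def)
    next
      fix t assume t: "t \<in> {-T..T}"
      have "dist z0 (x t) \<le> dist z0 z + norm (P x t - z)"
        using dist_triangle[of z0 "x t" z] by (simp add: x dist_norm norm_minus_commute)
      also have "\<dots> \<le> \<rho>" using z Pz[of x t] TB by auto
      finally show xt: "x t \<in> ?C" by simp
      have "((\<lambda>u. z + (integral {-T..u} (\<lambda>s. G (x s)) - integral {-T..0} (\<lambda>s. G (x s)))) has_vector_derivative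
          0 + (G (x t) - 0)) (at t within {-T..T})"
        by (intro has_vector_derivative_add has_vector_derivative_diff has_vector_derivative_const
            integral_has_vector_derivative Gx t)
      then have "(x has_vector_derivative 0 + (G (x t) - 0)) (at t within {-T..T})"
      proof (rule has_vector_derivative_transform[OF t, rotated])
        fix u assume "u \<in> {-T..T}"
        then have "c u = u" by (auto simp: c_def)
        then show "x u = z + (integral {-T..u} (\<lambda>s. G (x s)) - integral {-T..0} (\<lambda>s. G (x s)))"
          by (simp add: x[of u] P_def)
      qed
      moreover have "G (x t) = F (x t)"
        using closest_point_self[OF xt] by (simp add: G_def)
      ultimately show "(x has_vector_derivative F (x t)) (at t within {-T..T})" by simp
    qed
  qed
  show thesis by (rule that[OF T main])
qed

text \<open>A function on \<open>[-T, T]\<close> that vanishes at \<open>0\<close> and has slope at least \<open>1/2\<close> takes every value in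
  \<open>(-T/2, T/2)\<close>, whence the domain of its inverse.\<close>

lemma inverse_function_on_interval:
  fixes \<theta> \<theta>' :: "real \<Rightarrow> real"
  assumes T: "T > 0" and \<theta>0: "\<theta> 0 = 0"
    and der: "\<And>t. t \<in> {-T..T} \<Longrightarrow> (\<theta> has_real_derivative \<theta>' t) (at t within {-T..T})"
    and ge: "\<And>t. t \<in> {-T..T} \<Longrightarrow> \<theta>' t \<ge> 1/2"
  obtains \<tau> where
    "\<And>s. \<bar>s\<bar> < T/2 \<Longrightarrow> \<tau> s \<in> {-T<..<T} \<and> \<bar>\<tau> s\<bar> \<le> 2 * \<bar>s\<bar> \<and> \<theta> (\<tau> s) = s"
    "\<And>s. \<bar>s\<bar> < T/2 \<Longrightarrow> (\<tau> has_real_derivative 1 / \<theta>' (\<tau> s)) (at s)"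
    "\<And>t. t \<in> {-T..T} \<Longrightarrow> \<bar>\<theta> t\<bar> < T/2 \<Longrightarrow> \<tau> (\<theta> t) = t"
proof -
  have mono: "(t - s) / 2 \<le> \<theta> t - \<theta> s" if "-T \<le> s" "s \<le> t" "t \<le> T" for s t
  proof (cases "s = t")
    case False
    then have "s < t" using that by simp
    have "\<exists>z\<in>{s<..<t}. \<theta> t - \<theta> s = \<theta>' z * (t - s)"
    proof (rule mvt_simple[OF \<open>s < t\<close>, where f'="\<lambda>u h. \<theta>' u * h"])
      fix u assume u: "s \<le> u" "u \<le> t"
      then have "(\<theta> has_real_derivative \<theta>' u) (at u within {s..t})"
        using that by (intro DERIV_subset[OF der]) auto
      then show "(\<theta> has_derivative (\<lambda>h. \<theta>' u * h)) (at u within {s..t})"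
        by (simp add: has_field_derivative_def)
    qed
    then obtain z where "z \<in> {s<..<t}" "\<theta> t - \<theta> s = \<theta>' z * (t - s)" by auto
    moreover have "1/2 * (t - s) \<le> \<theta>' z * (t - s)"
      using calculation that by (intro mult_right_mono ge) auto
    ultimately show ?thesis by simp
  qed simp
  have cont: "continuous_on {-T..T} \<theta>"
    by (rule DERIV_continuous_on[OF der])
  have ex: "\<exists>t\<in>{-T..T}. \<theta> t = s" if "\<bar>s\<bar> < T/2" for s
  proof -
    have "\<theta> (-T) \<le> s" "s \<le> \<theta> T"
      using mono[of "-T" 0] mono[of 0 T] T \<theta>0 that by auto
    then show ?thesis
      using IVT'[of \<theta> "-T" s T] cont T by auto
  qed
  have inj: "s = t" if "s \<in> {-T..T}" "t \<in> {-T..T}" "\<theta> s = \<theta> t" for s t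
  proof (cases "s \<le> t")
    case True
    then show ?thesis using mono[of s t] that by simp
  next
    case False
    then show ?thesis using mono[of t s] that by simp
  qed
  define \<tau> where "\<tau> = (\<lambda>s. SOME t. t \<in> {-T..T} \<and> \<theta> t = s)"
  have \<tau>: "\<tau> s \<in> {-T..T}" "\<theta> (\<tau> s) = s" if "\<bar>s\<bar> < T/2" for s
    using someI_ex[of "\<lambda>t. t \<in> {-T..T} \<and> \<theta> t = s"] ex[OF that] unfolding \<tau>_def by blast+
  have lip: "\<bar>\<tau> r - \<tau> s\<bar> \<le> 2 * \<bar>r - s\<bar>" if "\<bar>r\<bar> < T/2" "\<bar>s\<bar> < T/2" for r s
  proof (cases "\<tau> r \<le> \<tau> s")
    case True
    then have "(\<tau> s - \<tau> r) / 2 \<le> s - r"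
      using mono[of "\<tau> r" "\<tau> s"] \<tau>[OF that(1)] \<tau>[OF that(2)] by simp
    with True show ?thesis by (simp add: abs_if)
  next
    case False
    then have "(\<tau> r - \<tau> s) / 2 \<le> r - s"
      using mono[of "\<tau> s" "\<tau> r"] \<tau>[OF that(1)] \<tau>[OF that(2)] by simp
    with False show ?thesis by (simp add: abs_if)
  qed
  have \<tau>0: "\<tau> 0 = 0" using inj[of "\<tau> 0" 0] \<tau>[of 0] T \<theta>0 by auto
  have b1: "\<bar>\<tau> s\<bar> \<le> 2 * \<bar>s\<bar>" if "\<bar>s\<bar> < T/2" for s
    using lip[OF that, of 0] T \<tau>0 by auto
  have b2: "\<tau> s \<in> {-T<..<T}" if "\<bar>s\<bar> < T/2" for s
    using b1[OF that] that by auto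
  show thesis
  proof (rule that)
    fix s assume s: "\<bar>s\<bar> < T/2"
    show "\<tau> s \<in> {-T<..<T} \<and> \<bar>\<tau> s\<bar> \<le> 2 * \<bar>s\<bar> \<and> \<theta> (\<tau> s) = s"
      using b1[OF s] b2[OF s] \<tau>[OF s] by blast
    have D: "(\<theta> has_real_derivative \<theta>' (\<tau> s)) (at (\<tau> s))"
      using der[of "\<tau> s"] b2[OF s] at_within_Icc_at[of "-T" "\<tau> s" T] by auto
    have "2-lipschitz_on {-T/2<..<T/2} \<tau>"
      by (rule lipschitz_onI) (use lip in \<open>auto simp: dist_real_def abs_less_iff\<close>)
    then have "continuous_on {-T/2<..<T/2} \<tau>" by (rule lipschitz_on_continuous_on)
    moreover have sT: "-T/2 < s" "s < T/2" using s by linarith+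
    ultimately have "isCont \<tau> s"
      by (simp add: continuous_on_eq_continuous_at)
    moreover have "\<theta> (\<tau> y) = y" if "-T/2 < y" "y < T/2" for y
      by (rule \<tau>) (use that in linarith)
    moreover have "\<theta>' (\<tau> s) \<noteq> 0"
      using ge[OF \<tau>(1)[OF s]] by linarith
    ultimately have "(\<tau> has_real_derivative inverse (\<theta>' (\<tau> s))) (at s)"
      by (intro DERIV_inverse_function[where f=\<theta> and g=\<tau> and x=s and a="-T/2" and b="T/2", OF D _ sT])
    then show "(\<tau> has_real_derivative 1 / \<theta>' (\<tau> s)) (at s)" by (simp add: divide_inverse)
  next
    fix t assume "t \<in> {-T..T}" "\<bar>\<theta> t\<bar> < T/2"
    then show "\<tau> (\<theta> t) = t" using inj \<tau> by blast
  qed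
qed

section \<open>Normal extremals and their calibrations\<close>

text \<open>The scalar estimate behind the calibration. Here \<open>E\<close> is the distance to the extremal and \<open>n\<close> the
  distance between two unit controls. The errors are all of size \<open>(n + E) * E\<close>, and \<open>2 * A * n * E \<le>
  n\<^sup>2 + A\<^sup>2 * E\<^sup>2\<close> splits them between the gain \<open>n\<^sup>2 / 2\<close>, which comes from the strict convexity of the
  unit sphere, and the gain \<open>K * E\<^sup>2\<close>, which comes from the penalty term.\<close>

lemma calibration_real_inequality:
  fixes n E t N :: real
  assumes vP: "vP \<le> 1 - n\<^sup>2 / 2 + va + N * C1 * E\<^sup>2"
    and ua: "va - \<beta> * ua \<le> N * (1 + C2) * C4 * (n + E) * E"
    and \<beta>: "\<bar>\<beta> - 1\<bar> \<le> C2 * (n + E)"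
    and q: "\<bar>q\<bar> \<le> C3 * (n + E) * E"
    and n: "n \<ge> 0" and E: "E \<ge> 0"
    and C: "N * C1 \<ge> 0" "N * (1 + C2) * C4 \<ge> 0" "C2 \<ge> 0" "C3 \<ge> 0"
    and A: "A = N * C1 + N * (1 + C2) * C4 + C2 + 2 * C3"
    and K: "K = A + A\<^sup>2 / 2"
    and KE: "K * E \<le> 1" and Kt: "K * \<bar>t\<bar> \<le> 1"
  shows "vP - \<beta> * ua - K * \<beta> * E\<^sup>2 - 2 * K * t * q \<le> 1"
proof -
  have A0: "A \<ge> 0" using C A by simp
  have K0: "K \<ge> 0" using A0 K by simp
  have 1: "N * C1 * E\<^sup>2 \<le> N * C1 * ((n + E) * E)"
    using C(1) n E by (intro mult_left_mono) (auto simp: power2_eq_square algebra_simps)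
  have "K * E\<^sup>2 * (1 - \<beta>) \<le> K * E\<^sup>2 * (C2 * (n + E))"
    using \<beta> K0 by (intro mult_left_mono) auto
  also have "\<dots> = (K * E) * (C2 * ((n + E) * E))" by (simp add: power2_eq_square)
  also have "\<dots> \<le> 1 * (C2 * ((n + E) * E))"
    using KE C n E by (intro mult_right_mono) auto
  finally have 2: "- (K * \<beta> * E\<^sup>2) \<le> C2 * ((n + E) * E) - K * E\<^sup>2"
    by (simp add: algebra_simps)
  have "\<bar>2 * K * t * q\<bar> = 2 * (K * \<bar>t\<bar>) * \<bar>q\<bar>" using K0 by (simp add: abs_mult)
  also have "\<dots> \<le> 2 * 1 * (C3 * (n + E) * E)"
    using Kt q K0 by (intro mult_mono) auto
  finally have 3: "- (2 * K * t * q) \<le> 2 * C3 * ((n + E) * E)"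
    by (simp add: abs_le_iff mult.assoc)
  have 4: "A * ((n + E) * E) \<le> n\<^sup>2 / 2 + K * E\<^sup>2"
  proof -
    have "0 \<le> (n - A * E)\<^sup>2" by simp
    then have "2 * (A * n * E) \<le> n\<^sup>2 + A\<^sup>2 * E\<^sup>2"
      by (simp add: power2_diff power_mult_distrib mult_ac)
    then have "A * n * E \<le> n\<^sup>2 / 2 + A\<^sup>2 / 2 * E\<^sup>2" by simp
    then show ?thesis unfolding K by (simp add: algebra_simps power2_eq_square)
  qed
  have "vP - \<beta> * ua - K * \<beta> * E\<^sup>2 - 2 * K * t * q \<le>
    1 - n\<^sup>2 / 2 + (N * C1 + N * (1 + C2) * C4 + C2 + 2 * C3) * ((n + E) * E) - K * E\<^sup>2"
    using vP ua 1 2 3 by (simp add: algebra_simps)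
  also have "\<dots> \<le> 1" using 4 unfolding A by linarith
  finally show ?thesis .
qed

text \<open>Vector fields \<open>y 0, ..., y (m - 1)\<close> on a closed ball, with derivatives \<open>D i x\<close>. One constant \<open>B\<close>
  bounds the fields, their derivatives and the Lipschitz constants of the derivatives. The
  fields need not be linearly independent.\<close>

locale frame_bounds =
  fixes y :: "nat \<Rightarrow> 'e::euclidean_space \<Rightarrow> 'e" and D :: "nat \<Rightarrow> 'e \<Rightarrow> 'e \<Rightarrow> 'e"
    and m :: nat and x0 :: 'e and \<rho> B :: real
  assumes \<rho>: "\<rho> > 0" and B: "B \<ge> 1"
    and deriv: "\<And>i x. i < m \<Longrightarrow> x \<in> cball x0 \<rho> \<Longrightarrow> (y i has_derivative D i x) (at x)"
    and y_le: "\<And>i x. i < m \<Longrightarrow> x \<in> cball x0 \<rho> \<Longrightarrow> norm (y i x) \<le> B"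
    and D_le: "\<And>i x h. i < m \<Longrightarrow> x \<in> cball x0 \<rho> \<Longrightarrow> norm (D i x h) \<le> B * norm h"
    and D_lip: "\<And>i x x' h. i < m \<Longrightarrow> x \<in> cball x0 \<rho> \<Longrightarrow> x' \<in> cball x0 \<rho> \<Longrightarrow>
       norm (D i x h - D i x' h) \<le> B * norm (x - x') * norm h"
begin

text \<open>For the Hamiltonian \<open>H(x, \<xi>) = (\<Sum>i<m. (\<xi> \<bullet> y i x)\<^sup>2) / 2\<close>, with covectors identified with vectors
  by the Euclidean inner product, these are the partial gradients in \<open>\<xi>\<close> and in \<open>x\<close>. The inner sum in the
  second one is the adjoint of \<open>D i x\<close> applied to \<open>\<xi>\<close>.\<close>

definition H\<^sub>\<xi> :: "'e \<Rightarrow> 'e \<Rightarrow> 'e" where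
  "H\<^sub>\<xi> x \<xi> = (\<Sum>i<m. (\<xi> \<bullet> y i x) *\<^sub>R y i x)"

definition H\<^sub>x :: "'e \<Rightarrow> 'e \<Rightarrow> 'e" where
  "H\<^sub>x x \<xi> = (\<Sum>i<m. (\<xi> \<bullet> y i x) *\<^sub>R (\<Sum>b\<in>Basis. (\<xi> \<bullet> D i x b) *\<^sub>R b))"

lemma linear_D: "i < m \<Longrightarrow> x \<in> cball x0 \<rho> \<Longrightarrow> linear (D i x)"
  using deriv has_derivative_linear by blast

lemma H\<^sub>x_inner:
  assumes "x \<in> cball x0 \<rho>"
  shows "H\<^sub>x x \<xi> \<bullet> h = (\<Sum>i<m. (\<xi> \<bullet> y i x) * (\<xi> \<bullet> D i x h))"
proof -
  have "(\<Sum>b\<in>Basis. (\<xi> \<bullet> D i x b) *\<^sub>R b) \<bullet> h = \<xi> \<bullet> D i x h" if i: "i < m" for i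
  proof -
    have "\<xi> \<bullet> D i x h = \<xi> \<bullet> D i x (\<Sum>b\<in>Basis. (h \<bullet> b) *\<^sub>R b)" by (simp add: euclidean_representation)
    also have "\<dots> = (\<Sum>b\<in>Basis. (h \<bullet> b) * (\<xi> \<bullet> D i x b))"
      by (simp add: linear_sum[OF linear_D[OF i assms]] linear_scale[OF linear_D[OF i assms]] inner_sum_right)
    finally show ?thesis by (simp add: inner_sum_left inner_commute[of h] mult.commute)
  qed
  then show ?thesis by (simp add: H\<^sub>x_def inner_sum_left)
qed

lemma y_diff_le:
  assumes "i < m" "x \<in> cball x0 \<rho>" "x' \<in> cball x0 \<rho>"
  shows "norm (y i x - y i x') \<le> B * norm (x - x')"
proof (rule differentiable_bound[of "cball x0 \<rho>" "y i" "D i"])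
  fix z assume z: "z \<in> cball x0 \<rho>"
  show "(y i has_derivative D i z) (at z within cball x0 \<rho>)"
    by (rule has_derivative_at_withinI[OF deriv[OF assms(1) z]])
  show "onorm (D i z) \<le> B"
    by (rule onorm_bound) (use B D_le[OF assms(1) z] in auto)
qed (use assms in auto)

lemma taylor_le:
  assumes i: "i < m" and x: "x \<in> cball x0 \<rho>" and x': "x' \<in> cball x0 \<rho>"
  shows "norm (y i x - y i x' - D i x' (x - x')) \<le> B * (norm (x - x'))\<^sup>2"
proof -
  let ?S = "closed_segment x' x"
  have S: "?S \<subseteq> cball x0 \<rho>" by (rule closed_segment_subset[OF x' x convex_cball])
  have bl: "bounded_linear (D i x')" using deriv[OF i x'] by (rule has_derivative_bounded_linear)
  have "norm ((y i x - D i x' x) - (y i x' - D i x' x')) \<le> (B * norm (x - x')) * norm (x - x')"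
  proof (rule differentiable_bound[of ?S "\<lambda>z. y i z - D i x' z" "\<lambda>z h. D i z h - D i x' h"])
    fix z assume z: "z \<in> ?S"
    then have zc: "z \<in> cball x0 \<rho>" using S by blast
    show "((\<lambda>z. y i z - D i x' z) has_derivative (\<lambda>h. D i z h - D i x' h)) (at z within ?S)"
      by (intro has_derivative_diff has_derivative_at_withinI[OF deriv[OF i zc]]
          bounded_linear.has_derivative[OF bl] has_derivative_ident)
    show "onorm (\<lambda>h. D i z h - D i x' h) \<le> B * norm (x - x')"
    proof (rule onorm_bound)
      fix h
      have "norm (D i z h - D i x' h) \<le> B * norm (z - x') * norm h" by (rule D_lip[OF i zc x'])
      also have "\<dots> \<le> B * norm (x - x') * norm h"
        using segment_bound1[OF z] B by (intro mult_right_mono mult_left_mono) auto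
      finally show "norm (D i z h - D i x' h) \<le> B * norm (x - x') * norm h" .
    qed (use B in simp)
  qed auto
  moreover have "(y i x - D i x' x) - (y i x' - D i x' x') = y i x - y i x' - D i x' (x - x')"
    by (simp add: linear_diff[OF linear_D[OF i x']])
  ultimately show ?thesis by (simp add: power2_eq_square)
qed

text \<open>A solution \<open>(\<gamma>, \<eta>)\<close> on \<open>[-T, T]\<close> of Hamilton's equations on the energy level \<open>H = 1/2\<close>: a position
  \<open>\<gamma>\<close> with a covector \<open>\<eta>\<close> bounded by \<open>\<Lambda>\<close>. The controls \<open>\<eta> t \<bullet> y i (\<gamma> t)\<close> of \<open>\<gamma>\<close> form a unit vector.\<close>

definition extremal :: "real \<Rightarrow> real \<Rightarrow> (real \<Rightarrow> 'e) \<Rightarrow> (real \<Rightarrow> 'e) \<Rightarrow> bool" where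
  "extremal T \<Lambda> \<gamma> \<eta> \<longleftrightarrow> (\<forall>t\<in>{-T..T}. \<gamma> t \<in> cball x0 \<rho> \<and> norm (\<eta> t) \<le> \<Lambda> \<and>
     (\<gamma> has_vector_derivative H\<^sub>\<xi> (\<gamma> t) (\<eta> t)) (at t within {-T..T}) \<and>
     (\<eta> has_vector_derivative - H\<^sub>x (\<gamma> t) (\<eta> t)) (at t within {-T..T}) \<and>
     (\<Sum>i<m. (\<eta> t \<bullet> y i (\<gamma> t))\<^sup>2) = 1)"

text \<open>Conservation of energy: the sum is the derivative of \<open>H\<close> along Hamilton's equations. It vanishes
  because its two double sums differ only by an exchange of the summation indices.\<close>

lemma energy_derivative_zero:
  assumes x: "x \<in> cball x0 \<rho>"
  shows "(\<Sum>i<m. (\<xi> \<bullet> y i x) * (- H\<^sub>x x \<xi> \<bullet> y i x + \<xi> \<bullet> D i x (H\<^sub>\<xi> x \<xi>))) = 0"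
proof -
  let ?u = "\<lambda>i. \<xi> \<bullet> y i x"
  have "\<xi> \<bullet> D i x (H\<^sub>\<xi> x \<xi>) = (\<Sum>j<m. ?u j * (\<xi> \<bullet> D i x (y j x)))" if "i < m" for i
    by (simp add: H\<^sub>\<xi>_def linear_sum[OF linear_D[OF that x]] linear_scale[OF linear_D[OF that x]] inner_sum_right)
  then have "(\<Sum>i<m. ?u i * (\<xi> \<bullet> D i x (H\<^sub>\<xi> x \<xi>))) = (\<Sum>i<m. \<Sum>j<m. ?u i * (?u j * (\<xi> \<bullet> D i x (y j x))))"
    by (simp add: sum_distrib_left)
  also have "\<dots> = (\<Sum>i<m. \<Sum>j<m. ?u j * (?u i * (\<xi> \<bullet> D j x (y i x))))"
    by (rule sum.swap)
  also have "\<dots> = (\<Sum>i<m. ?u i * (H\<^sub>x x \<xi> \<bullet> y i x))"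
    by (simp add: H\<^sub>x_inner[OF x] sum_distrib_left mult.left_commute)
  finally show ?thesis
    by (simp add: algebra_simps sum.distrib sum_subtractf sum_negf)
qed

lemma energy_constant:
  assumes "\<And>t. t \<in> {-T..T} \<Longrightarrow> \<gamma> t \<in> cball x0 \<rho>"
    and d\<gamma>: "\<And>t. t \<in> {-T..T} \<Longrightarrow> (\<gamma> has_vector_derivative H\<^sub>\<xi> (\<gamma> t) (\<eta> t)) (at t within {-T..T})"
    and d\<eta>: "\<And>t. t \<in> {-T..T} \<Longrightarrow> (\<eta> has_vector_derivative - H\<^sub>x (\<gamma> t) (\<eta> t)) (at t within {-T..T})"
    and t: "t \<in> {-T..T}" and T: "T > 0"
  shows "(\<Sum>i<m. (\<eta> t \<bullet> y i (\<gamma> t))\<^sup>2) = (\<Sum>i<m. (\<eta> 0 \<bullet> y i (\<gamma> 0))\<^sup>2)"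
proof -
  let ?I = "{-T..T}"
  have "((\<lambda>s. \<Sum>i<m. (\<eta> s \<bullet> y i (\<gamma> s))\<^sup>2) has_derivative (\<lambda>h. 0)) (at s within ?I)" if s: "s \<in> ?I" for s
  proof -
    have "((\<lambda>s. \<eta> s \<bullet> y i (\<gamma> s)) has_derivative
       (\<lambda>h. h * (- H\<^sub>x (\<gamma> s) (\<eta> s) \<bullet> y i (\<gamma> s) + \<eta> s \<bullet> D i (\<gamma> s) (H\<^sub>\<xi> (\<gamma> s) (\<eta> s))))) (at s within ?I)"
      if i: "i < m" for i
    proof -
      note lin = linear_D[OF i assms(1)[OF s]]
      have "((\<lambda>s. y i (\<gamma> s)) has_derivative (\<lambda>h. D i (\<gamma> s) (h *\<^sub>R H\<^sub>\<xi> (\<gamma> s) (\<eta> s)))) (at s within ?I)"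
        by (rule has_derivative_compose[OF d\<gamma>[OF s, unfolded has_vector_derivative_def] deriv[OF i assms(1)[OF s]]])
      from has_derivative_inner[OF d\<eta>[OF s, unfolded has_vector_derivative_def] this]
      show ?thesis by (rule has_derivative_eq_rhs) (simp add: linear_scale[OF lin] algebra_simps fun_eq_iff)
    qed
    note d1 = this
    have "((\<lambda>s. \<Sum>i<m. (\<eta> s \<bullet> y i (\<gamma> s))\<^sup>2) has_derivative (\<lambda>h. \<Sum>i<m. 2 * (h *
        (- H\<^sub>x (\<gamma> s) (\<eta> s) \<bullet> y i (\<gamma> s) + \<eta> s \<bullet> D i (\<gamma> s) (H\<^sub>\<xi> (\<gamma> s) (\<eta> s)))) * (\<eta> s \<bullet> y i (\<gamma> s)))) (at s within ?I)"
    proof (rule has_derivative_sum)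
      fix i assume "i \<in> {..<m}"
      then have i: "i < m" by simp
      show "((\<lambda>s. (\<eta> s \<bullet> y i (\<gamma> s))\<^sup>2) has_derivative (\<lambda>h. 2 * (h *
        (- H\<^sub>x (\<gamma> s) (\<eta> s) \<bullet> y i (\<gamma> s) + \<eta> s \<bullet> D i (\<gamma> s) (H\<^sub>\<xi> (\<gamma> s) (\<eta> s)))) * (\<eta> s \<bullet> y i (\<gamma> s)))) (at s within ?I)"
        by (rule has_derivative_eq_rhs[OF has_derivative_power[OF d1[OF i]]]) (simp add: fun_eq_iff)
    qed
    then show ?thesis
    proof (rule has_derivative_eq_rhs, intro ext)
      fix h
      have "(\<Sum>i<m. 2 * (h * (- H\<^sub>x (\<gamma> s) (\<eta> s) \<bullet> y i (\<gamma> s) + \<eta> s \<bullet> D i (\<gamma> s) (H\<^sub>\<xi> (\<gamma> s) (\<eta> s)))) * (\<eta> s \<bullet> y i (\<gamma> s)))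
        = (2 * h) * (\<Sum>i<m. (\<eta> s \<bullet> y i (\<gamma> s)) * (- H\<^sub>x (\<gamma> s) (\<eta> s) \<bullet> y i (\<gamma> s) + \<eta> s \<bullet> D i (\<gamma> s) (H\<^sub>\<xi> (\<gamma> s) (\<eta> s))))"
        unfolding sum_distrib_left by (intro sum.cong refl) (simp only: mult_ac)
      then show "(\<Sum>i<m. 2 * (h * (- H\<^sub>x (\<gamma> s) (\<eta> s) \<bullet> y i (\<gamma> s) + \<eta> s \<bullet> D i (\<gamma> s) (H\<^sub>\<xi> (\<gamma> s) (\<eta> s)))) * (\<eta> s \<bullet> y i (\<gamma> s))) = 0"
        using energy_derivative_zero[OF assms(1)[OF s], of "\<eta> s"] by simp
    qed
  qed
  then have "\<exists>c. \<forall>s\<in>?I. (\<Sum>i<m. (\<eta> s \<bullet> y i (\<gamma> s))\<^sup>2) = c"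
    by (intro has_derivative_zero_constant) auto
  then show ?thesis using t T by auto
qed

text \<open>Through every point \<open>q\<close> near \<open>x0\<close> passes an extremal on a common time interval. The initial
  covector is \<open>y 0 x0\<close>, rescaled to the energy level at \<open>q\<close>; the velocities of all these
  extremals lie uniformly on one side of the hyperplane orthogonal to \<open>\<xi>0\<close>.\<close>

lemma extremals_exist:
  assumes m: "m > 0" and y0: "y 0 x0 \<noteq> 0"
  obtains \<xi>0 \<Lambda> T \<rho>1 where "T > 0" "\<Lambda> \<ge> 1" "norm \<xi>0 \<le> \<Lambda>" "0 < \<rho>1" "\<rho>1 \<le> \<rho>"
    "\<And>q. q \<in> cball x0 \<rho>1 \<Longrightarrow> \<exists>\<gamma> \<eta>. \<gamma> 0 = q \<and> extremal T \<Lambda> \<gamma> \<eta> \<and>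
       (\<forall>t\<in>{-T..T}. \<xi>0 \<bullet> H\<^sub>\<xi> (\<gamma> t) (\<eta> t) \<ge> 1/2)"
proof -
  define N where "N = (\<lambda>x. sqrt (\<Sum>i<m. (y 0 x0 \<bullet> y i x)\<^sup>2))"
  have N0: "N x0 > 0"
  proof -
    have "0 < (y 0 x0 \<bullet> y 0 x0)\<^sup>2" using y0 by simp
    also have "\<dots> \<le> (\<Sum>i<m. (y 0 x0 \<bullet> y i x0)\<^sup>2)"
      by (rule member_le_sum) (use m in auto)
    finally show ?thesis by (simp add: N_def)
  qed
  define xi where "xi = (\<lambda>q. (1 / N q) *\<^sub>R y 0 x0)"
  have xi1: "(\<Sum>i<m. (xi q \<bullet> y i q)\<^sup>2) = 1" if "N q > 0" for q
  proof -
    have "(\<Sum>i<m. (xi q \<bullet> y i q)\<^sup>2) = (1 / N q)\<^sup>2 * (\<Sum>i<m. (y 0 x0 \<bullet> y i q)\<^sup>2)"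
      by (simp add: xi_def power_mult_distrib power_divide sum_distrib_left)
    also have "(\<Sum>i<m. (y 0 x0 \<bullet> y i q)\<^sup>2) = (N q)\<^sup>2"
      by (simp add: N_def sum_nonneg)
    finally show ?thesis using that by (simp add: power_divide)
  qed
  define \<xi>0 where "\<xi>0 = xi x0"
  define z0 where "z0 = (x0, \<xi>0)"
  define F where "F = (\<lambda>z. (H\<^sub>\<xi> (fst z) (snd z), - H\<^sub>x (fst z) (snd z)))"
  have bF: "bounded_lipschitz_on F (cball z0 \<rho>)" and bH: "bounded_lipschitz_on (\<lambda>z. H\<^sub>\<xi> (fst z) (snd z)) (cball z0 \<rho>)"
  proof -
    have fstC: "fst z \<in> cball x0 \<rho>" if "z \<in> cball z0 \<rho>" for z
      using that dist_fst_le[of z0 z] by (auto simp: z0_def)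
    have by': "bounded_lipschitz_on (\<lambda>z. y i (fst z)) (cball z0 \<rho>)" if i: "i < m" for i
    proof (rule bounded_lipschitz_onI)
      fix w z assume wz: "w \<in> cball z0 \<rho>" "z \<in> cball z0 \<rho>"
      have "norm (y i (fst w) - y i (fst z)) \<le> B * dist (fst w) (fst z)"
        using y_diff_le[OF i fstC[OF wz(1)] fstC[OF wz(2)]] by (simp add: dist_norm)
      also have "\<dots> \<le> B * dist w z"
        using B by (intro mult_left_mono dist_fst_le) auto
      finally show "norm (y i (fst w) - y i (fst z)) \<le> B * dist w z" .
    qed (use y_le[OF i] fstC in auto)
    have bD: "bounded_lipschitz_on (\<lambda>z. D i (fst z) b) (cball z0 \<rho>)" if i: "i < m" for i b
    proof (rule bounded_lipschitz_onI)
      fix w z assume wz: "w \<in> cball z0 \<rho>" "z \<in> cball z0 \<rho>"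
      have "norm (D i (fst w) b - D i (fst z) b) \<le> B * norm b * dist (fst w) (fst z)"
        using D_lip[OF i fstC[OF wz(1)] fstC[OF wz(2)], of b] by (simp add: dist_norm mult_ac)
      also have "\<dots> \<le> B * norm b * dist w z"
        using B by (intro mult_left_mono dist_fst_le) auto
      finally show "norm (D i (fst w) b - D i (fst z) b) \<le> B * norm b * dist w z" .
    qed (use D_le[OF i] fstC in auto)
    have bs: "bounded_lipschitz_on snd (cball z0 \<rho>)"
      by (rule bounded_lipschitz_on_linear[OF bounded_linear_snd bounded_lipschitz_on_id]) simp
    show bH: "bounded_lipschitz_on (\<lambda>z. H\<^sub>\<xi> (fst z) (snd z)) (cball z0 \<rho>)"
      unfolding H\<^sub>\<xi>_def
      by (intro bounded_lipschitz_on_sum bounded_lipschitz_on_scaleR bounded_lipschitz_on_inner bs by') auto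
    have "bounded_lipschitz_on (\<lambda>z. H\<^sub>x (fst z) (snd z)) (cball z0 \<rho>)"
      unfolding H\<^sub>x_def
      by (intro bounded_lipschitz_on_sum bounded_lipschitz_on_scaleR bounded_lipschitz_on_inner bs by' bD
          bounded_lipschitz_on_const) auto
    then show "bounded_lipschitz_on F (cball z0 \<rho>)"
      unfolding F_def by (intro bounded_lipschitz_on_Pair bH bounded_lipschitz_on_minus)
  qed
  have H\<xi>x: "\<xi> \<bullet> H\<^sub>\<xi> x \<xi> = (\<Sum>i<m. (\<xi> \<bullet> y i x)\<^sup>2)" for x \<xi>
    by (simp add: H\<^sub>\<xi>_def inner_sum_right power2_eq_square)
  \<comment> \<open>near the initial phase point, the velocity stays transversal to the hyperplane orthogonal to \<open>\<xi>0\<close>\<close>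
  obtain L where L: "L \<ge> 0" "\<And>w z. w \<in> cball z0 \<rho> \<Longrightarrow> z \<in> cball z0 \<rho> \<Longrightarrow>
      norm (H\<^sub>\<xi> (fst w) (snd w) - H\<^sub>\<xi> (fst z) (snd z)) \<le> L * dist w z"
    by (rule bounded_lipschitz_onE[OF bH]) blast
  define r where "r = min \<rho> (1 / (2 * (L + 1) * (norm \<xi>0 + 1)))"
  have r: "r > 0" "r \<le> \<rho>" using \<rho> L(1) by (auto simp: r_def intro!: divide_pos_pos mult_pos_pos add_nonneg_pos)
  have trans: "\<xi>0 \<bullet> H\<^sub>\<xi> (fst z) (snd z) \<ge> 1/2" if z: "z \<in> cball z0 r" for z
  proof -
    have "\<xi>0 \<bullet> H\<^sub>\<xi> (fst z0) (snd z0) = 1"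
      using xi1[OF N0] by (simp add: z0_def H\<xi>x \<xi>0_def)
    moreover have "\<bar>\<xi>0 \<bullet> (H\<^sub>\<xi> (fst z0) (snd z0) - H\<^sub>\<xi> (fst z) (snd z))\<bar> \<le> 1/2"
    proof -
      have "\<bar>\<xi>0 \<bullet> (H\<^sub>\<xi> (fst z0) (snd z0) - H\<^sub>\<xi> (fst z) (snd z))\<bar> \<le> norm \<xi>0 * (L * dist z0 z)"
        using z r \<rho> by (intro order_trans[OF Cauchy_Schwarz_ineq2] mult_left_mono L) auto
      also have "\<dots> \<le> (norm \<xi>0 + 1) * ((L + 1) * r)"
        using z L(1) by (intro mult_mono) auto
      also have "\<dots> \<le> (norm \<xi>0 + 1) * ((L + 1) * (1 / (2 * (L + 1) * (norm \<xi>0 + 1))))"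
        using L(1) by (intro mult_left_mono) (auto simp: r_def)
      also have "\<dots> = 1/2" using L(1) norm_ge_zero[of \<xi>0] by (simp add: field_simps add_nonneg_eq_0_iff)
      finally show ?thesis .
    qed
    ultimately show ?thesis unfolding inner_diff_right by linarith
  qed
  obtain T where T: "T > 0" and flow: "\<And>z. z \<in> cball z0 (r/2) \<Longrightarrow> \<exists>\<phi>. \<phi> 0 = z \<and>
      (\<forall>t\<in>{-T..T}. \<phi> t \<in> cball z0 r \<and> (\<phi> has_vector_derivative F (\<phi> t)) (at t within {-T..T}))"
    by (rule picard_local_flow[OF bounded_lipschitz_on_subset[OF bF] r(1)]) (use r in auto)
  have cN: "isCont N x0"
  proof -
    have "isCont (y i) x0" if "i < m" for i
      using deriv[OF that, of x0] \<rho> by (intro has_derivative_continuous) auto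
    then show ?thesis unfolding N_def by (intro continuous_intros) auto
  qed
  then have "isCont (\<lambda>q. (q, xi q)) x0"
    unfolding xi_def using N0 by (intro continuous_intros) auto
  then obtain d1 where d1: "d1 > 0" "\<And>q. dist q x0 < d1 \<Longrightarrow> dist (q, xi q) z0 < r / 2"
    using r(1) unfolding continuous_at_eps_delta z0_def \<xi>0_def by (meson half_gt_zero)
  obtain d2 where d2: "d2 > 0" "\<And>q. dist q x0 < d2 \<Longrightarrow> dist (N q) (N x0) < N x0"
    using cN N0 unfolding continuous_at_eps_delta by meson
  define \<rho>1 where "\<rho>1 = min \<rho> (min d1 d2 / 2)"
  define \<Lambda> where "\<Lambda> = 1 + norm \<xi>0 + r"
  show thesis
  proof (rule that[of T \<Lambda> \<xi>0 \<rho>1])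
    fix q assume q: "q \<in> cball x0 \<rho>1"
    have qd: "dist q x0 < d1" "dist q x0 < d2"
      using q d1(1) d2(1) by (auto simp: \<rho>1_def dist_commute)
    have Nq: "N q > 0" using d2(2)[OF qd(2)] by (simp add: dist_real_def abs_less_iff)
    have "(q, xi q) \<in> cball z0 (r/2)" using d1(2)[OF qd(1)] by (simp add: dist_commute)
    then obtain \<phi> where \<phi>: "\<phi> 0 = (q, xi q)" "\<And>t. t \<in> {-T..T} \<Longrightarrow> \<phi> t \<in> cball z0 r"
      "\<And>t. t \<in> {-T..T} \<Longrightarrow> (\<phi> has_vector_derivative F (\<phi> t)) (at t within {-T..T})"
      using flow by blast
    define \<gamma> where "\<gamma> = (\<lambda>t. fst (\<phi> t))"
    define \<eta> where "\<eta> = (\<lambda>t. snd (\<phi> t))"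
    have g: "\<gamma> t \<in> cball x0 \<rho>" and l: "norm (\<eta> t) \<le> \<Lambda>" if "t \<in> {-T..T}" for t
    proof -
      have "dist z0 (\<phi> t) \<le> r" using \<phi>(2)[OF that] by simp
      then have "dist x0 (\<gamma> t) \<le> r" "dist \<xi>0 (\<eta> t) \<le> r"
        using dist_fst_le[of z0 "\<phi> t"] dist_snd_le[of z0 "\<phi> t"] by (auto simp: z0_def \<gamma>_def \<eta>_def)
      then show "\<gamma> t \<in> cball x0 \<rho>" "norm (\<eta> t) \<le> \<Lambda>"
        using r norm_triangle_sub[of "\<eta> t" "\<xi>0"] by (auto simp: \<Lambda>_def dist_norm norm_minus_commute)
    qed
    have d\<gamma>: "(\<gamma> has_vector_derivative H\<^sub>\<xi> (\<gamma> t) (\<eta> t)) (at t within {-T..T})" if "t \<in> {-T..T}" for t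
      using bounded_linear.has_vector_derivative[OF bounded_linear_fst \<phi>(3)[OF that]]
      by (simp add: F_def \<gamma>_def \<eta>_def)
    have d\<eta>: "(\<eta> has_vector_derivative - H\<^sub>x (\<gamma> t) (\<eta> t)) (at t within {-T..T})" if "t \<in> {-T..T}" for t
      using bounded_linear.has_vector_derivative[OF bounded_linear_snd \<phi>(3)[OF that]]
      by (simp add: F_def \<gamma>_def \<eta>_def)
    have "(\<Sum>i<m. (\<eta> t \<bullet> y i (\<gamma> t))\<^sup>2) = 1" if "t \<in> {-T..T}" for t
      using energy_constant[OF g d\<gamma> d\<eta> that T] xi1[OF Nq] by (simp add: \<gamma>_def \<eta>_def \<phi>(1))
    then have "extremal T \<Lambda> \<gamma> \<eta>" unfolding extremal_def using g l d\<gamma> d\<eta> by blast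
    moreover have "\<gamma> 0 = q" by (simp add: \<gamma>_def \<phi>)
    moreover have "\<forall>t\<in>{-T..T}. \<xi>0 \<bullet> H\<^sub>\<xi> (\<gamma> t) (\<eta> t) \<ge> 1/2"
      using trans \<phi>(2) by (auto simp: \<gamma>_def \<eta>_def)
    ultimately show "\<exists>\<gamma> \<eta>. \<gamma> 0 = q \<and> extremal T \<Lambda> \<gamma> \<eta> \<and>
       (\<forall>t\<in>{-T..T}. \<xi>0 \<bullet> H\<^sub>\<xi> (\<gamma> t) (\<eta> t) \<ge> 1/2)" by blast
  qed (use T r d1 d2 \<rho> in \<open>auto simp: \<Lambda>_def \<rho>1_def\<close>)
qed

text \<open>The left-hand side is the differential in a horizontal direction \<open>w\<close> with unit controls \<open>v\<close> of the
  calibration constructed below. In that application \<open>p\<close> and \<open>\<xi>\<close> are the position and the covector of the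
  extremal at the time \<open>t\<close> at which it has the same \<open>\<xi>0\<close>-coordinate as \<open>x\<close>. Class $C^{1,1}$ enters through the
  quadratic error of the first-order Taylor polynomials of the fields \<open>y i\<close> at \<open>p\<close>.\<close>

lemma calibration_inequality:
  assumes x: "x \<in> cball x0 \<rho>" and p: "p \<in> cball x0 \<rho>"
    and \<Lambda>: "\<Lambda> \<ge> 1" and \<xi>: "norm \<xi> \<le> \<Lambda>" and \<xi>0: "norm \<xi>0 \<le> \<Lambda>"
    and unit: "(\<Sum>i<m. (\<xi> \<bullet> y i p)\<^sup>2) = 1" and trans: "\<xi>0 \<bullet> H\<^sub>\<xi> p \<xi> \<ge> 1/2"
    and v: "(\<Sum>i<m. (v i)\<^sup>2) = 1"
    and G: "G = real m * B" and C2: "C2 = 2 * \<Lambda> * G" and C3: "C3 = G + C2 * G"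
    and A: "A = real m * (\<Lambda> * B) + real m * (1 + C2) * (\<Lambda> * B) + C2 + 2 * C3"
    and K: "K = A + A\<^sup>2 / 2"
    and KE: "K * norm (x - p) \<le> 1" and Kt: "K * \<bar>t\<bar> \<le> 1"
    and w: "w = (\<Sum>i<m. v i *\<^sub>R y i x)" and \<beta>: "\<beta> = (\<xi>0 \<bullet> w) / (\<xi>0 \<bullet> H\<^sub>\<xi> p \<xi>)"
  shows "\<xi> \<bullet> w - \<beta> * (\<Sum>i<m. (\<xi> \<bullet> y i p) * (\<xi> \<bullet> D i p (x - p))) - K * \<beta> * (norm (x - p))\<^sup>2
      - 2 * K * t * ((x - p) \<bullet> (w - \<beta> *\<^sub>R H\<^sub>\<xi> p \<xi>)) \<le> 1"
proof -
  define u where "u = (\<lambda>i. \<xi> \<bullet> y i p)"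
  define a where "a = (\<lambda>i. \<xi> \<bullet> D i p (x - p))"
  define E where "E = norm (x - p)"
  define n where "n = sqrt (\<Sum>i<m. (v i - u i)\<^sup>2)"
  define V where "V = H\<^sub>\<xi> p \<xi>"
  have n0: "n \<ge> 0" by (simp add: n_def sum_nonneg)
  have E0: "E \<ge> 0" by (simp add: E_def)
  have G0: "G \<ge> 0" using B by (simp add: G)
  have le_n: "\<bar>v i - u i\<bar> \<le> n" if "i < m" for i
  proof -
    have "(v i - u i)\<^sup>2 \<le> (\<Sum>i<m. (v i - u i)\<^sup>2)" by (rule member_le_sum) (use that in auto)
    then show ?thesis unfolding n_def by (metis real_sqrt_abs real_sqrt_le_mono)
  qed
  have le1: "\<bar>f i\<bar> \<le> 1" if "i < m" "(\<Sum>i<m. (f i)\<^sup>2) = 1" for i and f :: "nat \<Rightarrow> real"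
  proof -
    have "(f i)\<^sup>2 \<le> (\<Sum>i<m. (f i)\<^sup>2)" by (rule member_le_sum) (use that in auto)
    then show ?thesis using that(2) by (simp add: abs_square_le_1)
  qed
  have u1: "\<bar>u i\<bar> \<le> 1" if "i < m" for i using le1[OF that, of u] unit by (simp add: u_def)
  have v1: "\<bar>v i\<bar> \<le> 1" if "i < m" for i using le1[OF that v] .
  have a_le: "\<bar>a i\<bar> \<le> (\<Lambda> * B) * E" if "i < m" for i
  proof -
    have "\<bar>a i\<bar> \<le> norm \<xi> * norm (D i p (x - p))" unfolding a_def by (rule Cauchy_Schwarz_ineq2)
    also have "\<dots> \<le> \<Lambda> * (B * E)"
      unfolding E_def using \<Lambda> by (intro mult_mono \<xi> D_le that p) auto
    finally show ?thesis by simp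
  qed
  have sum_le: "\<bar>\<Sum>i<m. f i\<bar> \<le> real m * c" if "\<And>i. i < m \<Longrightarrow> \<bar>f i\<bar> \<le> c" for f :: "nat \<Rightarrow> real" and c
    using sum_norm_bound[of "{..<m}" f c] that by simp
  have nsum_le: "norm (\<Sum>i<m. f i) \<le> real m * c" if "\<And>i. i < m \<Longrightarrow> norm (f i) \<le> c" for f :: "nat \<Rightarrow> 'e" and c
    using sum_norm_bound[of "{..<m}" f c] that by simp
  have V: "V = (\<Sum>i<m. u i *\<^sub>R y i p)" by (simp add: V_def H\<^sub>\<xi>_def u_def)
  have VG: "norm V \<le> G"
    unfolding V G
  proof (rule nsum_le)
    fix i assume i: "i < m"
    show "norm (u i *\<^sub>R y i p) \<le> B"
      using mult_mono[OF u1[OF i] y_le[OF i p]] by simp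
  qed
  have wV: "norm (w - V) \<le> G * (n + E)"
  proof -
    have "w - V = (\<Sum>i<m. (v i - u i) *\<^sub>R y i x + u i *\<^sub>R (y i x - y i p))"
      unfolding w V by (simp add: sum_subtractf[symmetric] algebra_simps)
    also have "norm \<dots> \<le> real m * (n * B + 1 * (B * E))"
    proof (rule nsum_le)
      fix i assume i: "i < m"
      have "norm ((v i - u i) *\<^sub>R y i x + u i *\<^sub>R (y i x - y i p)) \<le>
         \<bar>v i - u i\<bar> * norm (y i x) + \<bar>u i\<bar> * norm (y i x - y i p)"
        by (rule order_trans[OF norm_triangle_ineq]) simp
      also have "\<dots> \<le> n * B + 1 * (B * E)"
        unfolding E_def using n0 by (intro add_mono mult_mono le_n u1 y_le y_diff_le i x p) auto
      finally show "norm ((v i - u i) *\<^sub>R y i x + u i *\<^sub>R (y i x - y i p)) \<le> n * B + 1 * (B * E)" .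
    qed
    finally show ?thesis by (simp add: G algebra_simps)
  qed
  have th: "\<xi>0 \<bullet> V \<ge> 1/2" using trans by (simp add: V_def)
  have \<beta>1: "\<bar>\<beta> - 1\<bar> \<le> C2 * (n + E)"
  proof -
    have "\<beta> - 1 = (\<xi>0 \<bullet> (w - V)) / (\<xi>0 \<bullet> V)"
      using th by (simp add: \<beta> V_def[symmetric] inner_diff_right field_simps)
    also have "\<bar>\<dots>\<bar> = \<bar>\<xi>0 \<bullet> (w - V)\<bar> / (\<xi>0 \<bullet> V)" using th by simp
    also have "\<dots> \<le> (\<Lambda> * (G * (n + E))) / (1/2)"
    proof (rule frac_le)
      show "\<bar>\<xi>0 \<bullet> (w - V)\<bar> \<le> \<Lambda> * (G * (n + E))"
        using \<Lambda> by (intro order_trans[OF Cauchy_Schwarz_ineq2] mult_mono \<xi>0 wV) auto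
    qed (use th \<Lambda> G0 n0 E0 in auto)
    finally show ?thesis by (simp add: C2)
  qed
  have C20: "C2 \<ge> 0" using G0 \<Lambda> by (simp add: C2)
  have "\<xi> \<bullet> w - \<beta> * (\<Sum>i<m. u i * a i) - K * \<beta> * E\<^sup>2 - 2 * K * t * ((x - p) \<bullet> (w - \<beta> *\<^sub>R V)) \<le> 1"
  proof (rule calibration_real_inequality[where N="real m" and ?C1.0="\<Lambda> * B" and ?C4.0="\<Lambda> * B" and ?C2.0=C2 and ?C3.0=C3
        and n=n and A=A and va="\<Sum>i<m. v i * a i"])
    show "\<xi> \<bullet> w \<le> 1 - n\<^sup>2 / 2 + (\<Sum>i<m. v i * a i) + real m * (\<Lambda> * B) * E\<^sup>2"
    proof -
      have "n\<^sup>2 = (\<Sum>i<m. (v i - u i)\<^sup>2)" by (simp add: n_def sum_nonneg)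
      also have "\<dots> = (\<Sum>i<m. (v i)\<^sup>2) + (\<Sum>i<m. (u i)\<^sup>2) - 2 * (\<Sum>i<m. v i * u i)"
        by (simp add: power2_diff sum.distrib sum_subtractf sum_distrib_left mult.assoc)
      finally have vu: "(\<Sum>i<m. v i * u i) = 1 - n\<^sup>2 / 2"
        using v unit unfolding u_def by linarith
      have "\<xi> \<bullet> w - (\<Sum>i<m. v i * u i) - (\<Sum>i<m. v i * a i) = (\<Sum>i<m. v i * (\<xi> \<bullet> (y i x - y i p - D i p (x - p))))"
        by (simp add: w u_def a_def inner_sum_right inner_diff_right sum_subtractf[symmetric] algebra_simps)
      also have "\<bar>\<dots>\<bar> \<le> real m * (1 * (\<Lambda> * (B * E\<^sup>2)))"
      proof (rule sum_le)
        fix i assume i: "i < m"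
        have "\<bar>\<xi> \<bullet> (y i x - y i p - D i p (x - p))\<bar> \<le> \<Lambda> * (B * E\<^sup>2)"
          unfolding E_def using \<Lambda> by (intro order_trans[OF Cauchy_Schwarz_ineq2] mult_mono \<xi> taylor_le i x p) auto
        then show "\<bar>v i * (\<xi> \<bullet> (y i x - y i p - D i p (x - p)))\<bar> \<le> 1 * (\<Lambda> * (B * E\<^sup>2))"
          unfolding abs_mult by (intro mult_mono v1 i) auto
      qed
      finally show ?thesis unfolding vu by (simp add: abs_le_iff mult.assoc)
    qed
    show "(\<Sum>i<m. v i * a i) - \<beta> * (\<Sum>i<m. u i * a i) \<le> real m * (1 + C2) * (\<Lambda> * B) * (n + E) * E"
    proof -
      have "(\<Sum>i<m. v i * a i) - \<beta> * (\<Sum>i<m. u i * a i) = (\<Sum>i<m. ((v i - u i) - (\<beta> - 1) * u i) * a i)"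
        by (simp add: sum_distrib_left sum_subtractf[symmetric] algebra_simps)
      also have "\<dots> \<le> \<bar>\<dots>\<bar>" by simp
      also have "\<dots> \<le> real m * (((n + E) + C2 * (n + E) * 1) * ((\<Lambda> * B) * E))"
      proof (rule sum_le)
        fix i assume i: "i < m"
        have "\<bar>(v i - u i) - (\<beta> - 1) * u i\<bar> \<le> \<bar>v i - u i\<bar> + \<bar>\<beta> - 1\<bar> * \<bar>u i\<bar>"
          by (metis abs_mult abs_triangle_ineq4)
        also have "\<dots> \<le> (n + E) + C2 * (n + E) * 1"
          using le_n[OF i] E0 n0 C20 by (intro add_mono mult_mono \<beta>1 u1 i) auto
        finally show "\<bar>((v i - u i) - (\<beta> - 1) * u i) * a i\<bar> \<le> ((n + E) + C2 * (n + E) * 1) * ((\<Lambda> * B) * E)"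
          unfolding abs_mult using E0 n0 C20 by (intro mult_mono a_le i) auto
      qed
      finally show ?thesis by (simp add: algebra_simps)
    qed
    show "\<bar>(x - p) \<bullet> (w - \<beta> *\<^sub>R V)\<bar> \<le> C3 * (n + E) * E"
    proof -
      have "w - \<beta> *\<^sub>R V = (w - V) - (\<beta> - 1) *\<^sub>R V" by (simp add: algebra_simps)
      also have "norm \<dots> \<le> norm (w - V) + \<bar>\<beta> - 1\<bar> * norm V"
        by (rule order_trans[OF norm_triangle_ineq4]) simp
      also have "\<dots> \<le> G * (n + E) + C2 * (n + E) * G"
        using E0 n0 C20 by (intro add_mono mult_mono \<beta>1 VG wV) auto
      also have "\<dots> = C3 * (n + E)" by (simp add: C3 algebra_simps)
      finally have "norm (w - \<beta> *\<^sub>R V) \<le> C3 * (n + E)" .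
      then have "E * norm (w - \<beta> *\<^sub>R V) \<le> E * (C3 * (n + E))" using E0 by (rule mult_left_mono)
      then show ?thesis
        using Cauchy_Schwarz_ineq2[of "x - p" "w - \<beta> *\<^sub>R V"] by (simp add: E_def mult_ac)
    qed
  qed (use \<beta>1 n0 E0 C20 G0 \<Lambda> B A K KE Kt in \<open>auto simp: C3 E_def\<close>)
  then show ?thesis by (simp add: u_def a_def E_def V_def)
qed

text \<open>A function \<open>S\<close> on \<open>ball x0 R\<close> with differential \<open>S'\<close>, Lipschitz with constant \<open>L\<close>, whose horizontal
  gradient is nowhere longer than one.\<close>

definition calibration :: "real \<Rightarrow> real \<Rightarrow> ('e \<Rightarrow> real) \<Rightarrow> ('e \<Rightarrow> 'e \<Rightarrow> real) \<Rightarrow> bool" where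
  "calibration R L S S' \<longleftrightarrow> (\<forall>x\<in>ball x0 R. (S has_derivative S' x) (at x) \<and>
     (\<forall>h. \<bar>S' x h\<bar> \<le> L * norm h) \<and> (\<forall>v. S' x (\<Sum>i<m. v i *\<^sub>R y i x) \<le> sqrt (\<Sum>i<m. (v i)\<^sup>2)))"

lemma extremal_velocity_le:
  assumes "x \<in> cball x0 \<rho>" "(\<Sum>i<m. (\<xi> \<bullet> y i x)\<^sup>2) = 1"
  shows "norm (H\<^sub>\<xi> x \<xi>) \<le> real m * B"
proof -
  have "norm ((\<xi> \<bullet> y i x) *\<^sub>R y i x) \<le> B" if i: "i < m" for i
  proof -
    have "(\<xi> \<bullet> y i x)\<^sup>2 \<le> (\<Sum>i<m. (\<xi> \<bullet> y i x)\<^sup>2)" by (rule member_le_sum) (use i in auto)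
    then have "\<bar>\<xi> \<bullet> y i x\<bar> \<le> 1" using assms(2) by (simp add: abs_square_le_1)
    from mult_mono[OF this y_le[OF i assms(1)]] show ?thesis by simp
  qed
  then show ?thesis
    unfolding H\<^sub>\<xi>_def using sum_norm_bound[of "{..<m}" "\<lambda>i. (\<xi> \<bullet> y i x) *\<^sub>R y i x" B] by simp
qed

lemma extremal_speed_le:
  assumes ext: "extremal T \<Lambda> \<gamma> \<eta>" and t: "t \<in> {-T..T}" and T: "T > 0"
  shows "norm (\<gamma> t - \<gamma> 0) \<le> real m * B * \<bar>t\<bar>"
proof -
  have "norm (\<gamma> t - \<gamma> 0) \<le> (real m * B) * norm (t - 0)"
  proof (rule differentiable_bound[of "{-T..T}" \<gamma> "\<lambda>s h. h *\<^sub>R H\<^sub>\<xi> (\<gamma> s) (\<eta> s)"])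
    fix s assume s: "s \<in> {-T..T}"
    show "(\<gamma> has_derivative (\<lambda>h. h *\<^sub>R H\<^sub>\<xi> (\<gamma> s) (\<eta> s))) (at s within {-T..T})"
      using ext s by (auto simp: extremal_def has_vector_derivative_def)
    have "norm (H\<^sub>\<xi> (\<gamma> s) (\<eta> s)) \<le> real m * B"
      using ext s by (intro extremal_velocity_le) (auto simp: extremal_def)
    then show "onorm (\<lambda>h. h *\<^sub>R H\<^sub>\<xi> (\<gamma> s) (\<eta> s)) \<le> real m * B"
      by (simp add: onorm_scaleR_left onorm_id)
  qed (use t T in auto)
  then show ?thesis by simp
qed

text \<open>Around every extremal \<open>\<gamma>\<close> there is a calibration with \<open>S (\<gamma> t) = t\<close> for small \<open>t\<close>, on a ball whose radius does
  not depend on \<open>\<gamma>\<close>. Let \<open>tx x\<close> be the time at which \<open>\<gamma>\<close> has the same \<open>\<xi>0\<close>-coordinate as \<open>x\<close>, and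
  \<open>e x = x - \<gamma> (tx x)\<close>. Then \<open>S x = tx x + \<eta> (tx x) \<bullet> e x - K * tx x * (e x \<bullet> e x)\<close>. The first two terms
  have horizontal gradient of length one along \<open>\<gamma>\<close>, up to an error of second order in \<open>e x\<close>. The third
  term absorbs this error: since \<open>tx\<close> increases at rate about one along \<open>\<gamma>\<close>, it contributes \<open>- K * (e x \<bullet> e x)\<close>
  to the derivative, while its remaining contributions carry the small factor \<open>tx x\<close>.\<close>

lemma extremals_calibrated:
  assumes \<Lambda>: "\<Lambda> \<ge> 1" and T: "T > 0" and \<xi>0: "norm \<xi>0 \<le> \<Lambda>"
  obtains R M where "R > 0" "R \<le> \<rho>"
    "\<And>\<gamma> \<eta>. \<gamma> 0 \<in> ball x0 R \<Longrightarrow> extremal T \<Lambda> \<gamma> \<eta> \<Longrightarrow>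
       (\<forall>t\<in>{-T..T}. \<xi>0 \<bullet> H\<^sub>\<xi> (\<gamma> t) (\<eta> t) \<ge> 1/2) \<Longrightarrow>
       \<exists>S S'. calibration R M S S' \<and>
              (\<forall>t\<in>{-T..T}. \<Lambda> * (real m * B * \<bar>t\<bar>) < T / 2 \<longrightarrow> S (\<gamma> t) = t)"
proof -
  define G where "G = real m * B"
  define C2 where "C2 = 2 * \<Lambda> * G"
  define C3 where "C3 = G + C2 * G"
  define A where "A = real m * (\<Lambda> * B) + real m * (1 + C2) * (\<Lambda> * B) + C2 + 2 * C3"
  define K where "K = A + A\<^sup>2 / 2"
  define M where "M = \<Lambda> + 2 * \<Lambda> * (real m * (\<Lambda> * B)) + 2 * \<Lambda> + 2 * (1 + 2 * \<Lambda> * G)"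
  have G0: "G \<ge> 0" using B by (simp add: G_def)
  have K0: "K \<ge> 0"
  proof -
    have "A \<ge> 0" using G0 B \<Lambda> by (simp add: A_def C2_def C3_def)
    then show ?thesis by (simp add: K_def)
  qed
  \<comment> \<open>\<open>c * R\<close> will bound both \<open>\<bar>tx x\<bar>\<close> and \<open>norm (e x)\<close>; the last bound on \<open>R\<close> makes \<open>K\<close> times either at most one\<close>
  define c where "c = 2 + 4 * \<Lambda> * G + 4 * \<Lambda>"
  have c0: "c > 0" using G0 \<Lambda> by (auto simp: c_def intro!: add_pos_nonneg)
  define R where "R = min \<rho> (min (T / (8 * \<Lambda>)) (1 / ((K + 1) * c)))"
  have R: "R > 0" "R \<le> \<rho>"
    using \<rho> T \<Lambda> K0 c0 by (auto simp: R_def)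
  have RT: "4 * \<Lambda> * R \<le> T / 2"
  proof -
    have "R \<le> T / (8 * \<Lambda>)" by (auto simp: R_def)
    then show ?thesis using \<Lambda> by (simp add: field_simps)
  qed
  have "R \<le> 1 / ((K + 1) * c)" by (auto simp: R_def)
  then have Kc: "(K + 1) * (c * R) \<le> 1"
    using K0 c0 pos_le_divide_eq[of "(K + 1) * c" R 1] by (simp add: mult_ac)
  have cR: "c * R \<ge> 0" using c0 R by simp
  have KcR: "K * (c * R) \<le> 1" "c * R \<le> 1"
    using Kc cR mult_nonneg_nonneg[OF K0 cR] by (auto simp: algebra_simps)
  show thesis
  proof (rule that[OF R])
    fix \<gamma> \<eta>
    assume q: "\<gamma> 0 \<in> ball x0 R" and ext: "extremal T \<Lambda> \<gamma> \<eta>"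
      and tr: "\<forall>t\<in>{-T..T}. \<xi>0 \<bullet> H\<^sub>\<xi> (\<gamma> t) (\<eta> t) \<ge> 1/2"
    define V where "V = (\<lambda>t. H\<^sub>\<xi> (\<gamma> t) (\<eta> t))"
    have \<gamma>C: "\<gamma> t \<in> cball x0 \<rho>" and \<eta>\<Lambda>: "norm (\<eta> t) \<le> \<Lambda>" and unit: "(\<Sum>i<m. (\<eta> t \<bullet> y i (\<gamma> t))\<^sup>2) = 1"
      and d\<gamma>: "(\<gamma> has_vector_derivative V t) (at t within {-T..T})"
      and d\<eta>: "(\<eta> has_vector_derivative - H\<^sub>x (\<gamma> t) (\<eta> t)) (at t within {-T..T})"
      if "t \<in> {-T..T}" for t
      using ext that by (auto simp: extremal_def V_def)
    define \<theta> where "\<theta> = (\<lambda>t. \<xi>0 \<bullet> (\<gamma> t - \<gamma> 0))"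
    have VG: "norm (V t) \<le> G" if "t \<in> {-T..T}" for t
      unfolding V_def G_def by (rule extremal_velocity_le[OF \<gamma>C[OF that] unit[OF that]])
    have \<gamma>q: "norm (\<gamma> t - \<gamma> 0) \<le> G * \<bar>t\<bar>" if "t \<in> {-T..T}" for t
      using extremal_speed_le[OF ext that T] by (simp add: G_def)
    have d\<theta>: "(\<theta> has_real_derivative \<xi>0 \<bullet> V t) (at t within {-T..T})" if "t \<in> {-T..T}" for t
    proof -
      have "(\<theta> has_derivative (\<lambda>h. \<xi>0 \<bullet> (h *\<^sub>R V t - 0))) (at t within {-T..T})"
        unfolding \<theta>_def
        by (intro has_derivative_inner_right has_derivative_diff has_derivative_const
            d\<gamma>[OF that, unfolded has_vector_derivative_def])
      then show ?thesis
        unfolding has_field_derivative_def by (rule has_derivative_eq_rhs) (simp add: fun_eq_iff)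
    qed
    obtain \<tau> where \<tau>: "\<And>s. \<bar>s\<bar> < T/2 \<Longrightarrow> \<tau> s \<in> {-T<..<T} \<and> \<bar>\<tau> s\<bar> \<le> 2 * \<bar>s\<bar> \<and> \<theta> (\<tau> s) = s"
      and d\<tau>: "\<And>s. \<bar>s\<bar> < T/2 \<Longrightarrow> (\<tau> has_real_derivative 1 / (\<xi>0 \<bullet> V (\<tau> s))) (at s)"
      and \<tau>\<theta>: "\<And>t. t \<in> {-T..T} \<Longrightarrow> \<bar>\<theta> t\<bar> < T/2 \<Longrightarrow> \<tau> (\<theta> t) = t"
      by (rule inverse_function_on_interval[OF T _ d\<theta>]) (use tr in \<open>auto simp: \<theta>_def V_def\<close>)
    define tx where "tx = (\<lambda>x. \<tau> (\<xi>0 \<bullet> (x - \<gamma> 0)))"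
    define e where "e = (\<lambda>x. x - \<gamma> (tx x))"
    define \<beta> where "\<beta> = (\<lambda>x h. (\<xi>0 \<bullet> h) / (\<xi>0 \<bullet> V (tx x)))"
    define S where "S = (\<lambda>x. tx x + \<eta> (tx x) \<bullet> e x - K * (tx x * (e x \<bullet> e x)))"
    define S' where "S' = (\<lambda>x h. \<eta> (tx x) \<bullet> h
       - \<beta> x h * (\<Sum>i<m. (\<eta> (tx x) \<bullet> y i (\<gamma> (tx x))) * (\<eta> (tx x) \<bullet> D i (\<gamma> (tx x)) (e x)))
       - K * \<beta> x h * (norm (e x))\<^sup>2 - 2 * K * tx x * (e x \<bullet> (h - \<beta> x h *\<^sub>R V (tx x))))"
    have near: "\<bar>\<xi>0 \<bullet> (x - \<gamma> 0)\<bar> < T / 2" "\<bar>tx x\<bar> \<le> c * R" "norm (e x) \<le> c * R" "tx x \<in> {-T<..<T}"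
      if x: "x \<in> ball x0 R" for x
    proof -
      have xq: "norm (x - \<gamma> 0) < 2 * R"
        using x q dist_triangle_less_add[of x x0 R "\<gamma> 0" R] by (simp add: dist_norm[symmetric] dist_commute)
      have s: "\<bar>\<xi>0 \<bullet> (x - \<gamma> 0)\<bar> \<le> \<Lambda> * (2 * R)"
        using xq \<Lambda> by (intro order_trans[OF Cauchy_Schwarz_ineq2] mult_mono \<xi>0) auto
      have "\<Lambda> * R > 0" using \<Lambda> R by simp
      then show s': "\<bar>\<xi>0 \<bullet> (x - \<gamma> 0)\<bar> < T / 2" using s RT by (simp add: mult.assoc)
      show t: "tx x \<in> {-T<..<T}" using \<tau>[OF s'] by (simp add: tx_def)
      have t4: "\<bar>tx x\<bar> \<le> 4 * \<Lambda> * R" using \<tau>[OF s'] s by (simp add: tx_def)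
      also have "\<dots> \<le> c * R"
        using \<Lambda> G0 R by (intro mult_right_mono) (auto simp: c_def)
      finally show "\<bar>tx x\<bar> \<le> c * R" .
      have "norm (e x) \<le> norm (x - \<gamma> 0) + norm (\<gamma> (tx x) - \<gamma> 0)"
        unfolding e_def by (metis diff_diff_eq2 add_diff_cancel_right' diff_add_cancel norm_triangle_ineq4)
      also have "\<dots> \<le> 2 * R + G * (4 * \<Lambda> * R)"
        using xq \<gamma>q[of "tx x"] t mult_left_mono[OF t4 G0] by auto
      also have "\<dots> \<le> c * R"
        using \<Lambda> R by (simp add: c_def algebra_simps)
      finally show "norm (e x) \<le> c * R" .
    qed
    have tI: "tx x \<in> {-T..T}" if "x \<in> ball x0 R" for x using near(4)[OF that] by auto
    have atI: "at (tx x) within {-T..T} = at (tx x)" if "x \<in> ball x0 R" for x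
      using near(4)[OF that] by (intro at_within_Icc_at) auto
    have KE: "K * norm (e x) \<le> 1" "norm (e x) \<le> 1" "K * \<bar>tx x\<bar> \<le> 1" if "x \<in> ball x0 R" for x
      using near[OF that] KcR mult_left_mono[OF near(3)[OF that] K0] mult_left_mono[OF near(2)[OF that] K0]
      by linarith+
    have th: "\<xi>0 \<bullet> V (tx x) \<ge> 1/2" if "x \<in> ball x0 R" for x
      using tr tI[OF that] by (simp add: V_def)
    have \<beta>le: "\<bar>\<beta> x h\<bar> \<le> 2 * \<Lambda> * norm h" if x: "x \<in> ball x0 R" for x h
    proof -
      have "\<bar>\<beta> x h\<bar> = \<bar>\<xi>0 \<bullet> h\<bar> / (\<xi>0 \<bullet> V (tx x))" using th[OF x] by (simp add: \<beta>_def)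
      also have "\<dots> \<le> (\<Lambda> * norm h) / (1/2)"
        using th[OF x] \<Lambda> by (intro frac_le order_trans[OF Cauchy_Schwarz_ineq2] mult_right_mono \<xi>0) auto
      finally show ?thesis by simp
    qed
    have dS: "(S has_derivative S' x) (at x)" if x: "x \<in> ball x0 R" for x
    proof -
      have dt: "(tx has_derivative \<beta> x) (at x)"
      proof -
        have 1: "((\<lambda>z. \<xi>0 \<bullet> (z - \<gamma> 0)) has_derivative (\<lambda>h. \<xi>0 \<bullet> h)) (at x)"
          by (rule has_derivative_eq_rhs, rule has_derivative_inner_right,
              rule has_derivative_diff[OF has_derivative_ident has_derivative_const]) simp
        have 2: "(\<tau> has_derivative (\<lambda>h. (1 / (\<xi>0 \<bullet> V (tx x))) * h)) (at (\<xi>0 \<bullet> (x - \<gamma> 0)))"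
          using d\<tau>[OF near(1)[OF x]] unfolding has_field_derivative_def tx_def .
        show ?thesis
          unfolding tx_def[of] by (rule has_derivative_eq_rhs[OF has_derivative_compose[OF 1 2]])
            (simp add: \<beta>_def tx_def fun_eq_iff)
      qed
      have dg: "((\<lambda>z. \<gamma> (tx z)) has_derivative (\<lambda>h. \<beta> x h *\<^sub>R V (tx x))) (at x)"
        using has_derivative_compose[OF dt] d\<gamma>[OF tI[OF x]] unfolding atI[OF x] has_vector_derivative_def by blast
      have dl: "((\<lambda>z. \<eta> (tx z)) has_derivative (\<lambda>h. \<beta> x h *\<^sub>R (- H\<^sub>x (\<gamma> (tx x)) (\<eta> (tx x))))) (at x)"
        using has_derivative_compose[OF dt] d\<eta>[OF tI[OF x]] unfolding atI[OF x] has_vector_derivative_def by blast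
      have de: "(e has_derivative (\<lambda>h. h - \<beta> x h *\<^sub>R V (tx x))) (at x)"
        unfolding e_def by (intro has_derivative_diff has_derivative_ident dg)
      have "(S has_derivative (\<lambda>h. (\<beta> x h + (\<eta> (tx x) \<bullet> (h - \<beta> x h *\<^sub>R V (tx x)) +
            (\<beta> x h *\<^sub>R (- H\<^sub>x (\<gamma> (tx x)) (\<eta> (tx x)))) \<bullet> e x))
          - K * (tx x * (e x \<bullet> (h - \<beta> x h *\<^sub>R V (tx x)) + (h - \<beta> x h *\<^sub>R V (tx x)) \<bullet> e x) + \<beta> x h * (e x \<bullet> e x)))) (at x)"
        unfolding S_def
        by (intro has_derivative_diff has_derivative_add has_derivative_mult_right has_derivative_mult
            has_derivative_inner dt dl de)
      note S1 = this
      have unit_V: "\<eta> (tx x) \<bullet> V (tx x) = 1"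
        using unit[OF tI[OF x]] by (simp add: V_def H\<^sub>\<xi>_def inner_sum_right power2_eq_square)
      have "(\<lambda>h. (\<beta> x h + (\<eta> (tx x) \<bullet> (h - \<beta> x h *\<^sub>R V (tx x)) +
            (\<beta> x h *\<^sub>R (- H\<^sub>x (\<gamma> (tx x)) (\<eta> (tx x)))) \<bullet> e x))
          - K * (tx x * (e x \<bullet> (h - \<beta> x h *\<^sub>R V (tx x)) + (h - \<beta> x h *\<^sub>R V (tx x)) \<bullet> e x) + \<beta> x h * (e x \<bullet> e x)))
        = S' x"
      proof
        fix h
        have 1: "\<eta> (tx x) \<bullet> (h - \<beta> x h *\<^sub>R V (tx x)) = \<eta> (tx x) \<bullet> h - \<beta> x h"
          by (simp add: inner_diff_right unit_V)
        have 2: "(\<beta> x h *\<^sub>R (- H\<^sub>x (\<gamma> (tx x)) (\<eta> (tx x)))) \<bullet> e x = - (\<beta> x h *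
            (\<Sum>i<m. (\<eta> (tx x) \<bullet> y i (\<gamma> (tx x))) * (\<eta> (tx x) \<bullet> D i (\<gamma> (tx x)) (e x))))"
          by (simp add: H\<^sub>x_inner[OF \<gamma>C[OF tI[OF x]]])
        have 3: "(h - \<beta> x h *\<^sub>R V (tx x)) \<bullet> e x = e x \<bullet> (h - \<beta> x h *\<^sub>R V (tx x))"
          by (rule inner_commute)
        have 4: "b + ((a - b) + - (b * w)) - K * (t * (d + d) + b * n) = a - b * w - K * b * n - 2 * K * t * d"
          for a b d n t w :: real by (simp add: algebra_simps)
        show "(\<beta> x h + (\<eta> (tx x) \<bullet> (h - \<beta> x h *\<^sub>R V (tx x)) +
            (\<beta> x h *\<^sub>R (- H\<^sub>x (\<gamma> (tx x)) (\<eta> (tx x)))) \<bullet> e x))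
          - K * (tx x * (e x \<bullet> (h - \<beta> x h *\<^sub>R V (tx x)) + (h - \<beta> x h *\<^sub>R V (tx x)) \<bullet> e x) + \<beta> x h * (e x \<bullet> e x))
          = S' x h"
          unfolding S'_def 1 2 3 4 power2_norm_eq_inner ..
      qed
      with S1 show ?thesis by simp
    qed
    have S'M: "\<bar>S' x h\<bar> \<le> M * norm h" if x: "x \<in> ball x0 R" for x h
    proof -
      let ?t = "tx x"
      have 1: "\<bar>\<eta> ?t \<bullet> h\<bar> \<le> \<Lambda> * norm h"
        by (intro order_trans[OF Cauchy_Schwarz_ineq2] mult_right_mono \<eta>\<Lambda> tI x) auto
      have "\<bar>\<Sum>i<m. (\<eta> ?t \<bullet> y i (\<gamma> ?t)) * (\<eta> ?t \<bullet> D i (\<gamma> ?t) (e x))\<bar> \<le> real m * (1 * (\<Lambda> * B))"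
      proof -
        have "\<bar>(\<eta> ?t \<bullet> y i (\<gamma> ?t)) * (\<eta> ?t \<bullet> D i (\<gamma> ?t) (e x))\<bar> \<le> 1 * (\<Lambda> * B)" if i: "i < m" for i
        proof -
          have "(\<eta> ?t \<bullet> y i (\<gamma> ?t))\<^sup>2 \<le> (\<Sum>i<m. (\<eta> ?t \<bullet> y i (\<gamma> ?t))\<^sup>2)"
            by (rule member_le_sum) (use i in auto)
          then have "\<bar>\<eta> ?t \<bullet> y i (\<gamma> ?t)\<bar> \<le> 1" using unit[OF tI[OF x]] by (simp add: abs_square_le_1)
          moreover have "\<bar>\<eta> ?t \<bullet> D i (\<gamma> ?t) (e x)\<bar> \<le> \<Lambda> * (B * 1)"
          proof (rule order_trans[OF Cauchy_Schwarz_ineq2], rule mult_mono)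
            show "norm (D i (\<gamma> ?t) (e x)) \<le> B * 1"
              using D_le[OF i \<gamma>C[OF tI[OF x]], of "e x"] mult_left_mono[OF KE(2)[OF x], of B] B by linarith
          qed (use \<eta>\<Lambda>[OF tI[OF x]] \<Lambda> in auto)
          ultimately show ?thesis unfolding abs_mult by (intro mult_mono) auto
        qed
        then show ?thesis
          using sum_norm_bound[of "{..<m}" "\<lambda>i. (\<eta> ?t \<bullet> y i (\<gamma> ?t)) * (\<eta> ?t \<bullet> D i (\<gamma> ?t) (e x))" "1 * (\<Lambda> * B)"] by simp
      qed
      then have 2: "\<bar>\<beta> x h * (\<Sum>i<m. (\<eta> ?t \<bullet> y i (\<gamma> ?t)) * (\<eta> ?t \<bullet> D i (\<gamma> ?t) (e x)))\<bar> \<le> (2 * \<Lambda> * norm h) * (real m * (1 * (\<Lambda> * B)))"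
        unfolding abs_mult using \<Lambda> by (intro mult_mono \<beta>le x) auto
      have "\<bar>K * \<beta> x h * (norm (e x))\<^sup>2\<bar> = \<bar>\<beta> x h\<bar> * ((K * norm (e x)) * norm (e x))"
        using K0 by (simp add: abs_mult power2_eq_square)
      also have "\<dots> \<le> (2 * \<Lambda> * norm h) * (1 * 1)"
        using KE[OF x] K0 \<Lambda> by (intro mult_mono \<beta>le x) auto
      finally have 3: "\<bar>K * \<beta> x h * (norm (e x))\<^sup>2\<bar> \<le> 2 * \<Lambda> * norm h" by simp
      have "norm (h - \<beta> x h *\<^sub>R V ?t) \<le> norm h + \<bar>\<beta> x h\<bar> * norm (V ?t)"
        by (rule order_trans[OF norm_triangle_ineq4]) simp
      also have "\<dots> \<le> norm h + (2 * \<Lambda> * norm h) * G"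
        using \<Lambda> by (intro add_mono mult_mono \<beta>le x VG tI) auto
      finally have hV: "norm (h - \<beta> x h *\<^sub>R V ?t) \<le> (1 + 2 * \<Lambda> * G) * norm h" by (simp add: algebra_simps)
      have "\<bar>2 * K * ?t * (e x \<bullet> (h - \<beta> x h *\<^sub>R V ?t))\<bar> = 2 * (K * \<bar>?t\<bar>) * \<bar>e x \<bullet> (h - \<beta> x h *\<^sub>R V ?t)\<bar>"
        using K0 by (simp add: abs_mult)
      also have "\<dots> \<le> 2 * 1 * (1 * ((1 + 2 * \<Lambda> * G) * norm h))"
        using KE[OF x] K0 \<Lambda> hV by (intro mult_mono order_trans[OF Cauchy_Schwarz_ineq2]) auto
      finally have 4: "\<bar>2 * K * ?t * (e x \<bullet> (h - \<beta> x h *\<^sub>R V ?t))\<bar> \<le> 2 * (1 + 2 * \<Lambda> * G) * norm h"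
        by (simp only: mult_1_left mult_1_right mult.assoc)
      have "\<bar>S' x h\<bar> \<le> \<Lambda> * norm h + (2 * \<Lambda> * norm h) * (real m * (1 * (\<Lambda> * B))) + 2 * \<Lambda> * norm h + 2 * (1 + 2 * \<Lambda> * G) * norm h"
        unfolding S'_def using 1 2 3 4 by linarith
      also have "\<dots> = M * norm h" by (simp add: M_def algebra_simps)
      finally show ?thesis .
    qed
    have unit_le: "S' x (\<Sum>i<m. v i *\<^sub>R y i x) \<le> 1" if x: "x \<in> ball x0 R" and v: "(\<Sum>i<m. (v i)\<^sup>2) = 1" for x v
    proof -
      have xC: "x \<in> cball x0 \<rho>" using x R by auto
      show ?thesis
        unfolding S'_def e_def V_def
        by (rule calibration_inequality[OF xC \<gamma>C[OF tI[OF x]] \<Lambda> \<eta>\<Lambda>[OF tI[OF x]] \<xi>0 unit[OF tI[OF x]] _ v G_def C2_def C3_def A_def K_def])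
          (use KE[OF x] th[OF x] in \<open>simp_all add: e_def V_def \<beta>_def\<close>)
    qed
    have S'_le: "S' x (\<Sum>i<m. v i *\<^sub>R y i x) \<le> sqrt (\<Sum>i<m. (v i)\<^sup>2)" if x: "x \<in> ball x0 R" for x v
    proof -
      define s where "s = sqrt (\<Sum>i<m. (v i)\<^sup>2)"
      have lin: "linear (S' x)" using dS[OF x] by (rule has_derivative_linear)
      show ?thesis
      proof (cases "s = 0")
        case True
        then have "\<forall>i<m. v i = 0" by (simp add: s_def sum_nonneg_eq_0_iff)
        then show ?thesis using linear_0[OF lin] by simp
      next
        case False
        have "s \<ge> 0" by (simp add: s_def sum_nonneg)
        then have s: "s > 0" using False by simp
        have s2: "(\<Sum>i<m. (v i)\<^sup>2) = s\<^sup>2" by (simp add: s_def sum_nonneg)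
        have "S' x (\<Sum>i<m. (v i / s) *\<^sub>R y i x) \<le> 1"
          by (rule unit_le[OF x]) (use s s2 in \<open>simp add: power_divide sum_divide_distrib[symmetric]\<close>)
        moreover have "(\<Sum>i<m. v i *\<^sub>R y i x) = s *\<^sub>R (\<Sum>i<m. (v i / s) *\<^sub>R y i x)"
          using s by (simp add: scaleR_sum_right)
        ultimately show ?thesis
          using s by (simp add: linear_scale[OF lin] s_def[symmetric])
      qed
    qed
    have "S (\<gamma> t) = t" if t: "t \<in> {-T..T}" "\<Lambda> * (real m * B * \<bar>t\<bar>) < T / 2" for t
    proof -
      have "\<bar>\<theta> t\<bar> \<le> \<Lambda> * (G * \<bar>t\<bar>)"
        unfolding \<theta>_def using \<Lambda> by (intro order_trans[OF Cauchy_Schwarz_ineq2] mult_mono \<xi>0 \<gamma>q t) auto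
      then have "tx (\<gamma> t) = t" using \<tau>\<theta>[OF t(1)] t(2) by (simp add: tx_def \<theta>_def G_def)
      then show ?thesis by (simp add: S_def e_def)
    qed
    moreover have "calibration R M S S'" unfolding calibration_def using dS S'M S'_le by blast
    ultimately show "\<exists>S S'. calibration R M S S' \<and>
              (\<forall>t\<in>{-T..T}. \<Lambda> * (real m * B * \<bar>t\<bar>) < T / 2 \<longrightarrow> S (\<gamma> t) = t)"
      by blast
  qed
qed

text \<open>The two preceding lemmas together: unit-speed curves with calibrations, uniformly in the
  midpoint \<open>q\<close>.\<close>

lemma frame_calibration:
  assumes m: "m > 0" and y0: "y 0 x0 \<noteq> 0"
  obtains R T M where "R > 0" "R \<le> \<rho>" "T > 0"
    "\<And>q. q \<in> ball x0 (R/4) \<Longrightarrow> \<exists>\<gamma> u S S'. \<gamma> 0 = q \<and>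
       (\<forall>t\<in>{-T..T}. \<gamma> t \<in> ball x0 (R/2) \<and> (\<Sum>i<m. (u t i)\<^sup>2) = 1 \<and>
          (\<gamma> has_vector_derivative (\<Sum>i<m. u t i *\<^sub>R y i (\<gamma> t))) (at t within {-T..T}) \<and> S (\<gamma> t) = t) \<and>
       calibration R M S S'"
proof -
  obtain \<xi>0 \<Lambda> T0 \<rho>1 where T0: "T0 > 0" and \<Lambda>: "\<Lambda> \<ge> 1" and \<xi>0: "norm \<xi>0 \<le> \<Lambda>" and \<rho>1: "0 < \<rho>1" "\<rho>1 \<le> \<rho>"
    and ext: "\<And>q. q \<in> cball x0 \<rho>1 \<Longrightarrow> \<exists>\<gamma> \<eta>. \<gamma> 0 = q \<and> extremal T0 \<Lambda> \<gamma> \<eta> \<and>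
       (\<forall>t\<in>{-T0..T0}. \<xi>0 \<bullet> H\<^sub>\<xi> (\<gamma> t) (\<eta> t) \<ge> 1/2)"
    by (rule extremals_exist[OF m y0]) blast
  obtain R0 M where R0: "R0 > 0" "R0 \<le> \<rho>" and cal: "\<And>\<gamma> \<eta>. \<gamma> 0 \<in> ball x0 R0 \<Longrightarrow> extremal T0 \<Lambda> \<gamma> \<eta> \<Longrightarrow>
       (\<forall>t\<in>{-T0..T0}. \<xi>0 \<bullet> H\<^sub>\<xi> (\<gamma> t) (\<eta> t) \<ge> 1/2) \<Longrightarrow>
       \<exists>S S'. calibration R0 M S S' \<and>
              (\<forall>t\<in>{-T0..T0}. \<Lambda> * (real m * B * \<bar>t\<bar>) < T0 / 2 \<longrightarrow> S (\<gamma> t) = t)"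
    by (rule extremals_calibrated[OF \<Lambda> T0 \<xi>0]) blast
  define R where "R = min R0 \<rho>1"
  define G where "G = real m * B"
  have G: "G > 0" using m B by (simp add: G_def)
  define T where "T = min (T0 / 2) (min (T0 / (4 * \<Lambda> * G)) (R / (8 * G)))"
  have R: "R > 0" "R \<le> \<rho>" "R \<le> R0" "R \<le> \<rho>1" using R0 \<rho>1 by (auto simp: R_def)
  have T: "T > 0" using T0 \<Lambda> G R by (auto simp: T_def)
  have TT: "T < T0" "\<Lambda> * (G * T) < T0 / 2" "G * T < R / 4"
  proof -
    have T: "T \<le> T0 / 2" "T \<le> T0 / (4 * \<Lambda> * G)" "T \<le> R / (8 * G)" by (auto simp: T_def)
    show "T < T0" using T(1) T0 by linarith
    have "\<Lambda> * (G * T) \<le> T0 / 4" using T(2) \<Lambda> G by (simp add: field_simps)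
    then show "\<Lambda> * (G * T) < T0 / 2" using T0 by linarith
    have "G * T \<le> R / 8" using T(3) G by (simp add: field_simps)
    then show "G * T < R / 4" using R(1) by linarith
  qed
  show thesis
  proof (rule that[of R T M])
    fix q assume q: "q \<in> ball x0 (R/4)"
    have "q \<in> cball x0 \<rho>1" using q R by auto
    then obtain \<gamma> \<eta> where g: "\<gamma> 0 = q" "extremal T0 \<Lambda> \<gamma> \<eta>" "\<forall>t\<in>{-T0..T0}. \<xi>0 \<bullet> H\<^sub>\<xi> (\<gamma> t) (\<eta> t) \<ge> 1/2"
      using ext by blast
    have "\<gamma> 0 \<in> ball x0 R0" using q R g(1) by auto
    from cal[OF this g(2,3)] obtain S S' where
      S: "calibration R0 M S S'"
      and St: "\<forall>t\<in>{-T0..T0}. \<Lambda> * (real m * B * \<bar>t\<bar>) < T0 / 2 \<longrightarrow> S (\<gamma> t) = t" by blast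
    have "\<gamma> t \<in> ball x0 (R/2) \<and> (\<Sum>i<m. (\<eta> t \<bullet> y i (\<gamma> t))\<^sup>2) = 1 \<and>
        (\<gamma> has_vector_derivative (\<Sum>i<m. (\<eta> t \<bullet> y i (\<gamma> t)) *\<^sub>R y i (\<gamma> t))) (at t within {-T..T}) \<and> S (\<gamma> t) = t"
      if t: "t \<in> {-T..T}" for t
    proof (intro conjI)
      have t0: "t \<in> {-T0..T0}" using t TT by auto
      have tT: "G * \<bar>t\<bar> \<le> G * T" using t G by (intro mult_left_mono) auto
      have "norm (\<gamma> t - q) < R / 4"
        using extremal_speed_le[OF g(2) t0 T0] tT TT g(1) by (simp add: G_def)
      then show "\<gamma> t \<in> ball x0 (R/2)"
        using q dist_triangle_less_add[of x0 q "R/4" "\<gamma> t" "R/4"] by (simp add: dist_norm norm_minus_commute)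
      show "(\<Sum>i<m. (\<eta> t \<bullet> y i (\<gamma> t))\<^sup>2) = 1"
        using g(2) t0 by (auto simp: extremal_def)
      have "(\<gamma> has_vector_derivative H\<^sub>\<xi> (\<gamma> t) (\<eta> t)) (at t within {-T0..T0})"
        using g(2) t0 by (auto simp: extremal_def)
      then show "(\<gamma> has_vector_derivative (\<Sum>i<m. (\<eta> t \<bullet> y i (\<gamma> t)) *\<^sub>R y i (\<gamma> t))) (at t within {-T..T})"
        unfolding H\<^sub>\<xi>_def by (rule has_vector_derivative_within_subset) (use TT in auto)
      have "\<Lambda> * (G * \<bar>t\<bar>) \<le> \<Lambda> * (G * T)" using mult_left_mono[OF tT, of \<Lambda>] \<Lambda> by simp
      then show "S (\<gamma> t) = t" using St t0 TT by (simp add: G_def)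
    qed
    moreover have "calibration R M S S'" using S R(3) unfolding calibration_def by auto
    ultimately show "\<exists>\<gamma> u S S'. \<gamma> 0 = q \<and>
       (\<forall>t\<in>{-T..T}. \<gamma> t \<in> ball x0 (R/2) \<and> (\<Sum>i<m. (u t i)\<^sup>2) = 1 \<and>
          (\<gamma> has_vector_derivative (\<Sum>i<m. u t i *\<^sub>R y i (\<gamma> t))) (at t within {-T..T}) \<and> S (\<gamma> t) = t) \<and>
       calibration R M S S'"
      using g(1)
      by (intro exI[of _ \<gamma>] exI[of _ "\<lambda>t i. \<eta> t \<bullet> y i (\<gamma> t)"] exI[of _ S] exI[of _ S']) auto
  qed (use R T in auto)
qed

end

section \<open>Orthonormal frames\<close>

lemma coords_zero [simp]: "coords 0 c = 0"
  and coords_add [simp]: "coords (v + w) c = coords v c + coords w c"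
  and coords_scaleR [simp]: "coords (r *\<^sub>R v) c = r *\<^sub>R coords v c"
  by (transfer, simp)+

lemma coords_sum [simp]: "coords (\<Sum>i\<in>I. f i) c = (\<Sum>i\<in>I. coords (f i) c)"
  by (induction I rule: infinite_finite_induct) auto

lemma coords_eqI: "(\<And>c. coords v c = coords w c) \<Longrightarrow> v = w"
  by (metis ext coords_inject)

lemma span_image_sum:
  fixes f :: "'i \<Rightarrow> 'v::real_vector"
  assumes "finite I" "v \<in> span (f ` I)"
  obtains a where "v = (\<Sum>i\<in>I. a i *\<^sub>R f i)"
proof -
  let ?S = "{w. \<exists>a. w = (\<Sum>i\<in>I. a i *\<^sub>R f i)}"
  have "subspace ?S"
    unfolding subspace_def
  proof (intro conjI ballI allI)
    show "0 \<in> ?S" by (intro CollectI exI[of _ "\<lambda>_. 0"]) simp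
  next
    fix x y assume "x \<in> ?S" "y \<in> ?S"
    then obtain a b where "x = (\<Sum>i\<in>I. a i *\<^sub>R f i)" "y = (\<Sum>i\<in>I. b i *\<^sub>R f i)" by blast
    then have "x + y = (\<Sum>i\<in>I. (a i + b i) *\<^sub>R f i)" by (simp add: scaleR_left_distrib sum.distrib)
    then show "x + y \<in> ?S" by (intro CollectI exI)
  next
    fix c :: real and x assume "x \<in> ?S"
    then obtain a where "x = (\<Sum>i\<in>I. a i *\<^sub>R f i)" by blast
    then have "c *\<^sub>R x = (\<Sum>i\<in>I. (c * a i) *\<^sub>R f i)" by (simp add: scaleR_sum_right)
    then show "c *\<^sub>R x \<in> ?S" by (intro CollectI exI)
  qed
  moreover have "f ` I \<subseteq> ?S"
  proof safe
    fix j assume j: "j \<in> I"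
    have "f j = (\<Sum>i\<in>I. (if i = j then 1 else 0) *\<^sub>R f i)"
      using assms(1) j by (simp add: if_distrib[of "\<lambda>r. r *\<^sub>R _"] cong: if_cong)
    then show "\<exists>a. f j = (\<Sum>i\<in>I. a i *\<^sub>R f i)" by (intro exI[of _ "\<lambda>i. if i = j then 1 else 0"])
  qed
  ultimately have "span (f ` I) \<subseteq> ?S" by (intro span_minimal)
  then show thesis using assms(2) that by blast
qed

lemma not_in_span_of_dim_eq:
  fixes f :: "nat \<Rightarrow> 'v::real_vector"
  assumes "dim (span (f ` {..<m})) = m" "k < m"
  shows "f k \<notin> span (f ` {..<k})"
proof
  assume k: "f k \<in> span (f ` {..<k})"
  let ?T = "f ` ({..<m} - {k})"
  have "f ` {..<k} \<subseteq> ?T" using assms(2) by auto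
  then have "f k \<in> span ?T" using k span_mono by blast
  then have "f ` {..<m} \<subseteq> span ?T"
    using span_base[of _ ?T] by (force simp: image_subset_iff)
  then have "span (f ` {..<m}) \<subseteq> span ?T" by (intro span_minimal) auto
  then have "dim (span (f ` {..<m})) \<le> card ?T"
    by (intro real_vector.dim_le_card) auto
  also have "\<dots> \<le> card ({..<m} - {k})" by (rule card_image_le) simp
  also have "\<dots> < m" using assms(2) by simp
  finally show False using assms(1) by simp
qed

lemma inner_product_onD:
  assumes "inner_product_on S b"
  shows "u \<in> S \<Longrightarrow> v \<in> S \<Longrightarrow> b u v = b v u"
    and "u \<in> S \<Longrightarrow> v \<in> S \<Longrightarrow> w \<in> S \<Longrightarrow> b (u + v) w = b u w + b v w"
    and "u \<in> S \<Longrightarrow> v \<in> S \<Longrightarrow> b (r *\<^sub>R u) v = r * b u v"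
    and "v \<in> S \<Longrightarrow> v \<noteq> 0 \<Longrightarrow> 0 < b v v"
  using assms by (simp_all add: inner_product_on_def)

lemma inner_product_on_sum_left:
  assumes "inner_product_on S b" "subspace S" "\<And>i. i \<in> I \<Longrightarrow> v i \<in> S" "w \<in> S"
  shows "b (\<Sum>i\<in>I. a i *\<^sub>R v i) w = (\<Sum>i\<in>I. a i * b (v i) w)"
proof -
  note add = inner_product_onD(2)[OF assms(1) _ _ assms(4)]
    and scale = inner_product_onD(3)[OF assms(1) _ assms(4)]
  have "b 0 w = 0" using scale[OF subspace_0[OF assms(2)], of 0] by simp
  then show ?thesis using assms(3)
  proof (induction I rule: infinite_finite_induct)
    case (insert j I)
    have "(\<Sum>i\<in>I. a i *\<^sub>R v i) \<in> S"
      using insert by (intro subspace_sum subspace_scale assms(2)) auto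
    moreover have "a j *\<^sub>R v j \<in> S" using insert by (intro subspace_scale assms(2)) auto
    ultimately show ?case using insert by (simp add: add scale)
  qed auto
qed

lemma inner_product_on_sum_right:
  assumes "inner_product_on S b" "subspace S" "\<And>i. i \<in> I \<Longrightarrow> v i \<in> S" "w \<in> S"
  shows "b w (\<Sum>i\<in>I. a i *\<^sub>R v i) = (\<Sum>i\<in>I. a i * b w (v i))"
proof -
  note sym = inner_product_onD(1)[OF assms(1)]
  have "(\<Sum>i\<in>I. a i *\<^sub>R v i) \<in> S"
    using assms by (intro subspace_sum subspace_scale) auto
  then have "b w (\<Sum>i\<in>I. a i *\<^sub>R v i) = b (\<Sum>i\<in>I. a i *\<^sub>R v i) w" by (rule sym[OF assms(4)])
  also have "\<dots> = (\<Sum>i\<in>I. a i * b (v i) w)" by (rule inner_product_on_sum_left[OF assms])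
  also have "\<dots> = (\<Sum>i\<in>I. a i * b w (v i))" by (intro sum.cong refl) (simp add: sym[OF assms(3,4)])
  finally show ?thesis .
qed

text \<open>A fixed sub-Riemannian manifold of class $C^{1,1}$.\<close>

locale sub_riemannian =
  fixes M :: "'a topology" and A :: "('a, 'e::euclidean_space) chart set" and m :: nat
    and \<Delta> :: "'a \<Rightarrow> ('a, 'e) tvec set" and g :: "'a \<Rightarrow> ('a, 'e) tvec \<Rightarrow> ('a, 'e) tvec \<Rightarrow> real"
  assumes sr: "C11_sub_riemannian_manifold M A m \<Delta> g"
begin

lemma Hausdorff: "Hausdorff_space M"
  and atlas: "smooth_atlas M A"
  using sr unfolding C11_sub_riemannian_manifold_def smooth_manifold_def by auto

lemma chart:
  assumes "c \<in> A"
  shows "openin M (fst c)" "open (snd c ` fst c)"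
    "homeomorphic_map (subtopology M (fst c)) (top_of_set (snd c ` fst c)) (snd c)"
  using atlas assms unfolding smooth_atlas_def by (auto simp: split_beta)

lemma chart_subset: "c \<in> A \<Longrightarrow> fst c \<subseteq> topspace M"
  using chart(1) openin_subset by blast

lemma topspace_chart: "c \<in> A \<Longrightarrow> topspace (subtopology M (fst c)) = fst c"
  using chart_subset by (simp add: inf_absorb2)

lemma chart_inj: "c \<in> A \<Longrightarrow> inj_on (snd c) (fst c)"
  using homeomorphic_imp_injective_map[OF chart(3)] topspace_chart by metis

lemma chart_inv_apply: "c \<in> A \<Longrightarrow> p \<in> fst c \<Longrightarrow> chart_inv c (snd c p) = p"
  unfolding chart_inv_def by (intro inv_into_f_f chart_inj)

lemma apply_chart_inv:
  assumes "x \<in> snd c ` fst c"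
  shows "snd c (chart_inv c x) = x" "chart_inv c x \<in> fst c"
  using assms unfolding chart_inv_def by (auto intro: f_inv_into_f inv_into_into)

lemma ex_chart: "p \<in> topspace M \<Longrightarrow> \<exists>c\<in>A. p \<in> fst c"
  using atlas unfolding smooth_atlas_def by blast

lemma open_chart_image:
  assumes "c \<in> A" "openin M W"
  shows "open (snd c ` (fst c \<inter> W))"
proof -
  have "openin (subtopology M (fst c)) (fst c \<inter> W)"
    using assms(2) by (auto simp: openin_subtopology)
  then have "openin (top_of_set (snd c ` fst c)) (snd c ` (fst c \<inter> W))"
    using homeomorphic_imp_open_map[OF chart(3)[OF assms(1)]] unfolding open_map_def by blast
  then show ?thesis using chart(2)[OF assms(1)] openin_open_trans by blast
qed

lemma continuous_map_chart_inv:
  assumes "c \<in> A"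
  shows "continuous_map (top_of_set (snd c ` fst c)) M (chart_inv c)"
proof -
  let ?X = "subtopology M (fst c)" and ?Y = "top_of_set (snd c ` fst c)"
  have "continuous_map ?Y ?X (chart_inv c)"
    unfolding continuous_map_alt
  proof (intro conjI allI impI)
    show "chart_inv c \<in> topspace ?Y \<rightarrow> topspace ?X"
      using chart_subset[OF assms] by (auto simp: chart_inv_apply[OF assms])
    fix U assume U: "openin ?X U"
    then have US: "U \<subseteq> fst c" using openin_subset topspace_chart[OF assms] by blast
    have "openin ?Y (snd c ` U)"
      using U homeomorphic_imp_open_map[OF chart(3)[OF assms]] unfolding open_map_def by blast
    moreover have "chart_inv c -` U \<inter> topspace ?Y = snd c ` U"
    proof (intro equalityI subsetI)
      fix x assume x: "x \<in> chart_inv c -` U \<inter> topspace ?Y"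
      then have "snd c (chart_inv c x) = x" by (intro apply_chart_inv) simp
      then show "x \<in> snd c ` U" using x by (metis IntD1 imageI vimageD)
    next
      fix x assume "x \<in> snd c ` U"
      then obtain z where "z \<in> U" "x = snd c z" by blast
      then show "x \<in> chart_inv c -` U \<inter> topspace ?Y"
        using US chart_inv_apply[OF assms, of z] by auto
    qed
    ultimately show "openin ?Y (chart_inv c -` U \<inter> topspace ?Y)" by simp
  qed
  then show ?thesis using continuous_map_in_subtopology by blast
qed

lemma continuous_map_chart:
  "c \<in> A \<Longrightarrow> continuous_map (subtopology M (fst c)) euclidean (snd c)"
  using homeomorphic_imp_continuous_map[OF chart(3)] continuous_map_in_subtopology by blast

lemma smooth_transition:
  assumes "c \<in> A" "c' \<in> A"
  shows "smooth_on (transition c c') (snd c ` (fst c \<inter> fst c'))"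
  using atlas assms unfolding smooth_atlas_def by blast

lemma transition_has_derivative:
  assumes "c \<in> A" "c' \<in> A" "p \<in> fst c" "p \<in> fst c'"
  shows "(transition c c' has_derivative frechet_derivative (transition c c') (at (snd c p))) (at (snd c p))"
proof -
  have "Ck_on (Suc 0) (transition c c') (snd c ` (fst c \<inter> fst c'))"
    using smooth_transition[OF assms(1,2)] unfolding smooth_on_def by blast
  then show ?thesis using assms(3,4) by (auto simp: frechet_derivative_works)
qed

lemma tangent_space_transform:
  assumes "v \<in> tangent_space A p" "c \<in> A" "c' \<in> A" "p \<in> fst c" "p \<in> fst c'"
  shows "coords v c' = frechet_derivative (transition c c') (at (snd c p)) (coords v c)"
  using assms unfolding tangent_space_def by blast

lemma tangent_space_outside:
  "v \<in> tangent_space A p \<Longrightarrow> \<not> (c \<in> A \<and> p \<in> fst c) \<Longrightarrow> coords v c = 0"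
  unfolding tangent_space_def by blast

text \<open>A tangent vector is determined by its coordinates in a single chart.\<close>

lemma tangent_vector_zero:
  assumes c: "c \<in> A" "p \<in> fst c" and v: "v \<in> tangent_space A p" "coords v c = 0"
  shows "v = 0"
proof (rule coords_eqI)
  fix c'
  show "coords v c' = coords 0 c'"
  proof (cases "c' \<in> A \<and> p \<in> fst c'")
    case True
    then have "coords v c' = frechet_derivative (transition c c') (at (snd c p)) 0"
      using tangent_space_transform[OF v(1) c(1) _ c(2)] v(2) by simp
    also have "\<dots> = 0"
      by (rule linear_0[OF has_derivative_linear[OF transition_has_derivative]]) (use c True in auto)
    finally show ?thesis by simp
  next
    case False
    then show ?thesis using tangent_space_outside[OF v(1)] by simp
  qed
qed

lemma distribution:
  assumes "p \<in> topspace M"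
  shows "\<Delta> p \<subseteq> tangent_space A p" "subspace (\<Delta> p)" "dim (\<Delta> p) = m" "inner_product_on (\<Delta> p) (g p)"
  using sr assms unfolding C11_sub_riemannian_manifold_def C11_distribution_def C11_metric_def by auto

text \<open>Sections of \<open>\<Delta>\<close> of class $C^{1,1}$ over \<open>W\<close>.\<close>

definition C11_section :: "'a set \<Rightarrow> ('a \<Rightarrow> ('a, 'e) tvec) \<Rightarrow> bool" where
  "C11_section W X \<longleftrightarrow> C11_vector_field A W X \<and> (\<forall>p\<in>W. X p \<in> \<Delta> p)"

lemma C11_sectionI:
  assumes "openin M W" "\<And>p. p \<in> W \<Longrightarrow> X p \<in> \<Delta> p"
    and "\<And>c. c \<in> A \<Longrightarrow> C11_on (\<lambda>x. coords (X (chart_inv c x)) c) (snd c ` (fst c \<inter> W))"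
  shows "C11_section W X"
  using assms distribution(1) openin_subset[OF assms(1)]
  unfolding C11_section_def C11_vector_field_def by blast

lemma C11_section_coords:
  "C11_section W X \<Longrightarrow> c \<in> A \<Longrightarrow> C11_on (\<lambda>x. coords (X (chart_inv c x)) c) (snd c ` (fst c \<inter> W))"
  unfolding C11_section_def C11_vector_field_def by blast

lemma C11_section_mem: "C11_section W X \<Longrightarrow> p \<in> W \<Longrightarrow> X p \<in> \<Delta> p"
  unfolding C11_section_def by blast

lemma C11_section_add:
  assumes W: "openin M W" and X: "C11_section W X" and Y: "C11_section W Y"
  shows "C11_section W (\<lambda>p. X p + Y p)"
proof (rule C11_sectionI[OF W])
  show "X p + Y p \<in> \<Delta> p" if "p \<in> W" for p
    using that openin_subset[OF W] by (intro subspace_add distribution C11_section_mem[OF X] C11_section_mem[OF Y]) auto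
  show "C11_on (\<lambda>x. coords (X (chart_inv c x) + Y (chart_inv c x)) c) (snd c ` (fst c \<inter> W))" if "c \<in> A" for c
    using that by (auto intro!: C11_on_add C11_section_coords X Y)
qed

lemma C11_section_scaleR:
  assumes W: "openin M W" and X: "C11_section W X" and f: "C11_function A W f"
  shows "C11_section W (\<lambda>p. f p *\<^sub>R X p)"
proof (rule C11_sectionI[OF W])
  show "f p *\<^sub>R X p \<in> \<Delta> p" if "p \<in> W" for p
    using that openin_subset[OF W] by (intro subspace_scale distribution C11_section_mem[OF X]) auto
  show "C11_on (\<lambda>x. coords (f (chart_inv c x) *\<^sub>R X (chart_inv c x)) c) (snd c ` (fst c \<inter> W))" if c: "c \<in> A" for c
  proof -
    have "C11_on (\<lambda>x. f (chart_inv c x)) (snd c ` (fst c \<inter> W))" using f c by (simp add: C11_function_def)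
    from C11_on_bilinear[OF bounded_bilinear_scaleR this C11_section_coords[OF X c] open_chart_image[OF c W]]
    show ?thesis by simp
  qed
qed

lemma C11_function_metric:
  assumes W: "openin M W" and X: "C11_section W X" and Y: "C11_section W Y"
  shows "C11_function A W (\<lambda>p. g p (X p) (Y p))"
  using sr assms unfolding C11_sub_riemannian_manifold_def C11_metric_def C11_section_def by blast

lemma C11_function_minus:
  assumes W: "openin M W" and f: "C11_function A W f"
  shows "C11_function A W (\<lambda>p. - f p)"
  unfolding C11_function_def
proof
  fix c assume c: "c \<in> A"
  let ?S = "snd c ` (fst c \<inter> W)"
  have f': "C11_on (\<lambda>x. f (chart_inv c x)) ?S" using f c by (simp add: C11_function_def)
  have "C11_on (\<lambda>x::'e. - 1 :: real) ?S"
    by (rule C11_onI[where f'="\<lambda>x h. 0"]) (auto simp: locally_lipschitz_on_iff_bounded_lipschitz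
        intro!: bounded_lipschitz_on_const exI[of _ 1])
  from C11_on_bilinear[OF bounded_bilinear_mult this f' open_chart_image[OF c W]]
  show "C11_on (\<lambda>x. - f (chart_inv c x)) ?S" by simp
qed

lemma C11_section_add_sum:
  fixes k :: nat
  assumes W: "openin M W" and X: "C11_section W X"
    and Y: "\<And>j. j < k \<Longrightarrow> C11_section W (Y j)" and f: "\<And>j. j < k \<Longrightarrow> C11_function A W (f j)"
  shows "C11_section W (\<lambda>p. X p + (\<Sum>j<k. f j p *\<^sub>R Y j p))"
  using Y f
proof (induction k)
  case 0
  then show ?case using X by simp
next
  case (Suc k)
  have "C11_section W (\<lambda>p. (X p + (\<Sum>j<k. f j p *\<^sub>R Y j p)) + f k p *\<^sub>R Y k p)"
    by (rule C11_section_add[OF W Suc.IH C11_section_scaleR[OF W]]) (use Suc.prems in auto)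
  then show ?case by (simp add: add.assoc)
qed

text \<open>Gram-Schmidt orthonormalisation stays within class $C^{1,1}$, because the coefficients are
  obtained from values of the metric on sections by products and inverse square roots.\<close>

lemma orthonormal_sections:
  assumes W: "openin M W" and X: "\<And>i. i < m \<Longrightarrow> C11_section W (X i)"
    and span: "\<And>q. q \<in> W \<Longrightarrow> \<Delta> q = span ((\<lambda>i. X i q) ` {..<m})"
    and k: "k \<le> m"
  shows "\<exists>Y. (\<forall>i<k. C11_section W (Y i)) \<and>
     (\<forall>q\<in>W. span ((\<lambda>i. Y i q) ` {..<k}) = span ((\<lambda>i. X i q) ` {..<k})) \<and>
     (\<forall>q\<in>W. \<forall>i<k. \<forall>j<k. g q (Y i q) (Y j q) = (if i = j then 1 else 0))"
  using k
proof (induction k)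
  case 0
  then show ?case by simp
next
  case (Suc k)
  then obtain Y where Ys: "\<And>i. i < k \<Longrightarrow> C11_section W (Y i)"
    and Yspan: "\<And>q. q \<in> W \<Longrightarrow> span ((\<lambda>i. Y i q) ` {..<k}) = span ((\<lambda>i. X i q) ` {..<k})"
    and Yon: "\<And>q i j. q \<in> W \<Longrightarrow> i < k \<Longrightarrow> j < k \<Longrightarrow> g q (Y i q) (Y j q) = (if i = j then 1 else 0)"
    using Suc_leD[OF Suc.prems] by blast
  have km: "k < m" using Suc by simp
  \<comment> \<open>the component of \<open>X k\<close> orthogonal to the sections found so far\<close>
  define Z where "Z = (\<lambda>q. X k q + (\<Sum>j<k. (- g q (X k q) (Y j q)) *\<^sub>R Y j q))"
  have Zs: "C11_section W Z"
    unfolding Z_def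
    by (intro C11_section_add_sum C11_function_minus C11_function_metric W X Ys km)
  define a where "a = (\<lambda>q. g q (Z q) (Z q) powr (-1/2))"
  have top: "q \<in> topspace M" if "q \<in> W" for q using openin_subset[OF W] that by blast
  note ip = distribution(4)[OF top] and ss = distribution(2)[OF top]
  have Xk: "X k q \<in> \<Delta> q" if "q \<in> W" for q using C11_section_mem[OF X[OF km] that] .
  have Ym: "Y j q \<in> \<Delta> q" if "q \<in> W" "j < k" for q j using C11_section_mem[OF Ys[OF that(2)] that(1)] .
  have Zm: "Z q \<in> \<Delta> q" if "q \<in> W" for q using C11_section_mem[OF Zs that] .
  have ZY: "g q (Z q) (Y j q) = 0" if q: "q \<in> W" and j: "j < k" for q j
  proof -
    have Sm: "(\<Sum>j<k. (- g q (X k q) (Y j q)) *\<^sub>R Y j q) \<in> \<Delta> q"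
      using q by (intro subspace_sum subspace_scale ss Ym) auto
    have "g q (Z q) (Y j q) = g q (X k q) (Y j q) + g q (\<Sum>j<k. (- g q (X k q) (Y j q)) *\<^sub>R Y j q) (Y j q)"
      unfolding Z_def by (rule inner_product_onD(2)[OF ip[OF q] Xk[OF q] Sm Ym[OF q j]])
    also have "g q (\<Sum>j<k. (- g q (X k q) (Y j q)) *\<^sub>R Y j q) (Y j q) =
        (\<Sum>i<k. (- g q (X k q) (Y i q)) * g q (Y i q) (Y j q))"
      by (rule inner_product_on_sum_left[OF ip[OF q] ss[OF q]]) (use Ym q j in auto)
    also have "\<dots> = (\<Sum>i<k. (if i = j then - g q (X k q) (Y i q) else 0))"
      using Yon[OF q _ j] by (intro sum.cong) auto
    also have "\<dots> = - g q (X k q) (Y j q)" using j by simp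
    finally show ?thesis by simp
  qed
  have Ssp: "(\<Sum>j<k. c j *\<^sub>R Y j q) \<in> span ((\<lambda>i. X i q) ` {..<k})" if q: "q \<in> W" for q c
    unfolding Yspan[OF q, symmetric] by (intro span_sum span_scale span_base) auto
  have Z0: "Z q \<noteq> 0" if q: "q \<in> W" for q
  proof
    assume "Z q = 0"
    then have "X k q = - (\<Sum>j<k. (- g q (X k q) (Y j q)) *\<^sub>R Y j q)"
      unfolding Z_def by (simp add: add_eq_0_iff2)
    also have "\<dots> \<in> span ((\<lambda>i. X i q) ` {..<k})" by (intro span_neg Ssp q)
    finally have "X k q \<in> span ((\<lambda>i. X i q) ` {..<k})" .
    then show False
      using not_in_span_of_dim_eq[of "\<lambda>i. X i q" m k] km distribution(3)[OF top[OF q]] span[OF q] by simp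
  qed
  have gZ: "g q (Z q) (Z q) > 0" if q: "q \<in> W" for q
    by (rule inner_product_onD(4)[OF ip[OF q] Zm[OF q] Z0[OF q]])
  have aC: "C11_function A W a"
    unfolding C11_function_def
  proof
    fix c assume c: "c \<in> A"
    have "C11_on (\<lambda>x. g (chart_inv c x) (Z (chart_inv c x)) (Z (chart_inv c x))) (snd c ` (fst c \<inter> W))"
      using C11_function_metric[OF W Zs Zs] c by (simp add: C11_function_def)
    then show "C11_on (\<lambda>x. a (chart_inv c x)) (snd c ` (fst c \<inter> W))"
      unfolding a_def
      by (rule C11_on_inverse_sqrt[OF _ open_chart_image[OF c W]]) (auto simp: chart_inv_apply[OF c] intro!: gZ)
  qed
  have a0: "a q > 0" if q: "q \<in> W" for q using gZ[OF q] by (simp add: a_def)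
  have a2: "a q * (a q * g q (Z q) (Z q)) = 1" if q: "q \<in> W" for q
  proof -
    have "a q * a q = g q (Z q) (Z q) powr (-1)"
      unfolding a_def by (simp add: powr_add[symmetric])
    then show ?thesis using gZ[OF q] by (simp add: powr_minus powr_one mult.assoc[symmetric])
  qed
  define Y' where "Y' = (\<lambda>i. if i = k then (\<lambda>q. a q *\<^sub>R Z q) else Y i)"
  have Y's: "C11_section W (Y' i)" if "i < Suc k" for i
    using that Ys C11_section_scaleR[OF W Zs aC] by (auto simp: Y'_def less_Suc_eq)
  have Y'k: "(\<lambda>i. Y' i q) ` {..<Suc k} = insert (a q *\<^sub>R Z q) ((\<lambda>i. Y i q) ` {..<k})" for q
    by (auto simp: Y'_def lessThan_Suc)
  have Xk': "(\<lambda>i. X i q) ` {..<Suc k} = insert (X k q) ((\<lambda>i. X i q) ` {..<k})" for q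
    by (auto simp: lessThan_Suc)
  have Y'span: "span ((\<lambda>i. Y' i q) ` {..<Suc k}) = span ((\<lambda>i. X i q) ` {..<Suc k})" if q: "q \<in> W" for q
  proof (rule span_eq[THEN iffD2, OF conjI])
    let ?SY = "span (insert (a q *\<^sub>R Z q) ((\<lambda>i. Y i q) ` {..<k}))"
    let ?SX = "span (insert (X k q) ((\<lambda>i. X i q) ` {..<k}))"
    have sub: "span ((\<lambda>i. Y i q) ` {..<k}) \<subseteq> ?SX" unfolding Yspan[OF q] by (rule span_mono) auto
    have "Z q \<in> ?SX"
      unfolding Z_def
    proof (rule span_add)
      show "X k q \<in> ?SX" by (rule span_base) simp
      show "(\<Sum>j<k. (- g q (X k q) (Y j q)) *\<^sub>R Y j q) \<in> ?SX"
        by (rule subsetD[OF sub[unfolded Yspan[OF q]] Ssp[OF q]])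
    qed
    then have "a q *\<^sub>R Z q \<in> ?SX" by (rule span_scale)
    moreover have "(\<lambda>i. Y i q) ` {..<k} \<subseteq> ?SX" by (rule order_trans[OF span_superset sub])
    ultimately show "(\<lambda>i. Y' i q) ` {..<Suc k} \<subseteq> span ((\<lambda>i. X i q) ` {..<Suc k})"
      unfolding Y'k Xk' by simp
    have sub2: "span ((\<lambda>i. X i q) ` {..<k}) \<subseteq> ?SY" unfolding Yspan[OF q, symmetric] by (rule span_mono) auto
    have "Z q = (1 / a q) *\<^sub>R (a q *\<^sub>R Z q)" using a0[OF q] by simp
    also have "\<dots> \<in> ?SY" by (intro span_scale span_base) simp
    finally have "Z q - (\<Sum>j<k. (- g q (X k q) (Y j q)) *\<^sub>R Y j q) \<in> ?SY"
      by (rule span_diff[OF _ subsetD[OF sub2 Ssp[OF q]]])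
    then have "X k q \<in> ?SY" by (simp add: Z_def)
    moreover have "(\<lambda>i. X i q) ` {..<k} \<subseteq> ?SY" by (rule order_trans[OF span_superset sub2])
    ultimately show "(\<lambda>i. X i q) ` {..<Suc k} \<subseteq> span ((\<lambda>i. Y' i q) ` {..<Suc k})"
      unfolding Y'k Xk' by simp
  qed
  have Y'on: "g q (Y' i q) (Y' j q) = (if i = j then 1 else 0)" if q: "q \<in> W" and ij: "i < Suc k" "j < Suc k" for q i j
  proof -
    note sym = inner_product_onD(1)[OF ip[OF q]] and sc = inner_product_onD(3)[OF ip[OF q]]
    have aZ: "a q *\<^sub>R Z q \<in> \<Delta> q" by (intro subspace_scale ss Zm q)
    have aZY: "g q (a q *\<^sub>R Z q) (Y l q) = 0" if "l < k" for l
      using sc[OF Zm[OF q] Ym[OF q that]] ZY[OF q that] by simp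
    have aZa: "g q (a q *\<^sub>R Z q) (a q *\<^sub>R Z q) = 1"
      unfolding sc[OF Zm[OF q] aZ] sym[OF Zm[OF q] aZ] sc[OF Zm[OF q] Zm[OF q]] by (rule a2[OF q])
    show ?thesis
      using ij Yon[OF q, of i j] aZY[of i] aZY[of j] aZa sym[OF aZ Ym[OF q], of i] sym[OF aZ Ym[OF q], of j]
      by (cases "i = k"; cases "j = k") (simp_all add: Y'_def less_Suc_eq)
  qed
  show ?case
    by (intro exI[of _ Y'] conjI ballI allI impI Y's Y'span Y'on)
qed

text \<open>An orthonormal frame of \<open>\<Delta>\<close> of class $C^{1,1}$ over the open set \<open>W\<close>. Only the first \<open>m\<close> members of
  the family \<open>Y\<close> matter.\<close>

definition orthonormal_frame :: "'a set \<Rightarrow> (nat \<Rightarrow> 'a \<Rightarrow> ('a, 'e) tvec) \<Rightarrow> bool" where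
  "orthonormal_frame W Y \<longleftrightarrow> openin M W \<and> (\<forall>i<m. C11_section W (Y i)) \<and>
     (\<forall>q\<in>W. \<Delta> q = span ((\<lambda>i. Y i q) ` {..<m})) \<and>
     (\<forall>q\<in>W. \<forall>i<m. \<forall>j<m. g q (Y i q) (Y j q) = (if i = j then 1 else 0))"

lemma ex_orthonormal_frame:
  assumes "p \<in> topspace M"
  obtains W Y where "p \<in> W" "orthonormal_frame W Y"
proof -
  obtain W X where W: "openin M W" "p \<in> W" and X: "\<And>i. i < m \<Longrightarrow> C11_vector_field A W (X i)"
    and span: "\<And>q. q \<in> W \<Longrightarrow> \<Delta> q = span ((\<lambda>i. X i q) ` {..<m})"
    using sr assms unfolding C11_sub_riemannian_manifold_def C11_distribution_def by metis
  have Xs: "C11_section W (X i)" if "i < m" for i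
    unfolding C11_section_def using X[OF that] span that by (auto intro: span_base)
  obtain Y where "\<forall>i<m. C11_section W (Y i)"
     "\<forall>q\<in>W. span ((\<lambda>i. Y i q) ` {..<m}) = span ((\<lambda>i. X i q) ` {..<m})"
     "\<forall>q\<in>W. \<forall>i<m. \<forall>j<m. g q (Y i q) (Y j q) = (if i = j then 1 else 0)"
    using orthonormal_sections[OF W(1) Xs span order_refl] by blast
  then show thesis using that W span unfolding orthonormal_frame_def by metis
qed

lemma orthonormal_frame_norm:
  assumes Y: "orthonormal_frame W Y" and q: "q \<in> W" and v: "v = (\<Sum>i<m. a i *\<^sub>R Y i q)"
  shows "g q v v = (\<Sum>i<m. (a i)\<^sup>2)"
proof -
  have q': "q \<in> topspace M" using Y q openin_subset by (auto simp: orthonormal_frame_def)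
  have Ym: "Y i q \<in> \<Delta> q" if "i < m" for i
    using Y q that by (auto simp: orthonormal_frame_def intro: C11_section_mem)
  have vm: "v \<in> \<Delta> q"
    unfolding v by (intro subspace_sum subspace_scale distribution[OF q'] Ym) auto
  have "g q v v = (\<Sum>i<m. a i * g q (Y i q) v)"
    using inner_product_on_sum_left[OF distribution(4,2)[OF q'], of "{..<m}" "\<lambda>i. Y i q" v a] Ym vm
    unfolding v by auto
  also have "\<dots> = (\<Sum>i<m. a i * a i)"
  proof (rule sum.cong[OF refl])
    fix i assume i: "i \<in> {..<m}"
    have "g q (Y i q) v = (\<Sum>j<m. a j * g q (Y i q) (Y j q))"
      unfolding v by (rule inner_product_on_sum_right[OF distribution(4,2)[OF q']]) (use i Ym in auto)
    also have "\<dots> = (\<Sum>j<m. if i = j then a j else 0)"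
      using Y q i by (intro sum.cong) (auto simp: orthonormal_frame_def)
    also have "\<dots> = a i" using i by simp
    finally show "a i * g q (Y i q) v = a i * a i" by simp
  qed
  finally show ?thesis by (simp add: power2_eq_square)
qed

lemma orthonormal_frame_expansion:
  assumes Y: "orthonormal_frame W Y" and q: "q \<in> W" and v: "v \<in> \<Delta> q"
  obtains a where "v = (\<Sum>i<m. a i *\<^sub>R Y i q)" "g q v v = (\<Sum>i<m. (a i)\<^sup>2)"
proof -
  have "v \<in> span ((\<lambda>i. Y i q) ` {..<m})" using Y q v by (auto simp: orthonormal_frame_def)
  then obtain a where a: "v = (\<Sum>i<m. a i *\<^sub>R Y i q)"
    using span_image_sum[OF finite_lessThan] by metis
  moreover have "g q v v = (\<Sum>i<m. (a i)\<^sup>2)"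
  by (rule orthonormal_frame_norm[OF Y q a])
  ultimately show thesis by (rule that)
qed

end

section \<open>Admissible curves and the distance\<close>

context sub_riemannian
begin

lemma has_velocity_unique:
  assumes "has_velocity A {a..b} \<gamma> v t" "has_velocity A {a..b} \<gamma> w t" "t \<in> {a..b}" "a < b"
  shows "v = w"
proof (rule coords_eqI)
  fix c
  show "coords v c = coords w c"
  proof (cases "c \<in> A \<and> \<gamma> t \<in> fst c")
    case True
    then have "((snd c \<circ> \<gamma>) has_vector_derivative coords v c) (at t within {a..b})"
      "((snd c \<circ> \<gamma>) has_vector_derivative coords w c) (at t within {a..b})"
      using assms(1,2) unfolding has_velocity_def by auto
    then show ?thesis
      using vector_derivative_unique_within_closed_interval[of a b t "snd c \<circ> \<gamma>" "coords v c" "coords w c"] assms(3,4)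
      by simp
  next
    case False
    then show ?thesis
      using assms(1,2) tangent_space_outside unfolding has_velocity_def by metis
  qed
qed

text \<open>The integrand of the length functional.\<close>

definition speed :: "real \<Rightarrow> real \<Rightarrow> (real \<Rightarrow> 'a) \<Rightarrow> real \<Rightarrow> ennreal" where
  "speed a b \<gamma> t = ennreal (sqrt (g (\<gamma> t) (velocity A {a..b} \<gamma> t) (velocity A {a..b} \<gamma> t)))"

lemma curve_length_eq: "curve_length A g a b \<gamma> = (\<integral>\<^sup>+t\<in>{a..b}. speed a b \<gamma> t \<partial>lebesgue)"
  by (simp add: curve_length_def speed_def)

lemma velocity_eq:
  assumes "has_velocity A {a..b} \<gamma> v t" "t \<in> {a..b}" "a < b"
  shows "velocity A {a..b} \<gamma> t = v"
  unfolding velocity_def by (rule the_equality[where P="\<lambda>v. has_velocity A {a..b} \<gamma> v t", OF assms(1)])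
    (rule has_velocity_unique[OF _ assms])

text \<open>Velocities are local: they only depend on the germ of the curve and of the parameter set.\<close>

lemma has_velocity_localize:
  assumes S: "open S" "t \<in> S" "t \<in> I" and IJ: "I \<inter> S = J \<inter> S" and eq: "\<And>s. s \<in> I \<inter> S \<Longrightarrow> \<gamma> s = \<gamma>' s"
    and v: "has_velocity A I \<gamma> v t"
  shows "has_velocity A J \<gamma>' v t"
proof -
  have t: "\<gamma> t = \<gamma>' t" using S eq by blast
  have at: "at t within (I \<inter> S) = at t within J"
    by (rule at_within_nhd[OF S(2,1)]) (use IJ in blast)
  have "((snd c \<circ> \<gamma>') has_vector_derivative coords v c) (at t within J)" if c: "c \<in> A" "\<gamma>' t \<in> fst c" for c
  proof -
    have "((snd c \<circ> \<gamma>) has_vector_derivative coords v c) (at t within I)"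
      using v c t unfolding has_velocity_def by auto
    then have "((snd c \<circ> \<gamma>) has_vector_derivative coords v c) (at t within (I \<inter> S))"
      by (rule has_vector_derivative_within_subset) auto
    then have "((snd c \<circ> \<gamma>') has_vector_derivative coords v c) (at t within (I \<inter> S))"
      by (rule has_vector_derivative_transform[rotated 2]) (use S eq in auto)
    then show ?thesis unfolding at .
  qed
  then show ?thesis using v t unfolding has_velocity_def by simp
qed

lemma velocity_localize:
  assumes S: "open S" "t \<in> S" "t \<in> I" and IJ: "I \<inter> S = J \<inter> S" and eq: "\<And>s. s \<in> I \<inter> S \<Longrightarrow> \<gamma> s = \<gamma>' s"
  shows "has_velocity A I \<gamma> v t \<longleftrightarrow> has_velocity A J \<gamma>' v t" "velocity A I \<gamma> t = velocity A J \<gamma>' t"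
proof -
  have t: "t \<in> J" using S IJ by blast
  have eq': "\<gamma>' s = \<gamma> s" if "s \<in> J \<inter> S" for s using eq[of s] that IJ by auto
  show *: "has_velocity A I \<gamma> v t \<longleftrightarrow> has_velocity A J \<gamma>' v t" for v
    by (rule iffI[OF has_velocity_localize[where \<gamma>=\<gamma> and \<gamma>'=\<gamma>', OF S IJ eq]
        has_velocity_localize[where \<gamma>=\<gamma>' and \<gamma>'=\<gamma>, OF S(1,2) t IJ[symmetric] eq']])
  show "velocity A I \<gamma> t = velocity A J \<gamma>' t" unfolding velocity_def * ..
qed

lemma has_velocity_affine:
  assumes v: "has_velocity A {a..b} \<gamma> v (k + s * t)" and sv: "s *\<^sub>R v \<in> tangent_space A (\<gamma> (k + s * t))"
    and sub: "(\<lambda>t. k + s * t) ` {a'..b'} \<subseteq> {a..b}"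
  shows "has_velocity A {a'..b'} (\<lambda>t. \<gamma> (k + s * t)) (s *\<^sub>R v) t"
proof -
  have "((snd c \<circ> (\<lambda>t. \<gamma> (k + s * t))) has_vector_derivative coords (s *\<^sub>R v) c) (at t within {a'..b'})"
    if c: "c \<in> A" "\<gamma> (k + s * t) \<in> fst c" for c
  proof -
    have "((snd c \<circ> \<gamma>) has_vector_derivative coords v c) (at (k + s * t) within {a..b})"
      using v c unfolding has_velocity_def by auto
    then have "((snd c \<circ> \<gamma>) has_vector_derivative coords v c) (at (k + s * t) within (\<lambda>t. k + s * t) ` {a'..b'})"
      by (rule has_vector_derivative_within_subset[OF _ sub])
    moreover have "((\<lambda>t. k + s * t) has_vector_derivative s) (at t within {a'..b'})"
      by (auto intro!: derivative_eq_intros)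
    ultimately show ?thesis
      using vector_diff_chain_within[of "\<lambda>t. k + s * t" s t "{a'..b'}" "snd c \<circ> \<gamma>" "coords v c"] by (simp add: o_def)
  qed
  then show ?thesis using sv unfolding has_velocity_def by simp
qed

lemma admissible_curve_in:
  assumes "admissible_curve M A \<Delta> a b \<gamma>" "t \<in> {a..b}"
  shows "\<gamma> t \<in> topspace M"
  using assms continuous_map_image_subset_topspace[of "top_of_set {a..b}" M \<gamma>]
  unfolding admissible_curve_def abs_continuous_curve_def by auto

lemma abs_continuous_curveD:
  assumes "abs_continuous_curve M A a b \<gamma>" "c \<in> A" "a \<le> s" "s \<le> t" "t \<le> b"
    and "\<And>r. r \<in> {s..t} \<Longrightarrow> \<gamma> r \<in> fst c"
  shows "abs_continuous_on_interval s t (snd c \<circ> \<gamma>)"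
proof -
  have "\<gamma> ` {s..t} \<subseteq> fst c" using assms(6) by (rule image_subsetI)
  then show ?thesis using assms(1-5) unfolding abs_continuous_curve_def by blast
qed

text \<open>The affine parameter changes of slope \<open>1\<close> and \<open>-1\<close> suffice for reversing a curve and for matching
  the parameter intervals of two curves.\<close>

lemma admissible_curve_affine:
  assumes adm: "admissible_curve M A \<Delta> a b \<gamma>" and s: "s = 1 \<or> s = -1" and ab': "a' < b'"
    and L: "\<And>t. t \<in> {a'..b'} \<longleftrightarrow> k + s * t \<in> {a..b}"
  shows "admissible_curve M A \<Delta> a' b' (\<lambda>t. \<gamma> (k + s * t))"
    and "curve_length A g a' b' (\<lambda>t. \<gamma> (k + s * t)) \<le> curve_length A g a b \<gamma>"
proof -
  have s1: "\<bar>s\<bar> = 1" using s by auto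
  have ab: "a < b" and ac: "abs_continuous_curve M A a b \<gamma>"
    and ae: "AE t in lebesgue. t \<in> {a..b} \<longrightarrow> (\<exists>v\<in>\<Delta> (\<gamma> t). has_velocity A {a..b} \<gamma> v t)"
    using adm unfolding admissible_curve_def by auto
  have sub: "(\<lambda>t. k + s * t) ` {a'..b'} \<subseteq> {a..b}" using L by blast
  have ae': "AE t in lebesgue. k + s * t \<in> {a..b} \<longrightarrow>
      (\<exists>v\<in>\<Delta> (\<gamma> (k + s * t)). has_velocity A {a..b} \<gamma> v (k + s * t))"
    by (rule AE_lebesgue_affine[OF s1 ae])
  have vel: "s *\<^sub>R v \<in> \<Delta> (\<gamma> (k + s * t))" "has_velocity A {a'..b'} (\<lambda>t. \<gamma> (k + s * t)) (s *\<^sub>R v) t"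
    if t: "k + s * t \<in> {a..b}" and v: "v \<in> \<Delta> (\<gamma> (k + s * t))" "has_velocity A {a..b} \<gamma> v (k + s * t)" for t v
  proof -
    have top: "\<gamma> (k + s * t) \<in> topspace M" by (rule admissible_curve_in[OF adm t])
    show sv: "s *\<^sub>R v \<in> \<Delta> (\<gamma> (k + s * t))" by (intro subspace_scale distribution[OF top] v)
    show "has_velocity A {a'..b'} (\<lambda>t. \<gamma> (k + s * t)) (s *\<^sub>R v) t"
      by (rule has_velocity_affine[OF v(2) _ sub]) (use sv distribution(1)[OF top] in blast)
  qed
  show "admissible_curve M A \<Delta> a' b' (\<lambda>t. \<gamma> (k + s * t))"
    unfolding admissible_curve_def abs_continuous_curve_def
  proof (intro conjI ab' ballI allI impI)
    have "continuous_map (top_of_set {a'..b'}) (top_of_set {a..b}) (\<lambda>t. k + s * t)"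
      using sub by (auto simp: continuous_map_in_subtopology intro!: continuous_intros)
    then have "continuous_map (top_of_set {a'..b'}) M (\<gamma> \<circ> (\<lambda>t. k + s * t))"
      by (rule continuous_map_compose) (use ac in \<open>simp add: abs_continuous_curve_def\<close>)
    then show "continuous_map (top_of_set {a'..b'}) M (\<lambda>t. \<gamma> (k + s * t))" by (simp add: o_def)
  next
    fix c u w assume c: "c \<in> A" and uw: "a' \<le> u \<and> u \<le> w \<and> w \<le> b' \<and> (\<lambda>t. \<gamma> (k + s * t)) ` {u..w} \<subseteq> fst c"
    have in': "k + s * u \<in> {a..b}" "k + s * w \<in> {a..b}" using L[of u, THEN iffD1] L[of w, THEN iffD1] uw by auto
    from s show "abs_continuous_on_interval u w (snd c \<circ> (\<lambda>t. \<gamma> (k + s * t)))"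
    proof
      assume s: "s = 1"
      have "\<gamma> r \<in> fst c" if "r \<in> {k + u..k + w}" for r
      proof -
        have "r - k \<in> {u..w}" using that by auto
        then have "\<gamma> (k + s * (r - k)) \<in> fst c" using uw by blast
        then show ?thesis by (simp add: s)
      qed
      then have "abs_continuous_on_interval (k + u) (k + w) (snd c \<circ> \<gamma>)"
        using uw in' s by (intro abs_continuous_curveD[OF ac c]) auto
      then show ?thesis using abs_continuous_compose_shift[of k u w "snd c \<circ> \<gamma>"] s by (simp add: o_def)
    next
      assume s: "s = -1"
      have "\<gamma> r \<in> fst c" if "r \<in> {k - w..k - u}" for r
      proof -
        have "k - r \<in> {u..w}" using that by auto
        then have "\<gamma> (k + s * (k - r)) \<in> fst c" using uw by blast
        then show ?thesis by (simp add: s)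
      qed
      then have "abs_continuous_on_interval (k - w) (k - u) (snd c \<circ> \<gamma>)"
        using uw in' s by (intro abs_continuous_curveD[OF ac c]) auto
      then show ?thesis using abs_continuous_compose_reflect[of k w u "snd c \<circ> \<gamma>"] s by (simp add: o_def)
    qed
  next
    from ae' show "AE t in lebesgue. t \<in> {a'..b'} \<longrightarrow>
       (\<exists>v\<in>\<Delta> (\<gamma> (k + s * t)). has_velocity A {a'..b'} (\<lambda>t. \<gamma> (k + s * t)) v t)"
    proof eventually_elim
      case (elim t)
      then show ?case unfolding L using vel by blast
    qed
  qed
  let ?F = "\<lambda>t. speed a b \<gamma> t * indicator {a..b} t"
  let ?\<gamma>' = "\<lambda>t. \<gamma> (k + s * t)"
  have "curve_length A g a' b' ?\<gamma>' \<le> (\<integral>\<^sup>+t. ?F (k + s * t) \<partial>lebesgue)"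
    unfolding curve_length_eq
  proof (rule nn_integral_mono_AE)
    from ae' show "AE t in lebesgue. speed a' b' ?\<gamma>' t *
      indicator {a'..b'} t \<le> ?F (k + s * t)"
    proof eventually_elim
      case (elim t)
      show ?case
      proof (cases "t \<in> {a'..b'}")
        case True
        then have t: "k + s * t \<in> {a..b}" using L by blast
        then obtain v where v: "v \<in> \<Delta> (\<gamma> (k + s * t))" "has_velocity A {a..b} \<gamma> v (k + s * t)" using elim by blast
        have v1: "velocity A {a..b} \<gamma> (k + s * t) = v" by (rule velocity_eq[OF v(2) t ab])
        have v2: "velocity A {a'..b'} ?\<gamma>' t = s *\<^sub>R v" by (rule velocity_eq[OF vel(2)[OF t v] True ab'])
        have ip: "inner_product_on (\<Delta> (\<gamma> (k + s * t))) (g (\<gamma> (k + s * t)))"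
          by (rule distribution(4)[OF admissible_curve_in[OF adm t]])
        have "g (?\<gamma>' t) (s *\<^sub>R v) (s *\<^sub>R v) = s * (s * g (?\<gamma>' t) v v)"
          using inner_product_onD(1,3)[OF ip] v(1) vel(1)[OF t v] by metis
        also have "\<dots> = g (?\<gamma>' t) v v" using s by auto
        finally show ?thesis using True t by (simp add: speed_def v1 v2)
      qed simp
    qed
  qed
  also have "\<dots> \<le> (\<integral>\<^sup>+t. ?F t \<partial>lebesgue)" by (rule nn_integral_affine_le[OF s1])
  also have "\<dots> = curve_length A g a b \<gamma>" by (simp add: curve_length_eq)
  finally show "curve_length A g a' b' ?\<gamma>' \<le> curve_length A g a b \<gamma>" .
qed

lemma admissible_curve_join:
  assumes adm1: "admissible_curve M A \<Delta> a b \<gamma>1" and adm2: "admissible_curve M A \<Delta> b c \<gamma>2" and eq: "\<gamma>1 b = \<gamma>2 b"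
  defines "\<gamma> \<equiv> (\<lambda>t. if t \<le> b then \<gamma>1 t else \<gamma>2 t)"
  shows "admissible_curve M A \<Delta> a c \<gamma>"
    and "curve_length A g a c \<gamma> \<le> curve_length A g a b \<gamma>1 + curve_length A g b c \<gamma>2"
proof -
  have ab: "a < b" and ac1: "abs_continuous_curve M A a b \<gamma>1"
    and ae1: "AE t in lebesgue. t \<in> {a..b} \<longrightarrow> (\<exists>v\<in>\<Delta> (\<gamma>1 t). has_velocity A {a..b} \<gamma>1 v t)"
    using adm1 unfolding admissible_curve_def by auto
  have bc: "b < c" and ac2: "abs_continuous_curve M A b c \<gamma>2"
    and ae2: "AE t in lebesgue. t \<in> {b..c} \<longrightarrow> (\<exists>v\<in>\<Delta> (\<gamma>2 t). has_velocity A {b..c} \<gamma>2 v t)"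
    using adm2 unfolding admissible_curve_def by auto
  have g1: "\<gamma> t = \<gamma>1 t" if "t \<le> b" for t using that by (simp add: \<gamma>_def)
  have g2: "\<gamma> t = \<gamma>2 t" if "b \<le> t" for t using that eq by (auto simp: \<gamma>_def)
  have loc1: "has_velocity A {a..b} \<gamma>1 v t \<longleftrightarrow> has_velocity A {a..c} \<gamma> v t"
    "velocity A {a..b} \<gamma>1 t = velocity A {a..c} \<gamma> t" if "a \<le> t" "t < b" for t v
    by (rule velocity_localize[of "{..<b}"]; use that bc in \<open>auto simp: g1\<close>)+
  have loc2: "has_velocity A {b..c} \<gamma>2 v t \<longleftrightarrow> has_velocity A {a..c} \<gamma> v t"
    "velocity A {b..c} \<gamma>2 t = velocity A {a..c} \<gamma> t" if "b < t" "t \<le> c" for t v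
    by (rule velocity_localize[of "{b<..}"]; use that ab in \<open>auto simp: g2\<close>)+
  have neb: "AE t in lebesgue. t \<noteq> b"
    by (rule AE_I'[of "{b}"]) (auto simp: negligible_iff_null_sets[symmetric])
  show "admissible_curve M A \<Delta> a c \<gamma>"
    unfolding admissible_curve_def abs_continuous_curve_def
  proof (intro conjI ballI allI impI)
    show "a < c" using ab bc by simp
    show "continuous_map (top_of_set {a..c}) M \<gamma>"
      unfolding \<gamma>_def
    proof (rule continuous_map_cases_le)
      have "{x \<in> topspace (top_of_set {a..c}). x \<le> b} = {a..b}" "{x \<in> topspace (top_of_set {a..c}). b \<le> x} = {b..c}"
        using ab bc by auto
      moreover have "subtopology (top_of_set {a..c}) {a..b} = top_of_set {a..b}" "subtopology (top_of_set {a..c}) {b..c} = top_of_set {b..c}"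
        using ab bc by (auto simp: subtopology_subtopology Int_absorb1)
      ultimately show "continuous_map (subtopology (top_of_set {a..c}) {x \<in> topspace (top_of_set {a..c}). x \<le> b}) M \<gamma>1"
        "continuous_map (subtopology (top_of_set {a..c}) {x \<in> topspace (top_of_set {a..c}). b \<le> x}) M \<gamma>2"
        using ac1 ac2 unfolding abs_continuous_curve_def by auto
    qed (use eq in auto)
  next
    fix d u w assume d: "d \<in> A" and uw: "a \<le> u \<and> u \<le> w \<and> w \<le> c \<and> \<gamma> ` {u..w} \<subseteq> fst d"
    have A1: "abs_continuous_on_interval u' w' (snd d \<circ> \<gamma>)" if "u \<le> u'" "u' \<le> w'" "w' \<le> w" "w' \<le> b" for u' w'
    proof (rule abs_continuous_cong)
      show "abs_continuous_on_interval u' w' (snd d \<circ> \<gamma>1)"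
      proof (rule abs_continuous_curveD[OF ac1 d])
        fix r assume r: "r \<in> {u'..w'}"
        then have "\<gamma> r \<in> fst d" using that uw by (auto simp: image_subset_iff)
        then show "\<gamma>1 r \<in> fst d" using r that g1[of r] by simp
      qed (use that uw in auto)
    qed (use that in \<open>auto simp: g1\<close>)
    have A2: "abs_continuous_on_interval u' w' (snd d \<circ> \<gamma>)" if "u \<le> u'" "u' \<le> w'" "w' \<le> w" "b \<le> u'" for u' w'
    proof (rule abs_continuous_cong)
      show "abs_continuous_on_interval u' w' (snd d \<circ> \<gamma>2)"
      proof (rule abs_continuous_curveD[OF ac2 d])
        fix r assume r: "r \<in> {u'..w'}"
        then have "\<gamma> r \<in> fst d" using that uw by (auto simp: image_subset_iff)
        then show "\<gamma>2 r \<in> fst d" using r that g2[of r] by simp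
      qed (use that uw in auto)
    qed (use that in \<open>auto simp: g2\<close>)
    consider "w \<le> b" | "b \<le> u" | "u \<le> b" "b \<le> w" by linarith
    then show "abs_continuous_on_interval u w (snd d \<circ> \<gamma>)"
    proof cases
      case 1 then show ?thesis using A1[of u w] uw by simp
    next
      case 2 then show ?thesis using A2[of u w] uw by simp
    next
      case 3 then show ?thesis using abs_continuous_join[OF A1[of u b] A2[of b w]] by simp
    qed
  next
    from ae1 ae2 neb show "AE t in lebesgue. t \<in> {a..c} \<longrightarrow> (\<exists>v\<in>\<Delta> (\<gamma> t). has_velocity A {a..c} \<gamma> v t)"
    proof eventually_elim
      case (elim t)
      show ?case
      proof
        assume t: "t \<in> {a..c}"
        show "\<exists>v\<in>\<Delta> (\<gamma> t). has_velocity A {a..c} \<gamma> v t"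
        proof (cases "t < b")
          case True
          then show ?thesis using elim(1) t loc1(1)[of t] g1[of t] by auto
        next
          case False
          then have "b < t" using elim(3) by simp
          then show ?thesis using elim(2) t loc2(1)[of t] g2[of t] by auto
        qed
      qed
    qed
  qed
  let ?F = "\<lambda>t. speed a c \<gamma> t * indicator {a..c} t"
  have "curve_length A g a c \<gamma> = (\<integral>\<^sup>+t. ?F t \<partial>lebesgue)" by (simp add: curve_length_eq)
  also have "\<dots> \<le> (\<integral>\<^sup>+t. ?F t * indicator {..b} t \<partial>lebesgue) + (\<integral>\<^sup>+t. ?F t * indicator (- {..b}) t \<partial>lebesgue)"
    by (rule nn_integral_split_le) simp
  also have "\<dots> \<le> curve_length A g a b \<gamma>1 + curve_length A g b c \<gamma>2"
    unfolding curve_length_eq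
  proof (intro add_mono nn_integral_mono_AE)
    from neb show "AE t in lebesgue. ?F t * indicator {..b} t \<le>
      speed a b \<gamma>1 t * indicator {a..b} t"
    proof eventually_elim
      case (elim t)
      then show ?case using loc1(2)[of t] g1[of t] by (cases "a \<le> t \<and> t < b") (auto simp: indicator_def speed_def)
    qed
    show "AE t in lebesgue. ?F t * indicator (- {..b}) t \<le>
      speed b c \<gamma>2 t * indicator {b..c} t"
    proof (rule AE_I2)
      fix t
      show "?F t * indicator (- {..b}) t \<le>
        speed b c \<gamma>2 t * indicator {b..c} t"
        using loc2(2)[of t] g2[of t] by (cases "b < t \<and> t \<le> c") (auto simp: indicator_def speed_def)
    qed
  qed
  finally show "curve_length A g a c \<gamma> \<le> curve_length A g a b \<gamma>1 + curve_length A g b c \<gamma>2" .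
qed

lemma cc_dist_lessE:
  assumes "cc_dist M A \<Delta> g x y < r"
  obtains a b \<gamma> where "admissible_curve M A \<Delta> a b \<gamma>" "\<gamma> a = x" "\<gamma> b = y" "curve_length A g a b \<gamma> < r"
  using assms unfolding cc_dist_def Inf_less_iff by blast

lemma cc_dist_le_length:
  "admissible_curve M A \<Delta> a b \<gamma> \<Longrightarrow> cc_dist M A \<Delta> g (\<gamma> a) (\<gamma> b) \<le> curve_length A g a b \<gamma>"
  unfolding cc_dist_def by (rule Inf_lower) blast

lemma cc_dist_commute_le: "cc_dist M A \<Delta> g y x \<le> cc_dist M A \<Delta> g x y"
  unfolding cc_dist_def[of M A \<Delta> g x y]
proof (rule Inf_greatest, safe)
  fix a b \<gamma> assume adm: "admissible_curve M A \<Delta> a b \<gamma>"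
  have ab: "a < b" using adm by (simp add: admissible_curve_def)
  have L: "t \<in> {a..b} \<longleftrightarrow> (a + b) + (-1) * t \<in> {a..b}" for t by auto
  note rev = admissible_curve_affine[OF adm _ ab L, simplified]
  show "cc_dist M A \<Delta> g (\<gamma> b) (\<gamma> a) \<le> curve_length A g a b \<gamma>"
    using order_trans[OF cc_dist_le_length[OF rev(1)] rev(2)] by simp
qed

lemma cc_dist_le_add:
  assumes "cc_dist M A \<Delta> g x y < r1" "cc_dist M A \<Delta> g y z < r2"
  shows "cc_dist M A \<Delta> g x z \<le> r1 + r2"
proof -
  obtain a b \<gamma>1 where 1: "admissible_curve M A \<Delta> a b \<gamma>1" "\<gamma>1 a = x" "\<gamma>1 b = y" "curve_length A g a b \<gamma>1 < r1"
    using cc_dist_lessE[OF assms(1)] by blast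
  obtain a' b' \<gamma>2 where 2: "admissible_curve M A \<Delta> a' b' \<gamma>2" "\<gamma>2 a' = y" "\<gamma>2 b' = z" "curve_length A g a' b' \<gamma>2 < r2"
    using cc_dist_lessE[OF assms(2)] by blast
  have ab: "a < b" "a' < b'" using 1(1) 2(1) by (auto simp: admissible_curve_def)
  define c where "c = b + (b' - a')"
  define \<gamma>3 where "\<gamma>3 = (\<lambda>t. \<gamma>2 ((a' - b) + 1 * t))"
  have bc: "b < c" using ab by (simp add: c_def)
  have L: "t \<in> {b..c} \<longleftrightarrow> (a' - b) + 1 * t \<in> {a'..b'}" for t by (auto simp: c_def)
  have 3: "admissible_curve M A \<Delta> b c \<gamma>3" "curve_length A g b c \<gamma>3 \<le> curve_length A g a' b' \<gamma>2"
    unfolding \<gamma>3_def by (rule admissible_curve_affine[OF 2(1) _ bc L], simp)+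
  have e: "\<gamma>1 b = \<gamma>3 b" using 1(3) 2(2) by (simp add: \<gamma>3_def)
  note j = admissible_curve_join[OF 1(1) 3(1) e]
  have "cc_dist M A \<Delta> g x z \<le> curve_length A g a c (\<lambda>t. if t \<le> b then \<gamma>1 t else \<gamma>3 t)"
    using cc_dist_le_length[OF j(1)] ab bc 1(2) 2(3) by (simp add: \<gamma>3_def c_def)
  also have "\<dots> \<le> curve_length A g a b \<gamma>1 + curve_length A g b c \<gamma>3" by (rule j(2))
  also have "\<dots> \<le> r1 + r2" using 1(4) 2(4) 3(2) by (intro add_mono) auto
  finally show ?thesis .
qed

lemma cc_diameter_ball_le:
  assumes "r > 0"
  shows "cc_diameter M A \<Delta> g (cc_ball M A \<Delta> g q r) \<le> ennreal (2 * r)"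
  unfolding cc_diameter_def
proof (rule SUP_least, safe)
  fix x y assume "x \<in> cc_ball M A \<Delta> g q r" "y \<in> cc_ball M A \<Delta> g q r"
  then have "cc_dist M A \<Delta> g x q < ennreal r" "cc_dist M A \<Delta> g q y < ennreal r"
    using order_le_less_trans[OF cc_dist_commute_le] by (auto simp: cc_ball_def)
  then have "cc_dist M A \<Delta> g x y \<le> ennreal r + ennreal r" by (rule cc_dist_le_add)
  then show "cc_dist M A \<Delta> g x y \<le> ennreal (2 * r)"
    using assms by (simp add: ennreal_plus[symmetric] del: ennreal_plus)
qed

end

section \<open>Admissible curves in a chart\<close>

text \<open>A chart \<open>c\<close> around the point with coordinates \<open>x0\<close>, together with an orthonormal frame over \<open>W\<close> whose
  coordinate expressions satisfy the bounds of \<^locale>\<open>frame_bounds\<close> on a ball in the image of \<open>fst c \<inter> W\<close>.\<close>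

locale adapted_chart = sub_riemannian M A m \<Delta> g +
  frame_bounds "\<lambda>i x. coords (Y i (chart_inv c x)) c"
    "\<lambda>i x. frechet_derivative (\<lambda>x. coords (Y i (chart_inv c x)) c) (at x)" m x0 \<rho> B
  for M :: "'a topology" and A :: "('a, 'e::euclidean_space) chart set" and m \<Delta> g
    and c :: "('a, 'e) chart" and W :: "'a set" and Y :: "nat \<Rightarrow> 'a \<Rightarrow> ('a, 'e) tvec"
    and x0 :: 'e and \<rho> B :: real +
  assumes cA: "c \<in> A" and frame: "orthonormal_frame W Y" and cball_sub: "cball x0 \<rho> \<subseteq> snd c ` (fst c \<inter> W)"
    and m_pos: "m > 0"
begin

abbreviation y :: "nat \<Rightarrow> 'e \<Rightarrow> 'e" where "y i x \<equiv> coords (Y i (chart_inv c x)) c"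

lemma chart_inv_cball:
  assumes "x \<in> cball x0 \<rho>"
  shows "chart_inv c x \<in> fst c" "chart_inv c x \<in> W" "snd c (chart_inv c x) = x"
proof -
  obtain p where "p \<in> fst c" "p \<in> W" "x = snd c p" using assms cball_sub by blast
  then show "chart_inv c x \<in> fst c" "chart_inv c x \<in> W" "snd c (chart_inv c x) = x"
    using chart_inv_apply[OF cA] by auto
qed

lemma mem_W: "p \<in> fst c \<Longrightarrow> snd c p \<in> cball x0 \<rho> \<Longrightarrow> p \<in> W"
  using chart_inv_cball(2)[of "snd c p"] chart_inv_apply[OF cA] by simp

text \<open>The open subset of the manifold that corresponds to a coordinate ball around \<open>x0\<close>.\<close>

definition chart_ball :: "real \<Rightarrow> 'a set" where
  "chart_ball r = {p \<in> fst c. snd c p \<in> ball x0 r}"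

lemma openin_chart_ball: "openin M (chart_ball r)"
proof -
  have "openin (subtopology M (fst c)) {p \<in> topspace (subtopology M (fst c)). snd c p \<in> ball x0 r}"
    by (rule openin_continuous_map_preimage[OF continuous_map_chart[OF cA]]) simp
  then show ?thesis
    unfolding chart_ball_def topspace_chart[OF cA] by (rule openin_trans_full[OF _ chart(1)[OF cA]])
qed

lemma closedin_chart_cball:
  assumes "r \<le> \<rho>"
  shows "closedin M {p \<in> fst c. snd c p \<in> cball x0 r}"
proof -
  have sub: "cball x0 r \<subseteq> cball x0 \<rho>" using assms by auto
  have "{p \<in> fst c. snd c p \<in> cball x0 r} = chart_inv c ` cball x0 r"
  proof (intro equalityI subsetI)
    fix p assume p: "p \<in> {p \<in> fst c. snd c p \<in> cball x0 r}"
    then have "p = chart_inv c (snd c p)" using chart_inv_apply[OF cA] by simp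
    then show "p \<in> chart_inv c ` cball x0 r" using p by blast
  next
    fix p assume "p \<in> chart_inv c ` cball x0 r"
    then obtain x where x: "x \<in> cball x0 r" "p = chart_inv c x" by blast
    then show "p \<in> {p \<in> fst c. snd c p \<in> cball x0 r}"
      using chart_inv_cball[OF subsetD[OF sub x(1)]] by simp
  qed
  moreover have "compactin M (chart_inv c ` cball x0 r)"
  proof (rule image_compactin[OF _ continuous_map_chart_inv[OF cA]])
    show "compactin (top_of_set (snd c ` fst c)) (cball x0 r)"
      using sub cball_sub by (auto simp: compactin_subtopology)
  qed
  ultimately show ?thesis using compactin_imp_closedin[OF Hausdorff] by simp
qed

text \<open>A function whose differential is bounded by one on unit horizontal vectors grows along an
  admissible curve by at most the length of the curve.\<close>

lemma calibration_le_length: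
  assumes adm: "admissible_curve M A \<Delta> a b \<sigma>" and \<tau>: "a \<le> \<tau>" "\<tau> \<le> b" and R: "R \<le> \<rho>"
    and inside: "\<And>t. t \<in> {a..\<tau>} \<Longrightarrow> \<sigma> t \<in> chart_ball R"
    and cal: "calibration R L S S'"
  shows "ennreal (S (snd c (\<sigma> \<tau>)) - S (snd c (\<sigma> a))) \<le> curve_length A g a b \<sigma>"
proof -
  have dS: "(S has_derivative S' x) (at x)" and S'L: "\<bar>S' x h\<bar> \<le> L * norm h"
    and S'1: "S' x (\<Sum>i<m. v i *\<^sub>R y i x) \<le> sqrt (\<Sum>i<m. (v i)\<^sup>2)" if "x \<in> ball x0 R" for x h v
    using cal that unfolding calibration_def by blast+
  have ab: "a < b" and ac: "abs_continuous_curve M A a b \<sigma>"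
    and ae: "AE t in lebesgue. t \<in> {a..b} \<longrightarrow> (\<exists>v\<in>\<Delta> (\<sigma> t). has_velocity A {a..b} \<sigma> v t)"
    using adm unfolding admissible_curve_def by auto
  have in1: "\<sigma> t \<in> fst c" and in2: "snd c (\<sigma> t) \<in> ball x0 R" if "t \<in> {a..\<tau>}" for t
    using inside[OF that] by (auto simp: chart_ball_def)
  have acs: "abs_continuous_on_interval a \<tau> (snd c \<circ> \<sigma>)"
    by (rule abs_continuous_curveD[OF ac cA]) (use \<tau> in1 in auto)
  have lip: "(max L 0)-lipschitz_on ((snd c \<circ> \<sigma>) ` {a..\<tau>}) S"
  proof (rule lipschitz_onI)
    fix x x' assume x: "x \<in> (snd c \<circ> \<sigma>) ` {a..\<tau>}" "x' \<in> (snd c \<circ> \<sigma>) ` {a..\<tau>}"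
    have "norm (S x - S x') \<le> max L 0 * norm (x - x')"
    proof (rule differentiable_bound[of "ball x0 R" S S'])
      fix z assume z: "z \<in> ball x0 R"
      show "(S has_derivative S' z) (at z within ball x0 R)"
        by (rule has_derivative_at_withinI[OF dS[OF z]])
      show "onorm (S' z) \<le> max L 0"
      proof (rule onorm_bound)
        fix h :: 'e
        have "L * norm h \<le> max L 0 * norm h" by (rule mult_right_mono) auto
        then show "norm (S' z h) \<le> max L 0 * norm h" using S'L[OF z, of h] by simp
      qed simp
    qed (use x in2 in auto)
    then show "dist (S x) (S x') \<le> max L 0 * dist x x'" by (simp add: dist_norm)
  qed simp
  have acf: "abs_continuous_on_interval a \<tau> (\<lambda>t. S ((snd c \<circ> \<sigma>) t))"
    by (rule abs_continuous_compose_lipschitz[OF acs lip])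
  let ?h = "speed a b \<sigma>"
  have "ennreal (S ((snd c \<circ> \<sigma>) \<tau>) - S ((snd c \<circ> \<sigma>) a)) \<le> (\<integral>\<^sup>+t\<in>{a..\<tau>}. ?h t \<partial>lebesgue)"
  proof (rule absolutely_continuous_increment_le_nn_integral[OF acf \<tau>(1)])
    from ae show "AE t in lebesgue. t \<in> {a..\<tau>} \<longrightarrow>
       (\<exists>D. ((\<lambda>t. S ((snd c \<circ> \<sigma>) t)) has_vector_derivative D) (at t within {a..\<tau>}) \<and> ennreal D \<le> ?h t)"
    proof eventually_elim
      case (elim t)
      show ?case
      proof
        assume t: "t \<in> {a..\<tau>}"
        then have tab: "t \<in> {a..b}" using \<tau> by auto
        then obtain v where v: "v \<in> \<Delta> (\<sigma> t)" "has_velocity A {a..b} \<sigma> v t" using elim by blast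
        let ?x = "snd c (\<sigma> t)"
        have vel: "velocity A {a..b} \<sigma> t = v" by (rule velocity_eq[OF v(2) tab ab])
        have "((snd c \<circ> \<sigma>) has_vector_derivative coords v c) (at t within {a..b})"
          using v(2) cA in1[OF t] unfolding has_velocity_def by blast
        then have "((snd c \<circ> \<sigma>) has_vector_derivative coords v c) (at t within {a..\<tau>})"
          by (rule has_vector_derivative_within_subset) (use \<tau> in auto)
        then have 1: "((snd c \<circ> \<sigma>) has_derivative (\<lambda>h. h *\<^sub>R coords v c)) (at t within {a..\<tau>})"
          by (simp add: has_vector_derivative_def)
        have 2: "(S has_derivative S' ?x) (at ((snd c \<circ> \<sigma>) t))" using dS[OF in2[OF t]] by simp
        have lin: "linear (S' ?x)" using dS[OF in2[OF t]] by (rule has_derivative_linear)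
        have D: "((\<lambda>t. S ((snd c \<circ> \<sigma>) t)) has_vector_derivative S' ?x (coords v c)) (at t within {a..\<tau>})"
          unfolding has_vector_derivative_def
          by (rule has_derivative_eq_rhs[OF has_derivative_compose[OF 1 2]]) (simp add: fun_eq_iff linear_scale[OF lin])
        have xC: "?x \<in> cball x0 \<rho>" using in2[OF t] R by auto
        obtain w where w: "v = (\<Sum>i<m. w i *\<^sub>R Y i (\<sigma> t))" "g (\<sigma> t) v v = (\<Sum>i<m. (w i)\<^sup>2)"
          using orthonormal_frame_expansion[OF frame mem_W[OF in1[OF t] xC] v(1)] by blast
        have "coords v c = (\<Sum>i<m. w i *\<^sub>R y i ?x)"
          unfolding w(1) by (simp add: chart_inv_apply[OF cA in1[OF t]])
        then have "S' ?x (coords v c) \<le> sqrt (g (\<sigma> t) v v)"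
          using S'1[OF in2[OF t], of w] w(2) by simp
        then have "ennreal (S' ?x (coords v c)) \<le> ?h t" unfolding speed_def vel by (rule ennreal_leI)
        with D show "\<exists>D. ((\<lambda>t. S ((snd c \<circ> \<sigma>) t)) has_vector_derivative D) (at t within {a..\<tau>}) \<and> ennreal D \<le> ?h t"
          by blast
      qed
    qed
  qed
  also have "\<dots> \<le> curve_length A g a b \<sigma>"
    unfolding curve_length_eq using \<tau> by (intro nn_integral_mono) (auto simp: indicator_def)
  finally show ?thesis by simp
qed

lemma displacement_le_length:
  assumes adm: "admissible_curve M A \<Delta> a b \<sigma>" and \<tau>: "a \<le> \<tau>" "\<tau> \<le> b" and R: "R \<le> \<rho>"
    and inside: "\<And>t. t \<in> {a..\<tau>} \<Longrightarrow> \<sigma> t \<in> chart_ball R"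
    and len: "curve_length A g a b \<sigma> \<le> ennreal l" and l: "l \<ge> 0"
  shows "norm (snd c (\<sigma> \<tau>) - snd c (\<sigma> a)) \<le> real m * B * l"
proof -
  define C where "C = real m * B"
  have C: "C > 0" using m_pos B by (simp add: C_def)
  \<comment> \<open>a linear function in the direction of the displacement, scaled to be a calibration\<close>
  define d where "d = sgn (snd c (\<sigma> \<tau>) - snd c (\<sigma> a))"
  have d: "norm d \<le> 1" by (simp add: d_def norm_sgn)
  have "calibration R (1 / C) (\<lambda>x. d \<bullet> x / C) (\<lambda>x h. d \<bullet> h / C)"
    unfolding calibration_def
  proof (intro ballI conjI allI)
    fix x assume x: "x \<in> ball x0 R"
    then have xC: "x \<in> cball x0 \<rho>" using R by auto
    show "((\<lambda>x. d \<bullet> x / C) has_derivative (\<lambda>h. d \<bullet> h / C)) (at x)"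
      using C by (auto intro!: derivative_eq_intros)
    show "\<bar>d \<bullet> h / C\<bar> \<le> 1 / C * norm h" for h
    proof -
      have "\<bar>d \<bullet> h\<bar> \<le> 1 * norm h"
        by (rule order_trans[OF Cauchy_Schwarz_ineq2 mult_right_mono[OF d]]) simp
      then show ?thesis using C by (simp add: divide_right_mono)
    qed
    show "d \<bullet> (\<Sum>i<m. v i *\<^sub>R y i x) / C \<le> sqrt (\<Sum>i<m. (v i)\<^sup>2)" for v
    proof -
      have "\<bar>v i * (d \<bullet> y i x)\<bar> \<le> sqrt (\<Sum>i<m. (v i)\<^sup>2) * B" if i: "i < m" for i
      proof -
        have "(v i)\<^sup>2 \<le> (\<Sum>i<m. (v i)\<^sup>2)" by (rule member_le_sum) (use i in auto)
        then have "\<bar>v i\<bar> \<le> sqrt (\<Sum>i<m. (v i)\<^sup>2)" by (metis real_sqrt_abs real_sqrt_le_mono)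
        moreover have "\<bar>d \<bullet> y i x\<bar> \<le> 1 * B"
          by (rule order_trans[OF Cauchy_Schwarz_ineq2 mult_mono[OF d y_le[OF i xC]]]) auto
        ultimately show ?thesis unfolding abs_mult by (intro mult_mono) (auto simp: sum_nonneg)
      qed
      then have "\<bar>\<Sum>i<m. v i * (d \<bullet> y i x)\<bar> \<le> real m * (sqrt (\<Sum>i<m. (v i)\<^sup>2) * B)"
        using sum_norm_bound[of "{..<m}" "\<lambda>i. v i * (d \<bullet> y i x)" "sqrt (\<Sum>i<m. (v i)\<^sup>2) * B"] by simp
      then have "d \<bullet> (\<Sum>i<m. v i *\<^sub>R y i x) \<le> sqrt (\<Sum>i<m. (v i)\<^sup>2) * C"
        by (simp add: inner_sum_right C_def mult_ac)
      then show ?thesis using C by (simp add: pos_divide_le_eq)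
    qed
  qed
  from calibration_le_length[OF adm \<tau> R inside this]
  have "ennreal (d \<bullet> snd c (\<sigma> \<tau>) / C - d \<bullet> snd c (\<sigma> a) / C) \<le> ennreal l" using len by (rule order_trans)
  then have "d \<bullet> snd c (\<sigma> \<tau>) / C - d \<bullet> snd c (\<sigma> a) / C \<le> l" using l by (simp add: ennreal_le_iff)
  then have "d \<bullet> (snd c (\<sigma> \<tau>) - snd c (\<sigma> a)) \<le> C * l"
    using C by (simp add: inner_diff_right diff_divide_distrib[symmetric] pos_divide_le_eq mult.commute)
  moreover have "d \<bullet> (snd c (\<sigma> \<tau>) - snd c (\<sigma> a)) = norm (snd c (\<sigma> \<tau>) - snd c (\<sigma> a))"
    by (cases "snd c (\<sigma> \<tau>) - snd c (\<sigma> a) = 0")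
      (simp_all add: d_def sgn_div_norm power2_norm_eq_inner[symmetric] power2_eq_square)
  ultimately show ?thesis by (simp add: C_def)
qed

text \<open>A short admissible curve cannot leave the chart: up to the first exit time its displacement
  is controlled by its length.\<close>

lemma short_curve_stays:
  assumes adm: "admissible_curve M A \<Delta> a b \<sigma>" and R: "R > 0" "R \<le> \<rho>"
    and start: "\<sigma> a \<in> chart_ball (R/2)"
    and len: "curve_length A g a b \<sigma> \<le> ennreal l" and l: "l \<ge> 0" and small: "real m * B * l \<le> R / 4"
    and t: "t \<in> {a..b}"
  shows "\<sigma> t \<in> chart_ball R"
proof (rule ccontr)
  assume out: "\<sigma> t \<notin> chart_ball R"
  have cont: "continuous_map (top_of_set {a..b}) M \<sigma>"
    using adm unfolding admissible_curve_def abs_continuous_curve_def by blast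
  \<comment> \<open>the times spent outside; \<open>Inf E\<close> is the first exit time\<close>
  define E where "E = {s \<in> {a..b}. \<sigma> s \<notin> chart_ball R}"
  have "E = {a..b} - {s \<in> topspace (top_of_set {a..b}). \<sigma> s \<in> chart_ball R}" by (auto simp: E_def)
  moreover have "openin (top_of_set {a..b}) {s \<in> topspace (top_of_set {a..b}). \<sigma> s \<in> chart_ball R}"
    by (rule openin_continuous_map_preimage[OF cont openin_chart_ball])
  ultimately have "closedin (top_of_set {a..b}) E"
    by (metis closedin_diff closedin_subtopology_refl closedin_topspace openin_closedin_eq topspace_euclidean_subtopology)
  then have clE: "closed E" using closedin_closed_trans closed_atLeastAtMost by blast
  have Et: "t \<in> E" using t out by (simp add: E_def)
  have bdd: "bdd_below E" by (rule bdd_belowI[of _ a]) (simp add: E_def)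
  define \<tau> where "\<tau> = Inf E"
  have \<tau>E: "\<tau> \<in> E" unfolding \<tau>_def by (rule closed_contains_Inf[OF _ bdd clE]) (use Et in auto)
  then have \<tau>ab: "\<tau> \<in> {a..b}" "\<sigma> \<tau> \<notin> chart_ball R" by (auto simp: E_def)
  have before: "\<sigma> s \<in> chart_ball R" if "a \<le> s" "s < \<tau>" for s
  proof (rule ccontr)
    assume "\<sigma> s \<notin> chart_ball R"
    then have "s \<in> E" using that \<tau>ab by (simp add: E_def)
    then have "\<tau> \<le> s" unfolding \<tau>_def by (rule cInf_lower[OF _ bdd])
    then show False using that by simp
  qed
  have aR: "\<sigma> a \<in> chart_ball R" using start R by (auto simp: chart_ball_def)
  then have a\<tau>: "a < \<tau>" using \<tau>ab by (cases "a = \<tau>") auto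
  let ?K = "{p \<in> fst c. snd c p \<in> cball x0 (3 * R / 4)}"
  have inK: "\<sigma> s \<in> ?K" if s: "a \<le> s" "s < \<tau>" for s
  proof -
    have "norm (snd c (\<sigma> s) - snd c (\<sigma> a)) \<le> real m * B * l"
      by (rule displacement_le_length[OF adm s(1) _ R(2) before len l]) (use s \<tau>ab in auto)
    then have "dist (snd c (\<sigma> a)) (snd c (\<sigma> s)) \<le> R / 4" using small by (simp add: dist_norm norm_minus_commute)
    moreover have "dist x0 (snd c (\<sigma> a)) < R / 2" using start by (simp add: chart_ball_def)
    ultimately have "dist x0 (snd c (\<sigma> s)) \<le> 3 * R / 4"
      using dist_triangle[of x0 "snd c (\<sigma> s)" "snd c (\<sigma> a)"] by linarith
    then show ?thesis using before[OF s] by (simp add: chart_ball_def)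
  qed
  have "closedin (top_of_set {a..b}) {s \<in> topspace (top_of_set {a..b}). \<sigma> s \<in> ?K}"
    by (rule closedin_continuous_map_preimage[OF cont closedin_chart_cball]) (use R in auto)
  then have "closed {s \<in> topspace (top_of_set {a..b}). \<sigma> s \<in> ?K}" using closedin_closed_trans closed_atLeastAtMost by blast
  moreover have "{a..<\<tau>} \<subseteq> {s \<in> topspace (top_of_set {a..b}). \<sigma> s \<in> ?K}" using inK \<tau>ab by auto
  ultimately have "closure {a..<\<tau>} \<subseteq> {s \<in> topspace (top_of_set {a..b}). \<sigma> s \<in> ?K}" by (rule closure_minimal[rotated])
  moreover have "\<tau> \<in> closure {a..<\<tau>}" using a\<tau> by (simp add: closure_atLeastLessThan)
  ultimately have "\<sigma> \<tau> \<in> ?K" by blast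
  then have "\<sigma> \<tau> \<in> chart_ball R" using R by (auto simp: chart_ball_def)
  then show False using \<tau>ab by simp
qed

text \<open>A horizontal curve in coordinates with unit controls is an admissible curve in the manifold, and its
  length is the length of the parameter interval. Absolute continuity has to be checked in every chart
  of the atlas, where it follows from boundedness of the differential of the transition map along the
  curve.\<close>

lemma chart_curve_admissible:
  assumes ab: "a < b" and zC: "\<And>t. t \<in> {a..b} \<Longrightarrow> z t \<in> cball x0 \<rho>"
    and dz: "\<And>t. t \<in> {a..b} \<Longrightarrow> (z has_vector_derivative (\<Sum>i<m. u t i *\<^sub>R y i (z t))) (at t within {a..b})"
    and unit: "\<And>t. t \<in> {a..b} \<Longrightarrow> (\<Sum>i<m. (u t i)\<^sup>2) = 1"
  shows "admissible_curve M A \<Delta> a b (\<lambda>t. chart_inv c (z t))"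
    and "curve_length A g a b (\<lambda>t. chart_inv c (z t)) \<le> ennreal (b - a)"
proof -
  define \<gamma> where "\<gamma> = (\<lambda>t. chart_inv c (z t))"
  define v where "v = (\<lambda>t. \<Sum>i<m. u t i *\<^sub>R Y i (\<gamma> t))"
  have \<gamma>: "\<gamma> t \<in> fst c" "\<gamma> t \<in> W" "snd c (\<gamma> t) = z t" if "t \<in> {a..b}" for t
    using chart_inv_cball[OF zC[OF that]] by (auto simp: \<gamma>_def)
  have \<gamma>M: "\<gamma> t \<in> topspace M" if "t \<in> {a..b}" for t using \<gamma>(1)[OF that] chart_subset[OF cA] by blast
  have v\<Delta>: "v t \<in> \<Delta> (\<gamma> t)" if "t \<in> {a..b}" for t
    unfolding v_def
    by (intro subspace_sum subspace_scale distribution[OF \<gamma>M[OF that]])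
      (use frame \<gamma>(2)[OF that] in \<open>auto simp: orthonormal_frame_def intro: C11_section_mem\<close>)
  have vT: "v t \<in> tangent_space A (\<gamma> t)" if "t \<in> {a..b}" for t
    using v\<Delta>[OF that] distribution(1)[OF \<gamma>M[OF that]] by blast
  have vc: "coords (v t) c = (\<Sum>i<m. u t i *\<^sub>R y i (z t))" for t by (simp add: v_def \<gamma>_def)
  have vel_c: "((snd c' \<circ> \<gamma>) has_vector_derivative coords (v t) c') (at t within {a..b})"
    if t: "t \<in> {a..b}" and c': "c' \<in> A" "\<gamma> t \<in> fst c'" for t c'
  proof -
    let ?D = "frechet_derivative (transition c c') (at (snd c (\<gamma> t)))"
    have T: "(transition c c' has_derivative ?D) (at (z t))"
      using transition_has_derivative[OF cA c'(1) \<gamma>(1)[OF t] c'(2)] \<gamma>(3)[OF t] by simp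
    have lin: "linear ?D" using T by (rule has_derivative_linear)
    have "((\<lambda>t. transition c c' (z t)) has_derivative (\<lambda>h. ?D (h *\<^sub>R coords (v t) c))) (at t within {a..b})"
      using has_derivative_compose[OF dz[OF t, unfolded has_vector_derivative_def] T] by (simp add: vc)
    moreover have "(\<lambda>t. transition c c' (z t)) = snd c' \<circ> \<gamma>" by (auto simp: transition_def \<gamma>_def)
    moreover have "coords (v t) c' = ?D (coords (v t) c)"
      by (rule tangent_space_transform[OF vT[OF t] cA c'(1) \<gamma>(1)[OF t] c'(2)])
    ultimately show ?thesis by (simp add: has_vector_derivative_def linear_scale[OF lin])
  qed
  have vel: "has_velocity A {a..b} \<gamma> (v t) t" if "t \<in> {a..b}" for t
    unfolding has_velocity_def using vT[OF that] vel_c[OF that] by blast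
  have zcont: "continuous_on {a..b} z"
    using dz has_vector_derivative_continuous continuous_on_eq_continuous_within by blast
  have vb: "norm (coords (v t) c) \<le> real m * B" if t: "t \<in> {a..b}" for t
  proof -
    have "norm (u t i *\<^sub>R y i (z t)) \<le> B" if i: "i < m" for i
    proof -
      have "(u t i)\<^sup>2 \<le> (\<Sum>i<m. (u t i)\<^sup>2)" by (rule member_le_sum) (use i in auto)
      then have "\<bar>u t i\<bar> \<le> 1" using unit[OF t] by (simp add: abs_square_le_1)
      from mult_mono[OF this y_le[OF i zC[OF t]]] show ?thesis by simp
    qed
    then show ?thesis
      unfolding vc using sum_norm_bound[of "{..<m}" "\<lambda>i. u t i *\<^sub>R y i (z t)" B] by simp
  qed
  have ac: "abs_continuous_on_interval s t (snd c' \<circ> \<gamma>)"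
    if c': "c' \<in> A" and st: "a \<le> s" "s \<le> t" "t \<le> b" "\<gamma> ` {s..t} \<subseteq> fst c'" for s t c'
  proof -
    let ?D = "\<lambda>x. frechet_derivative (transition c c') (at x)"
    have sub: "{s..t} \<subseteq> {a..b}" using st by auto
    have Ck: "Ck_on (Suc 0) (transition c c') (snd c ` (fst c \<inter> fst c'))"
      using smooth_transition[OF cA c'] unfolding smooth_on_def by blast
    have zin: "z r \<in> snd c ` (fst c \<inter> fst c')" if "r \<in> {s..t}" for r
      using \<gamma>[of r] that sub st(4) by (intro image_eqI[of _ _ "\<gamma> r"]) auto
    have "\<exists>N. \<forall>r\<in>{s..t}. norm (?D (z r) e) \<le> N" for e
    proof -
      have "continuous_on (snd c ` (fst c \<inter> fst c')) (\<lambda>x. ?D x e)" using Ck by simp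
      then have "continuous_on {s..t} (\<lambda>r. ?D (z r) e)"
        by (rule continuous_on_compose2[OF _ continuous_on_subset[OF zcont sub]]) (use zin in auto)
      then have "bounded ((\<lambda>r. ?D (z r) e) ` {s..t})"
        by (intro compact_imp_bounded compact_continuous_image) auto
      then show ?thesis by (auto simp: bounded_iff)
    qed
    then obtain N where N: "\<And>e r. r \<in> {s..t} \<Longrightarrow> norm (?D (z r) e) \<le> N e" by metis
    define L where "L = (\<Sum>e\<in>(Basis::'e set). (real m * B) * max (N e) 0)"
    have L: "L \<ge> 0" using B unfolding L_def by (intro sum_nonneg mult_nonneg_nonneg) auto
    have vL: "norm (coords (v r) c') \<le> L" if r: "r \<in> {s..t}" for r
    proof -
      have rab: "r \<in> {a..b}" and rc': "\<gamma> r \<in> fst c'" using r sub st(4) by auto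
      have lin: "linear (?D (z r))"
        using has_derivative_linear[OF transition_has_derivative[OF cA c' \<gamma>(1)[OF rab] rc']] \<gamma>(3)[OF rab] by simp
      let ?w = "coords (v r) c"
      have "coords (v r) c' = ?D (z r) ?w"
        using tangent_space_transform[OF vT[OF rab] cA c' \<gamma>(1)[OF rab] rc'] \<gamma>(3)[OF rab] by simp
      also have "\<dots> = ?D (z r) (\<Sum>e\<in>Basis. (?w \<bullet> e) *\<^sub>R e)" by (simp add: euclidean_representation)
      also have "\<dots> = (\<Sum>e\<in>Basis. (?w \<bullet> e) *\<^sub>R ?D (z r) e)"
        by (simp add: linear_sum[OF lin] linear_scale[OF lin])
      also have "norm \<dots> \<le> L"
        unfolding L_def
      proof (rule sum_norm_le)
        fix e :: 'e assume e: "e \<in> Basis"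
        have "\<bar>?w \<bullet> e\<bar> \<le> real m * B" using Basis_le_norm[OF e, of ?w] vb[OF rab] by linarith
        moreover have "norm (?D (z r) e) \<le> max (N e) 0" using N[OF r, of e] by simp
        ultimately show "norm ((?w \<bullet> e) *\<^sub>R ?D (z r) e) \<le> (real m * B) * max (N e) 0"
          using B by (simp add: mult_mono)
      qed
      finally show ?thesis .
    qed
    have "L-lipschitz_on {s..t} (snd c' \<circ> \<gamma>)"
    proof (rule lipschitz_onI[OF _ L])
      fix r r' assume r: "r \<in> {s..t}" "r' \<in> {s..t}"
      have "norm ((snd c' \<circ> \<gamma>) r - (snd c' \<circ> \<gamma>) r') \<le> L * norm (r - r')"
      proof (rule differentiable_bound[of "{s..t}" _ "\<lambda>r h. h *\<^sub>R coords (v r) c'"])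
        fix r assume r: "r \<in> {s..t}"
        have "((snd c' \<circ> \<gamma>) has_vector_derivative coords (v r) c') (at r within {s..t})"
          by (rule has_vector_derivative_within_subset[OF vel_c sub]) (use r sub st(4) c' in auto)
        then show "((snd c' \<circ> \<gamma>) has_derivative (\<lambda>h. h *\<^sub>R coords (v r) c')) (at r within {s..t})"
          by (simp add: has_vector_derivative_def)
        show "onorm (\<lambda>h. h *\<^sub>R coords (v r) c') \<le> L"
          using vL[OF r] by (simp add: onorm_scaleR_left onorm_id)
      qed (use r in auto)
      then show "dist ((snd c' \<circ> \<gamma>) r) ((snd c' \<circ> \<gamma>) r') \<le> L * dist r r'" by (simp add: dist_norm)
    qed
    then show ?thesis by (rule lipschitz_imp_abs_continuous)
  qed
  have "continuous_map (top_of_set {a..b}) (top_of_set (snd c ` fst c)) z"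
    using zcont \<gamma>(1,3) by (auto simp: continuous_map_in_subtopology) (metis image_eqI)
  from continuous_map_compose[OF this continuous_map_chart_inv[OF cA]]
  have cont: "continuous_map (top_of_set {a..b}) M \<gamma>" by (simp add: \<gamma>_def o_def)
  have "AE t in lebesgue. t \<in> {a..b} \<longrightarrow> (\<exists>w\<in>\<Delta> (\<gamma> t). has_velocity A {a..b} \<gamma> w t)"
    using v\<Delta> vel by (intro AE_I2) blast
  then have "admissible_curve M A \<Delta> a b \<gamma>"
    unfolding admissible_curve_def abs_continuous_curve_def using ab cont ac by blast
  then show "admissible_curve M A \<Delta> a b (\<lambda>t. chart_inv c (z t))" by (simp add: \<gamma>_def)
  have "curve_length A g a b \<gamma> = (\<integral>\<^sup>+t. indicator {a..b} t \<partial>lebesgue)"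
    unfolding curve_length_eq
  proof (rule nn_integral_cong)
    fix t
    show "speed a b \<gamma> t * indicator {a..b} t = indicator {a..b} t"
    proof (cases "t \<in> {a..b}")
      case True
      have "g (\<gamma> t) (v t) (v t) = 1"
        using orthonormal_frame_norm[OF frame \<gamma>(2)[OF True], of "v t" "u t"] unit[OF True] by (simp add: v_def)
      then show ?thesis using velocity_eq[OF vel[OF True] True ab] by (simp add: speed_def)
    qed simp
  qed
  also have "\<dots> = ennreal (b - a)" using ab by simp
  finally show "curve_length A g a b (\<lambda>t. chart_inv c (z t)) \<le> ennreal (b - a)" by (simp add: \<gamma>_def)
qed

text \<open>Let \<open>\<gamma>\<close> be the calibrated extremal through \<open>q\<close>. For \<open>s < r\<close> the points \<open>\<gamma> (-s)\<close> and \<open>\<gamma> s\<close> lie in the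
  ball. A curve between them of length less than \<open>2 * s\<close> would stay in the domain of the calibration, and
  would then have length at least \<open>S (\<gamma> s) - S (\<gamma> (-s)) = 2 * s\<close>.\<close>

lemma sharp_diameter_near:
  obtains V rbar where "openin M V" "\<And>p. p \<in> fst c \<Longrightarrow> snd c p = x0 \<Longrightarrow> p \<in> V" "rbar > 0"
    "\<And>r q. 0 < r \<Longrightarrow> r < rbar \<Longrightarrow> q \<in> V \<Longrightarrow> cc_diameter M A \<Delta> g (cc_ball M A \<Delta> g q r) = ennreal (2 * r)"
proof -
  \<comment> \<open>a coordinate vector vanishes only for the zero tangent vector, and \<open>Y 0\<close> has unit length\<close>
  have "y 0 x0 \<noteq> 0"
  proof
    assume y0: "y 0 x0 = 0"
    let ?p = "chart_inv c x0"
    have x0: "x0 \<in> cball x0 \<rho>" using \<rho> by simp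
    note p = chart_inv_cball[OF x0]
    have pM: "?p \<in> topspace M" using p(1) chart_subset[OF cA] by blast
    have mem: "Y 0 ?p \<in> \<Delta> ?p"
      using frame p(2) m_pos by (auto simp: orthonormal_frame_def intro: C11_section_mem)
    have "Y 0 ?p = 0"
      by (rule tangent_vector_zero[OF cA p(1) subsetD[OF distribution(1)[OF pM] mem] y0])
    moreover have "g ?p (Y 0 ?p) (Y 0 ?p) = 1" using frame p(2) m_pos by (auto simp: orthonormal_frame_def)
    moreover have "g ?p 0 0 = 0"
      using inner_product_onD(3)[OF distribution(4)[OF pM] mem mem, of 0] calculation(1) by simp
    ultimately show False by simp
  qed
  from frame_calibration[OF m_pos this]
  obtain R T L where R: "R > 0" "R \<le> \<rho>" and T: "T > 0"
    and cal: "\<And>q. q \<in> ball x0 (R/4) \<Longrightarrow> \<exists>\<gamma> u S S'. \<gamma> 0 = q \<and>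
       (\<forall>t\<in>{-T..T}. \<gamma> t \<in> ball x0 (R/2) \<and> (\<Sum>i<m. (u t i)\<^sup>2) = 1 \<and>
          (\<gamma> has_vector_derivative (\<Sum>i<m. u t i *\<^sub>R y i (\<gamma> t))) (at t within {-T..T}) \<and> S (\<gamma> t) = t) \<and>
       calibration R L S S'" by blast
  define C where "C = real m * B"
  have C: "C > 0" using m_pos B by (simp add: C_def)
  define rbar where "rbar = min T (R / (8 * C))"
  have rbar: "rbar > 0" using T R C by (simp add: rbar_def)
  have ge: "ennreal (2 * s) \<le> cc_diameter M A \<Delta> g (cc_ball M A \<Delta> g q r)"
    if q: "q \<in> chart_ball (R/4)" and s: "0 < s" "s < r" "r < rbar" for q r s
  proof -
    have qc: "q \<in> fst c" "snd c q \<in> ball x0 (R/4)" using q by (auto simp: chart_ball_def)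
    obtain \<gamma> u S S' where \<gamma>0: "\<gamma> 0 = snd c q"
      and \<gamma>: "\<And>t. t \<in> {-T..T} \<Longrightarrow> \<gamma> t \<in> ball x0 (R/2)" "\<And>t. t \<in> {-T..T} \<Longrightarrow> (\<Sum>i<m. (u t i)\<^sup>2) = 1"
        "\<And>t. t \<in> {-T..T} \<Longrightarrow> (\<gamma> has_vector_derivative (\<Sum>i<m. u t i *\<^sub>R y i (\<gamma> t))) (at t within {-T..T})"
        "\<And>t. t \<in> {-T..T} \<Longrightarrow> S (\<gamma> t) = t"
      and S: "calibration R L S S'"
      using cal[OF qc(2)] by blast
    have sT: "s < T" using s by (simp add: rbar_def)
    have sub: "{-s..0} \<subseteq> {-T..T}" "{0..s} \<subseteq> {-T..T}" "-s \<in> {-T..T}" "s \<in> {-T..T}" using s sT by auto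
    have \<gamma>\<rho>: "\<gamma> t \<in> cball x0 \<rho>" if "t \<in> {-T..T}" for t using \<gamma>(1)[OF that] R by auto
    define x where "x = chart_inv c (\<gamma> (-s))"
    define x' where "x' = chart_inv c (\<gamma> s)"
    have x: "x \<in> fst c" "snd c x = \<gamma> (-s)" and x': "x' \<in> fst c" "snd c x' = \<gamma> s"
      using chart_inv_cball[OF \<gamma>\<rho>[OF sub(3)]] chart_inv_cball[OF \<gamma>\<rho>[OF sub(4)]] by (auto simp: x_def x'_def)
    have q0: "chart_inv c (\<gamma> 0) = q" using \<gamma>0 chart_inv_apply[OF cA qc(1)] by simp
    have half: "cc_dist M A \<Delta> g (chart_inv c (\<gamma> a)) (chart_inv c (\<gamma> b)) \<le> ennreal (b - a)"
      if ab: "a < b" "{a..b} \<subseteq> {-T..T}" for a b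
    proof -
      have dz: "(\<gamma> has_vector_derivative (\<Sum>i<m. u t i *\<^sub>R y i (\<gamma> t))) (at t within {a..b})" if "t \<in> {a..b}" for t
        by (rule has_vector_derivative_within_subset[OF \<gamma>(3) ab(2)]) (use that ab(2) in blast)
      note adm = chart_curve_admissible[of a b \<gamma> u, OF ab(1) \<gamma>\<rho>[OF subsetD[OF ab(2)]] dz \<gamma>(2)[OF subsetD[OF ab(2)]]]
      show ?thesis by (rule order_trans[OF cc_dist_le_length[OF adm(1)] adm(2)])
    qed
    have "cc_dist M A \<Delta> g x q \<le> ennreal s" using half[OF _ sub(1)] s q0 by (simp add: x_def)
    then have "cc_dist M A \<Delta> g q x \<le> ennreal s" using cc_dist_commute_le order_trans by blast
    then have xB: "x \<in> cc_ball M A \<Delta> g q r"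
      using x(1) chart_subset[OF cA] s by (auto simp: cc_ball_def ennreal_lessI intro: order_le_less_trans)
    have "cc_dist M A \<Delta> g q x' \<le> ennreal s" using half[OF _ sub(2)] s q0 by (simp add: x'_def)
    then have x'B: "x' \<in> cc_ball M A \<Delta> g q r"
      using x'(1) chart_subset[OF cA] s by (auto simp: cc_ball_def ennreal_lessI intro: order_le_less_trans)
    have "ennreal (2 * s) \<le> cc_dist M A \<Delta> g x x'"
      unfolding cc_dist_def
    proof (rule Inf_greatest, safe)
      fix a b \<sigma> assume adm: "admissible_curve M A \<Delta> a b \<sigma>" and ends: "x = \<sigma> a" "x' = \<sigma> b"
      show "ennreal (2 * s) \<le> curve_length A g a b \<sigma>"
      proof (rule ccontr)
        assume lt: "\<not> ennreal (2 * s) \<le> curve_length A g a b \<sigma>"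
        then have len: "curve_length A g a b \<sigma> \<le> ennreal (2 * s)" by simp
        have start: "\<sigma> a \<in> chart_ball (R/2)"
          using x \<gamma>(1)[OF sub(3)] ends by (simp add: chart_ball_def)
        have "C * (2 * s) \<le> C * (2 * (R / (8 * C)))"
          using s C by (intro mult_left_mono) (auto simp: rbar_def)
        then have small: "real m * B * (2 * s) \<le> R / 4" using C by (simp add: C_def[symmetric])
        have stay: "\<sigma> t \<in> chart_ball R" if "t \<in> {a..b}" for t
          by (rule short_curve_stays[OF adm R start len _ small that]) (use s in simp)
        have ab: "a \<le> b" using adm by (simp add: admissible_curve_def)
        have "ennreal (S (snd c (\<sigma> b)) - S (snd c (\<sigma> a))) \<le> curve_length A g a b \<sigma>"
          by (rule calibration_le_length[OF adm ab order_refl R(2) stay S])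
        moreover have "S (snd c (\<sigma> b)) - S (snd c (\<sigma> a)) = 2 * s"
          using x(2) x'(2) ends \<gamma>(4)[OF sub(3)] \<gamma>(4)[OF sub(4)] by simp
        ultimately show False using lt by simp
      qed
    qed
    also have "\<dots> \<le> cc_diameter M A \<Delta> g (cc_ball M A \<Delta> g q r)"
      unfolding cc_diameter_def by (rule SUP_upper2[of "(x, x')"]) (use xB x'B in auto)
    finally show ?thesis .
  qed
  show thesis
  proof (rule that[OF openin_chart_ball[of "R/4"] _ rbar])
    show "p \<in> chart_ball (R/4)" if "p \<in> fst c" "snd c p = x0" for p
      using that R by (simp add: chart_ball_def)
  next
    fix r q assume r: "0 < r" "r < rbar" and q: "q \<in> chart_ball (R/4)"
    show "cc_diameter M A \<Delta> g (cc_ball M A \<Delta> g q r) = ennreal (2 * r)" (is "?d = _")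
    proof (rule antisym[OF cc_diameter_ball_le[OF r(1)]], rule ccontr)
      assume "\<not> ennreal (2 * r) \<le> ?d"
      then have lt: "?d < ennreal (2 * r)" by simp
      then have "?d = ennreal (enn2real ?d)" by (simp add: less_top order_less_trans[OF lt])
      then obtain d where d: "?d = ennreal d" "d \<ge> 0" using enn2real_nonneg by blast
      have "d < 2 * r" using lt d by (simp add: ennreal_less_iff)
      then obtain s where s: "max 0 (d / 2) < s" "s < r" using dense[of "max 0 (d / 2)" r] r by auto
      then have "ennreal (2 * s) \<le> ennreal d" using ge[OF q _ s(2) r(2)] d by simp
      then show False using s d by (simp add: ennreal_le_iff)
    qed
  qed
qed

end

lemma (in sub_riemannian) ex_adapted_chart:
  assumes p: "p \<in> topspace M" and m: "m > 0"
  obtains c W Y \<rho> B where "p \<in> fst c" "adapted_chart M A m \<Delta> g c W Y (snd c p) \<rho> B"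
proof -
  obtain c where c: "c \<in> A" "p \<in> fst c" using ex_chart[OF p] by blast
  obtain W Y where W: "p \<in> W" and frame: "orthonormal_frame W Y" using ex_orthonormal_frame[OF p] by blast
  let ?S = "snd c ` (fst c \<inter> W)" and ?x0 = "snd c p"
  let ?y = "\<lambda>i x. coords (Y i (chart_inv c x)) c"
  let ?D = "\<lambda>i x. frechet_derivative (?y i) (at x)"
  have S: "open ?S" using frame by (intro open_chart_image[OF c(1)]) (simp add: orthonormal_frame_def)
  have x0: "?x0 \<in> ?S" using c(2) W by blast
  have C11: "C11_on (?y i) ?S" if "i < m" for i
    using frame that by (intro C11_section_coords[OF _ c(1)]) (simp add: orthonormal_frame_def)
  have "\<exists>e B. i < m \<longrightarrow> e > 0 \<and> B \<ge> 0 \<and> cball ?x0 e \<subseteq> ?S \<and> (\<forall>x\<in>cball ?x0 e. norm (?y i x) \<le> B \<and>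
     (\<forall>h. norm (?D i x h) \<le> B * norm h) \<and>
     (\<forall>x'\<in>cball ?x0 e. \<forall>h. norm (?D i x h - ?D i x' h) \<le> B * norm (x - x') * norm h))" for i
  proof (cases "i < m")
    case True
    show ?thesis by (rule C11_on_local_bounds[OF C11[OF True] S x0]) blast
  qed simp
  then obtain e b where e: "\<And>i. i < m \<Longrightarrow> e i > 0" and b: "\<And>i. i < m \<Longrightarrow> b i \<ge> 0"
    and sub: "\<And>i. i < m \<Longrightarrow> cball ?x0 (e i) \<subseteq> ?S"
    and bd: "\<And>i x. i < m \<Longrightarrow> x \<in> cball ?x0 (e i) \<Longrightarrow> norm (?y i x) \<le> b i \<and>
     (\<forall>h. norm (?D i x h) \<le> b i * norm h) \<and>
     (\<forall>x'\<in>cball ?x0 (e i). \<forall>h. norm (?D i x h - ?D i x' h) \<le> b i * norm (x - x') * norm h)"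
    by metis
  define \<rho> where "\<rho> = Min (e ` {..<m})"
  define B where "B = 1 + (\<Sum>i<m. b i)"
  have ne: "{..<m} \<noteq> {}" using m by auto
  have \<rho>: "\<rho> > 0" using e ne by (simp add: \<rho>_def Min_gr_iff)
  have \<rho>e: "\<rho> \<le> e i" if "i < m" for i using that by (simp add: \<rho>_def)
  have bB: "b i \<le> B" if "i < m" for i
    using member_le_sum[of i "{..<m}" b] that b by (simp add: B_def)
  have cb: "x \<in> cball ?x0 (e i)" if "x \<in> cball ?x0 \<rho>" "i < m" for x i using that \<rho>e[OF that(2)] by auto
  have "adapted_chart M A m \<Delta> g c W Y ?x0 \<rho> B"
  proof (unfold_locales)
    show "1 \<le> B" using b sum_nonneg[of "{..<m}" b] by (simp add: B_def)
    show "cball ?x0 \<rho> \<subseteq> ?S" using sub[OF m] cb[OF _ m] by blast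
    fix i x assume i: "i < m" and x: "x \<in> cball ?x0 \<rho>"
    note bdi = bd[OF i cb[OF x i]]
    show "(?y i has_derivative ?D i x) (at x)"
      by (rule C11_onD(1)[OF C11[OF i]]) (use sub[OF i] cb[OF x i] in blast)
    show "norm (?y i x) \<le> B" using bdi bB[OF i] by linarith
    show "norm (?D i x h) \<le> B * norm h" for h
      using bdi mult_right_mono[OF bB[OF i], of "norm h"] by (meson norm_ge_zero order_trans)
    fix x' h assume x': "x' \<in> cball ?x0 \<rho>"
    have "norm (?D i x h - ?D i x' h) \<le> b i * norm (x - x') * norm h" using bdi cb[OF x' i] by blast
    also have "\<dots> \<le> B * norm (x - x') * norm h" by (intro mult_right_mono bB i) auto
    finally show "norm (?D i x h - ?D i x' h) \<le> B * norm (x - x') * norm h" .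
  qed (use \<rho> c frame m in auto)
  then show thesis using that c(2) by blast
qed

section \<open>The diameter of small balls\<close>

theorem theorem1p1:
  fixes M :: "'a topology"
    and A :: "('a, 'e::euclidean_space) chart set"
    and m :: nat
    and \<Delta> :: "'a \<Rightarrow> ('a, 'e) tvec set"
    and g :: "'a \<Rightarrow> ('a, 'e) tvec \<Rightarrow> ('a, 'e) tvec \<Rightarrow> real"
  assumes "C11_sub_riemannian_manifold M A m \<Delta> g"
    and "1 \<le> m"
  shows "\<forall>p\<in>topspace M. \<exists>V rbar. openin M V \<and> p \<in> V \<and> 0 < rbar \<and>
           (\<forall>r q. 0 < r \<and> r < rbar \<and> q \<in> V \<longrightarrow>
              cc_diameter M A \<Delta> g (cc_ball M A \<Delta> g q r) = ennreal (2 * r))"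
proof
  fix p assume p: "p \<in> topspace M"
  interpret sub_riemannian M A m \<Delta> g by (unfold_locales) (rule assms(1))
  have m: "m > 0" using assms(2) by simp
  obtain c W Y \<rho> B where pc: "p \<in> fst c" and ad: "adapted_chart M A m \<Delta> g c W Y (snd c p) \<rho> B"
    by (rule ex_adapted_chart[OF p m])
  obtain V rbar where "openin M V" "\<And>p'. p' \<in> fst c \<Longrightarrow> snd c p' = snd c p \<Longrightarrow> p' \<in> V" "rbar > 0"
    "\<And>r q. 0 < r \<Longrightarrow> r < rbar \<Longrightarrow> q \<in> V \<Longrightarrow> cc_diameter M A \<Delta> g (cc_ball M A \<Delta> g q r) = ennreal (2 * r)"
    by (rule adapted_chart.sharp_diameter_near[OF ad]) blast
  then show "\<exists>V rbar. openin M V \<and> p \<in> V \<and> 0 < rbar \<and>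
           (\<forall>r q. 0 < r \<and> r < rbar \<and> q \<in> V \<longrightarrow>
              cc_diameter M A \<Delta> g (cc_ball M A \<Delta> g q r) = ennreal (2 * r))"
    using pc by (intro exI[of _ V] exI[of _ rbar]) blast
qed

end
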